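(* Let $n\ge1$ be an integer, $Q=2n+2$, $q^*=\frac{Q+2}{Q-2}$, and let $1<q<q^*$. There is a constant $C>0$ depending only on $n$ and $q$ such that the following holds. Let $\Omega\subset\mathbb{H}^n$ be a domain, let $\xi_0\in\mathbb{H}^n$ and $r>0$ be such that $B_{4r}(\xi_0)\subset\Omega$, and let $u$ be a positive smooth solution of $$-\triangle_{\mathbb{H}^n}u=2n^2u^{q}\quad\text{in }\Omega.$$ Then $$\int_{B_r(\xi_0)}u^{3q-q^*}\le C\,r^{\,Q-2\cdot\frac{3q-q^*}{q-1}}.$$
   Context: The Heisenberg group $\mathbb{H}^n$ is the set $\mathbb{C}^n\times\mathbb{R}$ with coordinates $(z,t)$, $z=(z^1,\dots,z^n)$, and group law $(z,t)\circ(\zeta,s)=\big(z+\zeta,\,t+s+2\,\mathrm{Im}\sum_{\alpha}z^\alpha\overline{\zeta}^\alpha\big)$. Put $Z_\alpha=\frac{\partial}{\partial z^\alpha}+\sqrt{-1}\,\overline{z}^{\alpha}\frac{\partial}{\partial t}$ for $\alpha=1,\dots,n$, and $Z_{\overline{\alpha}}=\overline{Z_\alpha}=\frac{\partial}{\partial\overline{z}^\alpha}-\sqrt{-1}\,z^{\alpha}\frac{\partial}{\partial t}$. The Heisenberg Laplacian of a smooth real function $u$ is $\triangle_{\mathbb{H}^n}u=\sum_{\alpha=1}^n\big(u_{\alpha\overline{\alpha}}+u_{\overline{\alpha}\alpha}\big)=\sum_{\alpha=1}^n\big(Z_{\overline{\alpha}}Z_\alpha u+Z_\alpha Z_{\overline{\alpha}}u\big)$.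 The number $Q=2n+2$ is the homogeneous dimension. For $\xi=(z,t)$ let $|\xi|=(|z|^4+t^2)^{1/4}$, and let $B_r(\xi_0)=\{\xi:|\xi_0^{-1}\circ\xi|<r\}$ be the ball of radius $r$ centered at $\xi_0$. Integrals are with respect to Lebesgue (Haar) measure on $\mathbb{C}^n\times\mathbb{R}$. *)

theory Defs
  imports "HOL-Analysis.Analysis"
begin

text \<open>The Heisenberg group of complex dimension CARD('n), with coordinates (z, t).\<close>

type_synonym 'n heis = "(complex ^ 'n) \<times> real"

definition heis_mult :: "('n::finite) heis \<Rightarrow> 'n heis \<Rightarrow> 'n heis" where
  "heis_mult \<xi> \<eta> = (fst \<xi> + fst \<eta>,
     snd \<xi> + snd \<eta> + 2 * Im (\<Sum>\<alpha>\<in>UNIV. fst \<xi> $ \<alpha> * cnj (fst \<eta> $ \<alpha>)))"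

definition heis_inv :: "('n::finite) heis \<Rightarrow> 'n heis" where
  "heis_inv \<xi> = (- fst \<xi>, - snd \<xi>)"

lemma heis_mult_0: "heis_mult \<xi> 0 = \<xi>" "heis_mult 0 \<xi> = \<xi>"
  by (simp_all add: heis_mult_def)

lemma heis_mult_inv: "heis_mult \<xi> (heis_inv \<xi>) = 0" "heis_mult (heis_inv \<xi>) \<xi> = 0"
  by (simp_all add: heis_mult_def heis_inv_def zero_prod_def)

text \<open>The norm of \<^typ>\<open>complex ^ 'n\<close> is the Euclidean one, as in the gauge
  $|\xi| = (|z|^4 + t^2)^{1/4}$.\<close>

definition heis_norm :: "('n::finite) heis \<Rightarrow> real" where
  "heis_norm \<xi> = root 4 (norm (fst \<xi>) ^ 4 + (snd \<xi>)\<^sup>2)"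

definition heis_ball :: "('n::finite) heis \<Rightarrow> real \<Rightarrow> 'n heis set" where
  "heis_ball \<xi>0 r = {\<xi>. heis_norm (heis_mult (heis_inv \<xi>0) \<xi>) < r}"

definition dir_deriv :: "'a::real_normed_vector \<Rightarrow> ('a \<Rightarrow> 'b::real_normed_vector) \<Rightarrow> 'a \<Rightarrow> 'b" where
  "dir_deriv v f x = frechet_derivative f (at x) v"

text \<open>$C^k$ and $C^\infty$ regularity on an open set, for functions on a finite-dimensional space:
  all iterated directional derivatives exist (as values of Frechet derivatives)
  and are continuous.\<close>

fun Ck_on :: "nat \<Rightarrow> 'a::euclidean_space set \<Rightarrow> ('a \<Rightarrow> 'b::real_normed_vector) \<Rightarrow> bool" where
  "Ck_on 0 S f \<longleftrightarrow> continuous_on S f"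
| "Ck_on (Suc k) S f \<longleftrightarrow> (\<forall>x\<in>S. f differentiable at x) \<and> (\<forall>v. Ck_on k S (dir_deriv v f))"

definition smooth_on :: "'a::euclidean_space set \<Rightarrow> ('a \<Rightarrow> 'b::real_normed_vector) \<Rightarrow> bool" where
  "smooth_on S f \<longleftrightarrow> (\<forall>k. Ck_on k S f)"

text \<open>The Wirtinger derivatives $\frac12(\partial_x \mp i\,\partial_y)$ in the variable
  $z^\alpha = x + i y$.\<close>

definition d_z :: "'n::finite \<Rightarrow> ('n heis \<Rightarrow> complex) \<Rightarrow> 'n heis \<Rightarrow> complex" where
  "d_z \<alpha> f \<xi> = (dir_deriv (axis \<alpha> 1, 0) f \<xi> - \<i> * dir_deriv (axis \<alpha> \<i>, 0) f \<xi>) / 2"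

definition d_zbar :: "'n::finite \<Rightarrow> ('n heis \<Rightarrow> complex) \<Rightarrow> 'n heis \<Rightarrow> complex" where
  "d_zbar \<alpha> f \<xi> = (dir_deriv (axis \<alpha> 1, 0) f \<xi> + \<i> * dir_deriv (axis \<alpha> \<i>, 0) f \<xi>) / 2"

definition d_t :: "(('n::finite) heis \<Rightarrow> complex) \<Rightarrow> 'n heis \<Rightarrow> complex" where
  "d_t f \<xi> = dir_deriv (0, 1) f \<xi>"

definition Z :: "'n::finite \<Rightarrow> ('n heis \<Rightarrow> complex) \<Rightarrow> 'n heis \<Rightarrow> complex" where
  "Z \<alpha> f \<xi> = d_z \<alpha> f \<xi> + \<i> * cnj (fst \<xi> $ \<alpha>) * d_t f \<xi>"

definition Zbar :: "'n::finite \<Rightarrow> ('n heis \<Rightarrow> complex) \<Rightarrow> 'n heis \<Rightarrow> complex" where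
  "Zbar \<alpha> f \<xi> = d_zbar \<alpha> f \<xi> - \<i> * (fst \<xi> $ \<alpha>) * d_t f \<xi>"

text \<open>The value is typed as a complex number, since the fields act on complex-valued functions;
  it is real wherever \<open>u\<close> is smooth.\<close>

definition heis_laplacian :: "(('n::finite) heis \<Rightarrow> real) \<Rightarrow> 'n heis \<Rightarrow> complex" where
  "heis_laplacian u \<xi> =
     (\<Sum>\<alpha>\<in>UNIV. Zbar \<alpha> (Z \<alpha> (\<lambda>\<eta>. complex_of_real (u \<eta>))) \<xi>
              + Z \<alpha> (Zbar \<alpha> (\<lambda>\<eta>. complex_of_real (u \<eta>))) \<xi>)"

end

theory Submission
  imports Defs
begin

text \<open>With $u = e^{nf}$ and $p = n(q-1)-2 \in (-2,0)$ the equation becomes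
  $\sum_\alpha f_{\alpha\bar\alpha} = -n g$, where $g = |\partial f|^2 + e^{(2+p)f} - i f_0$.
  A weighted vector field of Jerison--Lee type, built from the tensors
  $D_{\alpha\beta} = f_{\alpha\beta} - 2f_\alpha f_\beta$ and
  $E_{\alpha\bar\beta} = f_{\alpha\bar\beta} + g\,\delta_{\alpha\beta}$,
  has a divergence that is a sum of squares up to terms carrying the good sign of $-p > 0$.
  Two lower order fields are added, so that the squares also control $|\partial f|^6$ and
  $e^{3(2+p)f}$, together with a multiple of $i f_0 \partial f$ scaled by $r^{-2}$, which yields
  $r^{-2} f_0^2$. After multiplication by a power of a cutoff every error term is absorbed
  pointwise by Young's inequality, and since the total divergence of the compactly supported
  field integrates to zero, the bound for
  $\int e^{(2(n-1)+3(2+p))f} = \int u^{3q-q^*}$ follows.\<close>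

section \<open>Directional derivatives and smooth functions\<close>

text \<open>Here p < 0 says exactly that q is subcritical, and p > -2 that q > 1. At p = 0 the
  squares control only the tensors; the terms with factor -p, of size e^((2+p)f) |df|^2 (|df|^2 +
  e^((2+p)f)), pay for the wrongly signed mixed terms of the two lower order fields. Two obstacles
  shape the rest. Derivatives of the cutoff meet a factor f_0, and the available good term in f_0^2
  carries e^((2+p)f), which may be arbitrarily small; the field i f_0 df is added because its
  divergence contains n f_0^2 without that factor. Moreover, Young's inequality leaves the weight
  times a power of 1/r, and the weight is not bounded a priori when n > 1. Where this error is not
  dominated by the good cube, e^((2+p)f) is bounded by a power of 1/(r * cutoff), hence so is the
  weight, which is a nonnegative power of it.\<close>

lemma has_derivative_dir_deriv:
  "f differentiable at x \<Longrightarrow> (f has_derivative (\<lambda>v. dir_deriv v f x)) (at x)"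
  unfolding dir_deriv_def by (simp add: frechet_derivative_works[symmetric] eta_contract_eq)

lemma dir_deriv_eqI: "(f has_derivative f') (at x) \<Longrightarrow> dir_deriv v f x = f' v"
  unfolding dir_deriv_def by (metis frechet_derivative_at)

lemma dir_deriv_cong_open:
  assumes "open S" "x \<in> S" "\<And>y. y \<in> S \<Longrightarrow> f y = g y"
  shows "dir_deriv v f x = dir_deriv v g x"
proof (cases "f differentiable at x")
  case True
  then have "(f has_derivative (\<lambda>v. dir_deriv v f x)) (at x)"
    by (rule has_derivative_dir_deriv)
  then have "(g has_derivative (\<lambda>v. dir_deriv v f x)) (at x)"
    using assms by (rule has_derivative_transform_within_open)
  then show ?thesis by (simp add: dir_deriv_eqI)
next
  case False
  \<comment> \<open>Without differentiability, \<open>frechet_derivative\<close> is a choice from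
    the set of derivatives; these sets agree for f and g, hence so do the chosen values.\<close>
  have "(f has_derivative D) (at x) \<longleftrightarrow> (g has_derivative D) (at x)" for D
    using assms has_derivative_transform_within_open[of f D x UNIV S g]
      has_derivative_transform_within_open[of g D x UNIV S f] by auto
  then show ?thesis unfolding dir_deriv_def frechet_derivative_def by simp
qed

lemma dir_deriv_add:
  "f differentiable at x \<Longrightarrow> g differentiable at x \<Longrightarrow>
    dir_deriv v (\<lambda>y. f y + g y) x = dir_deriv v f x + dir_deriv v g x"
  by (rule dir_deriv_eqI) (intro has_derivative_add has_derivative_dir_deriv)

lemma dir_deriv_mult:
  fixes f g :: "'a::real_normed_vector \<Rightarrow> 'b::real_normed_algebra"
  shows "f differentiable at x \<Longrightarrow> g differentiable at x \<Longrightarrow>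
    dir_deriv v (\<lambda>y. f y * g y) x = f x * dir_deriv v g x + dir_deriv v f x * g x"
  by (rule dir_deriv_eqI[OF has_derivative_mult]) (auto intro: has_derivative_dir_deriv)

lemma dir_deriv_const [simp]: "dir_deriv v (\<lambda>y. c) x = 0"
  by (rule dir_deriv_eqI) simp

lemma dir_deriv_bounded_linear:
  "bounded_linear l \<Longrightarrow> f differentiable at x \<Longrightarrow>
    dir_deriv v (\<lambda>y. l (f y)) x = l (dir_deriv v f x)"
  by (rule dir_deriv_eqI[OF bounded_linear.has_derivative]) (auto intro: has_derivative_dir_deriv)

lemma dir_deriv_linear_self: "bounded_linear l \<Longrightarrow> dir_deriv v l x = l v"
  by (rule dir_deriv_eqI) (rule bounded_linear_imp_has_derivative)

lemma dir_deriv_real_chain: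
  fixes f :: "'a::real_normed_vector \<Rightarrow> real" and \<phi> :: "real \<Rightarrow> real"
  assumes "f differentiable at x" "(\<phi> has_real_derivative d) (at (f x))"
  shows "dir_deriv v (\<lambda>y. \<phi> (f y)) x = d * dir_deriv v f x"
proof -
  have "((\<lambda>y. \<phi> (f y)) has_derivative (\<lambda>v. d * dir_deriv v f x)) (at x)"
    using has_derivative_compose[OF has_derivative_dir_deriv[OF assms(1)]
        assms(2)[unfolded has_field_derivative_def]]
    by (simp add: mult.commute)
  then show ?thesis by (rule dir_deriv_eqI)
qed

lemma differentiable_cong_open:
  "open S \<Longrightarrow> x \<in> S \<Longrightarrow> (\<And>y. y \<in> S \<Longrightarrow> f y = g y) \<Longrightarrow>
    f differentiable at x \<longleftrightarrow> g differentiable at x"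
  unfolding differentiable_def
  using has_derivative_transform_within_open[of f _ x UNIV S g]
    has_derivative_transform_within_open[of g _ x UNIV S f] by auto

text \<open>\<open>Ck_on\<close> speaks of \<open>dir_deriv v f\<close> as a function on the whole
  space, while calculus rules give its value only at points of S. Openness of S makes the values off
  S irrelevant, so the closure proofs can rewrite derivatives through this lemma.\<close>

lemma Ck_on_cong:
  assumes "open S" "\<And>y. y \<in> S \<Longrightarrow> f y = g y" "Ck_on k S f"
  shows "Ck_on k S g"
  using assms(2,3)
proof (induction k arbitrary: f g)
  case 0
  then show ?case by (simp cong: continuous_on_cong)
next
  case (Suc k)
  have "Ck_on k S (dir_deriv v g)" for v
    using Suc.IH[of "dir_deriv v f" "dir_deriv v g"] Suc.prems
      dir_deriv_cong_open[OF assms(1), of _ f g v] by auto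
  then show ?case
    using Suc.prems differentiable_cong_open[OF assms(1), of _ f g] by auto
qed

lemma Ck_on_Suc_imp: "Ck_on (Suc k) S f \<Longrightarrow> Ck_on k S f"
proof (induction k arbitrary: f)
  case 0
  then show ?case
    by (auto intro!: continuous_at_imp_continuous_on differentiable_imp_continuous_within)
qed auto

lemma Ck_on_const: "Ck_on k (S :: 'a::euclidean_space set) (\<lambda>x. c)"
proof (induction k arbitrary: c)
  case (Suc k)
  have "dir_deriv v (\<lambda>x. c) = (\<lambda>x. 0)" for v :: 'a by (rule ext) simp
  with Suc show ?case by simp
qed simp

lemma Ck_on_add:
  assumes "open S" "Ck_on k S f" "Ck_on k S g"
  shows "Ck_on k S (\<lambda>x. f x + g x)"
  using assms(2,3)
proof (induction k arbitrary: f g)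
  case 0
  then show ?case by (auto intro: continuous_intros)
next
  case (Suc k)
  have "Ck_on k S (dir_deriv v (\<lambda>x. f x + g x))" for v
    by (rule Ck_on_cong[OF assms(1) _ Suc.IH[of "dir_deriv v f" "dir_deriv v g"]])
       (use Suc.prems in \<open>auto simp: dir_deriv_add\<close>)
  with Suc.prems show ?case by auto
qed

lemma Ck_on_mult:
  fixes f g :: "'a::euclidean_space \<Rightarrow> 'b::real_normed_algebra"
  assumes "open S" "Ck_on k S f" "Ck_on k S g"
  shows "Ck_on k S (\<lambda>x. f x * g x)"
  using assms(2,3)
proof (induction k arbitrary: f g)
  case 0
  then show ?case by (auto intro: continuous_intros)
next
  case (Suc k)
  have "Ck_on k S (dir_deriv v (\<lambda>x. f x * g x))" for v
  proof (rule Ck_on_cong[OF assms(1)])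
    show "Ck_on k S (\<lambda>x. f x * dir_deriv v g x + dir_deriv v f x * g x)"
      using Suc.prems Suc.prems[THEN Ck_on_Suc_imp]
      by (intro Ck_on_add[OF assms(1)] Suc.IH) auto
  qed (use Suc.prems in \<open>auto simp: dir_deriv_mult\<close>)
  moreover have "(\<lambda>x. f x * g x) differentiable at x" if "x \<in> S" for x
    using Suc.prems that
    by (intro differentiableI[OF has_derivative_mult[OF has_derivative_dir_deriv has_derivative_dir_deriv]]) auto
  ultimately show ?case by auto
qed

lemma Ck_on_bounded_linear:
  assumes "open S" "bounded_linear l" "Ck_on k S f"
  shows "Ck_on k S (\<lambda>x. l (f x))"
  using assms(3)
proof (induction k arbitrary: f)
  case 0
  then show ?case by (auto intro: bounded_linear.continuous_on[OF assms(2)])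
next
  case (Suc k)
  have "Ck_on k S (dir_deriv v (\<lambda>x. l (f x)))" for v
    by (rule Ck_on_cong[OF assms(1) _ Suc.IH[of "dir_deriv v f"]])
       (use Suc.prems in \<open>auto simp: dir_deriv_bounded_linear[OF assms(2)]\<close>)
  moreover have "(\<lambda>x. l (f x)) differentiable at x" if "x \<in> S" for x
    using Suc.prems that
    by (intro differentiableI[OF bounded_linear.has_derivative[OF assms(2) has_derivative_dir_deriv]]) auto
  ultimately show ?case by auto
qed

lemma smooth_on_linear:
  fixes l :: "'a::euclidean_space \<Rightarrow> 'b::real_normed_vector"
  assumes "bounded_linear l"
  shows "smooth_on S l"
proof -
  have "Ck_on k S l" for k
  proof (cases k)
    case 0
    then show ?thesis using assms by (simp add: linear_continuous_on)
  next
    case (Suc j)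
    have "dir_deriv v l = (\<lambda>x. l v)" for v
      by (rule ext) (rule dir_deriv_linear_self[OF assms])
    then show ?thesis
      using Suc assms by (auto simp: Ck_on_const bounded_linear_imp_differentiable)
  qed
  then show ?thesis by (simp add: smooth_on_def)
qed

lemma smooth_on_const: "smooth_on S (\<lambda>x. c)"
  by (simp add: smooth_on_def Ck_on_const)

lemma smooth_on_add: "open S \<Longrightarrow> smooth_on S f \<Longrightarrow> smooth_on S g \<Longrightarrow> smooth_on S (\<lambda>x. f x + g x)"
  by (simp add: smooth_on_def Ck_on_add)

lemma smooth_on_mult:
  fixes f g :: "'a::euclidean_space \<Rightarrow> 'b::real_normed_algebra"
  shows "open S \<Longrightarrow> smooth_on S f \<Longrightarrow> smooth_on S g \<Longrightarrow> smooth_on S (\<lambda>x. f x * g x)"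
  by (simp add: smooth_on_def Ck_on_mult)

lemma smooth_on_bounded_linear:
  "open S \<Longrightarrow> bounded_linear l \<Longrightarrow> smooth_on S f \<Longrightarrow> smooth_on S (\<lambda>x. l (f x))"
  by (simp add: smooth_on_def Ck_on_bounded_linear)

lemma smooth_on_minus: "open S \<Longrightarrow> smooth_on S f \<Longrightarrow> smooth_on S (\<lambda>x. - f x)"
  by (rule smooth_on_bounded_linear[OF _ bounded_linear_minus[OF bounded_linear_ident]])

lemma smooth_on_diff:
  "open S \<Longrightarrow> smooth_on S f \<Longrightarrow> smooth_on S g \<Longrightarrow> smooth_on S (\<lambda>x. f x - g x)"
  using smooth_on_add[of S f "\<lambda>x. - g x"] smooth_on_minus[of S g] by simp

lemma smooth_on_sum:
  "open S \<Longrightarrow> (\<And>i. i \<in> I \<Longrightarrow> smooth_on S (f i)) \<Longrightarrow> smooth_on S (\<lambda>x. \<Sum>i\<in>I. f i x)"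
  by (induction I rule: infinite_finite_induct) (auto intro: smooth_on_add smooth_on_const)

lemma smooth_on_power:
  fixes f :: "'a::euclidean_space \<Rightarrow> 'b::real_normed_algebra_1"
  shows "open S \<Longrightarrow> smooth_on S f \<Longrightarrow> smooth_on S (\<lambda>x. f x ^ m)"
  by (induction m) (auto intro: smooth_on_mult smooth_on_const)

lemma smooth_on_subset: "smooth_on S f \<Longrightarrow> T \<subseteq> S \<Longrightarrow> smooth_on T f"
proof -
  have "Ck_on k S f \<Longrightarrow> T \<subseteq> S \<Longrightarrow> Ck_on k T f" for k
    by (induction k arbitrary: f) (auto intro: continuous_on_subset)
  then show "smooth_on S f \<Longrightarrow> T \<subseteq> S \<Longrightarrow> smooth_on T f"
    unfolding smooth_on_def by blast
qed

lemma smooth_on_dir_deriv: "smooth_on S f \<Longrightarrow> smooth_on S (dir_deriv v f)"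
  unfolding smooth_on_def by (metis Ck_on.simps(2))

lemma smooth_on_differentiable: "smooth_on S f \<Longrightarrow> x \<in> S \<Longrightarrow> f differentiable at x"
  unfolding smooth_on_def by (metis Ck_on.simps(2))

lemma smooth_on_continuous_on: "smooth_on S f \<Longrightarrow> continuous_on S f"
  unfolding smooth_on_def by (metis Ck_on.simps(1))

text \<open>The derivative is \<open>exp f\<close> times a derivative of f, so the induction on k
  feeds on the same function at the previous order and needs no chain rule of higher order. The
  inverse works the same way; the logarithm then needs only one differentiation.\<close>

lemma smooth_on_exp:
  fixes f :: "'a::euclidean_space \<Rightarrow> real"
  assumes "open S" "smooth_on S f"
  shows "smooth_on S (\<lambda>x. exp (f x))"
proof -
  have "Ck_on k S (\<lambda>x. exp (f x))" for k
  proof (induction k)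
    case 0
    show ?case using smooth_on_continuous_on[OF assms(2)] by (simp add: continuous_on_exp)
  next
    case (Suc k)
    have d: "((\<lambda>x. exp (f x)) has_derivative (\<lambda>v. exp (f x) * dir_deriv v f x)) (at x)" if "x \<in> S" for x
      using has_derivative_exp[OF has_derivative_dir_deriv[OF smooth_on_differentiable[OF assms(2) that]]]
      by (simp add: mult.commute)
    have "Ck_on k S (dir_deriv v (\<lambda>x. exp (f x)))" for v
      by (rule Ck_on_cong[OF assms(1) _ Ck_on_mult[OF assms(1) Suc, of "dir_deriv v f"]])
         (use smooth_on_dir_deriv[OF assms(2), of v] dir_deriv_eqI[OF d] in \<open>auto simp: smooth_on_def\<close>)
    then show ?case using d by (auto simp: differentiable_def)
  qed
  then show ?thesis by (simp add: smooth_on_def)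
qed

lemma smooth_on_inverse:
  fixes f :: "'a::euclidean_space \<Rightarrow> real"
  assumes "open S" "smooth_on S f" "\<And>x. x \<in> S \<Longrightarrow> f x \<noteq> 0"
  shows "smooth_on S (\<lambda>x. inverse (f x))"
proof -
  have "Ck_on k S (\<lambda>x. inverse (f x))" for k
  proof (induction k)
    case 0
    show ?case using smooth_on_continuous_on[OF assms(2)] assms(3) by (simp add: continuous_on_inverse)
  next
    case (Suc k)
    have d: "((\<lambda>x. inverse (f x)) has_derivative
        (\<lambda>v. - (inverse (f x) * dir_deriv v f x * inverse (f x)))) (at x)" if "x \<in> S" for x
      using Deriv.has_derivative_inverse[OF assms(3)[OF that]
          has_derivative_dir_deriv[OF smooth_on_differentiable[OF assms(2) that]]] .
    have "Ck_on k S (dir_deriv v (\<lambda>x. inverse (f x)))" for v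
    proof (rule Ck_on_cong[OF assms(1)])
      show "Ck_on k S (\<lambda>x. - (inverse (f x) * dir_deriv v f x * inverse (f x)))"
        using smooth_on_dir_deriv[OF assms(2), of v] Suc assms(1)
        by (intro Ck_on_bounded_linear[OF assms(1) bounded_linear_minus[OF bounded_linear_ident]] Ck_on_mult)
           (auto simp: smooth_on_def)
    qed (use dir_deriv_eqI[OF d] in auto)
    then show ?case using d by (auto simp: differentiable_def)
  qed
  then show ?thesis by (simp add: smooth_on_def)
qed

lemma smooth_on_ln:
  fixes f :: "'a::euclidean_space \<Rightarrow> real"
  assumes "open S" "smooth_on S f" "\<And>x. x \<in> S \<Longrightarrow> f x > 0"
  shows "smooth_on S (\<lambda>x. ln (f x))"
proof -
  have d: "((\<lambda>x. ln (f x)) has_derivative (\<lambda>v. dir_deriv v f x * inverse (f x))) (at x)" if "x \<in> S" for x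
    using has_derivative_ln[OF assms(3)[OF that]
        has_derivative_dir_deriv[OF smooth_on_differentiable[OF assms(2) that]]]
    by (simp add: field_simps)
  have "Ck_on k S (\<lambda>x. ln (f x))" for k
  proof (cases k)
    case 0
    have "f x \<noteq> 0" if "x \<in> S" for x using assms(3)[OF that] by simp
    then show ?thesis using smooth_on_continuous_on[OF assms(2)] 0
      by (auto intro!: continuous_on_ln)
  next
    case (Suc j)
    have "smooth_on S (\<lambda>x. dir_deriv v f x * inverse (f x))" for v
      using assms(3)
      by (intro smooth_on_mult smooth_on_inverse smooth_on_dir_deriv assms) force
    then have c: "Ck_on j S (\<lambda>x. dir_deriv v f x * inverse (f x))" for v
      by (simp add: smooth_on_def)
    have "Ck_on j S (dir_deriv v (\<lambda>x. ln (f x)))" for v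
      by (rule Ck_on_cong[OF assms(1) _ c[of v]]) (simp add: dir_deriv_eqI[OF d])
    then show ?thesis using d Suc by (auto simp: differentiable_def)
  qed
  then show ?thesis by (simp add: smooth_on_def)
qed

section \<open>Symmetry of mixed directional derivatives\<close>

lemma dir_deriv_along_line:
  fixes f :: "'a::real_normed_vector \<Rightarrow> real"
  assumes "f differentiable at (x + t *\<^sub>R v)"
  shows "((\<lambda>t. f (x + t *\<^sub>R v)) has_real_derivative dir_deriv v f (x + t *\<^sub>R v)) (at t)"
proof -
  have 1: "((\<lambda>t. x + t *\<^sub>R v) has_derivative (\<lambda>s. s *\<^sub>R v)) (at t)"
    by (auto intro!: derivative_eq_intros)
  have L: "(f has_derivative (\<lambda>v'. dir_deriv v' f (x + t *\<^sub>R v))) (at (x + t *\<^sub>R v))"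
    using assms by (rule has_derivative_dir_deriv)
  have "dir_deriv (s *\<^sub>R v) f (x + t *\<^sub>R v) = dir_deriv v f (x + t *\<^sub>R v) * s" for s
    using linear_cmul[OF has_derivative_linear[OF L], of s v] by simp
  with has_derivative_compose[OF 1 L] show ?thesis
    by (simp add: has_field_derivative_def)
qed

text \<open>The second difference quotient in the directions v and w is, by applying the mean value
  theorem twice, a value of either mixed derivative at a nearby point.\<close>

lemma second_difference_mean_value:
  fixes f :: "'a::euclidean_space \<Rightarrow> real"
  assumes "Ck_on 2 S f" "0 < s"
    "\<And>a b. 0 \<le> a \<Longrightarrow> a \<le> s \<Longrightarrow> 0 \<le> b \<Longrightarrow> b \<le> s \<Longrightarrow> x + a *\<^sub>R v + b *\<^sub>R w \<in> S"
  shows "\<exists>a b. 0 < a \<and> a < s \<and> 0 < b \<and> b < s \<and>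
    f (x + s *\<^sub>R v + s *\<^sub>R w) - f (x + s *\<^sub>R v) - f (x + s *\<^sub>R w) + f x
      = s^2 * dir_deriv w (dir_deriv v f) (x + a *\<^sub>R v + b *\<^sub>R w)"
proof -
  have df: "f differentiable at y" and ddf: "dir_deriv v f differentiable at y" if "y \<in> S" for y
    using assms(1) that by (auto simp: numeral_2_eq_2)
  define \<phi> where "\<phi> = (\<lambda>t. f (x + s *\<^sub>R w + t *\<^sub>R v) - f (x + t *\<^sub>R v))"
  have "\<exists>z. 0 < z \<and> z < s \<and> \<phi> s - \<phi> 0
      = (s - 0) * (dir_deriv v f (x + s *\<^sub>R w + z *\<^sub>R v) - dir_deriv v f (x + z *\<^sub>R v))"
  proof (rule MVT2)
    fix t assume t: "0 \<le> t" "t \<le> s"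
    show "(\<phi> has_real_derivative
        (dir_deriv v f (x + s *\<^sub>R w + t *\<^sub>R v) - dir_deriv v f (x + t *\<^sub>R v))) (at t)"
      unfolding \<phi>_def using assms(3)[of t s] assms(3)[of t 0] t assms(2)
      by (intro DERIV_diff dir_deriv_along_line df) (auto simp: algebra_simps)
  qed (use assms(2) in auto)
  then obtain a where a: "0 < a" "a < s" "\<phi> s - \<phi> 0
      = s * (dir_deriv v f (x + s *\<^sub>R w + a *\<^sub>R v) - dir_deriv v f (x + a *\<^sub>R v))" by auto
  have "\<exists>z. 0 < z \<and> z < s \<and>
      dir_deriv v f (x + a *\<^sub>R v + s *\<^sub>R w) - dir_deriv v f (x + a *\<^sub>R v + 0 *\<^sub>R w)
      = (s - 0) * dir_deriv w (dir_deriv v f) (x + a *\<^sub>R v + z *\<^sub>R w)"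
    using assms(2,3) a(1,2) by (intro MVT2 dir_deriv_along_line ddf) auto
  then obtain b where "0 < b" "b < s"
      "dir_deriv v f (x + a *\<^sub>R v + s *\<^sub>R w) - dir_deriv v f (x + a *\<^sub>R v)
      = s * dir_deriv w (dir_deriv v f) (x + a *\<^sub>R v + b *\<^sub>R w)" by auto
  with a show ?thesis unfolding \<phi>_def
    by (intro exI[of _ a] exI[of _ b]) (auto simp: algebra_simps power2_eq_square)
qed

text \<open>If the two mixed derivatives differed at x, then on a small enough parallelogram each
  would stay within half the gap of its value at x. The same second difference equals
  \<open>s^2\<close> times a value of each, which is a contradiction.\<close>

lemma dir_deriv_commute_real:
  fixes f :: "'a::euclidean_space \<Rightarrow> real"
  assumes "open S" "x \<in> S" "Ck_on 2 S f"
  shows "dir_deriv w (dir_deriv v f) x = dir_deriv v (dir_deriv w f) x"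
proof (rule ccontr)
  assume ne: "\<not> ?thesis"
  define e where "e = \<bar>dir_deriv w (dir_deriv v f) x - dir_deriv v (dir_deriv w f) x\<bar> / 2"
  have e: "e > 0" using ne by (simp add: e_def)
  have c: "continuous_on S (dir_deriv w (dir_deriv v f))" "continuous_on S (dir_deriv v (dir_deriv w f))"
    using assms(3) by (auto simp: numeral_2_eq_2)
  obtain d0 where d0: "d0 > 0" "ball x d0 \<subseteq> S" using assms(1,2) openE by blast
  obtain d1 where d1: "d1 > 0" "\<And>y. y \<in> S \<Longrightarrow> dist y x < d1 \<Longrightarrow>
      dist (dir_deriv w (dir_deriv v f) y) (dir_deriv w (dir_deriv v f) x) < e"
    using c(1) e assms(2) unfolding continuous_on_iff by meson
  obtain d2 where d2: "d2 > 0" "\<And>y. y \<in> S \<Longrightarrow> dist y x < d2 \<Longrightarrow>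
      dist (dir_deriv v (dir_deriv w f) y) (dir_deriv v (dir_deriv w f) x) < e"
    using c(2) e assms(2) unfolding continuous_on_iff by meson
  define d where "d = min d0 (min d1 d2)"
  have d: "d > 0" using d0 d1 d2 by (simp add: d_def)
  \<comment> \<open>This size keeps the whole parallelogram within distance d of x; the summand 1
    covers v = w = 0 and makes the bound strict.\<close>
  define s where "s = d / (norm v + norm w + 1)"
  have np: "norm v + norm w + 1 > 0"
    by (simp add: add_nonneg_pos)
  have s: "s > 0" using d np by (simp add: s_def)
  have near: "dist (x + a *\<^sub>R v + b *\<^sub>R w) x < d" if "0 \<le> a" "a \<le> s" "0 \<le> b" "b \<le> s" for a b
  proof -
    have "dist (x + a *\<^sub>R v + b *\<^sub>R w) x \<le> norm (a *\<^sub>R v) + norm (b *\<^sub>R w)"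
      by (simp add: dist_norm add.assoc norm_triangle_ineq del: norm_scaleR)
    also have "\<dots> \<le> s * norm v + s * norm w"
      using that by (intro add_mono) (auto intro: mult_right_mono)
    also have "\<dots> < s * (norm v + norm w + 1)" using s by (simp add: algebra_simps)
    also have "\<dots> = d" using np by (simp add: s_def)
    finally show ?thesis .
  qed
  have inS: "x + a *\<^sub>R v + b *\<^sub>R w \<in> S" if "0 \<le> a" "a \<le> s" "0 \<le> b" "b \<le> s" for a b
    using near[OF that] d0(2) by (auto simp: d_def dist_commute subset_iff)
  obtain a b where 1: "0 < a" "a < s" "0 < b" "b < s"
      "f (x + s *\<^sub>R v + s *\<^sub>R w) - f (x + s *\<^sub>R v) - f (x + s *\<^sub>R w) + f x
      = s^2 * dir_deriv w (dir_deriv v f) (x + a *\<^sub>R v + b *\<^sub>R w)"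
    using second_difference_mean_value[OF assms(3) s inS] by blast
  have inS': "x + a *\<^sub>R w + b *\<^sub>R v \<in> S" if "0 \<le> a" "a \<le> s" "0 \<le> b" "b \<le> s" for a b
    using inS[of b a] that by (simp add: algebra_simps)
  obtain a' b' where 2: "0 < a'" "a' < s" "0 < b'" "b' < s"
      "f (x + s *\<^sub>R w + s *\<^sub>R v) - f (x + s *\<^sub>R w) - f (x + s *\<^sub>R v) + f x
      = s^2 * dir_deriv v (dir_deriv w f) (x + a' *\<^sub>R w + b' *\<^sub>R v)"
    using second_difference_mean_value[OF assms(3) s inS'] by blast
  have "s^2 * dir_deriv w (dir_deriv v f) (x + a *\<^sub>R v + b *\<^sub>R w)
      = s^2 * dir_deriv v (dir_deriv w f) (x + b' *\<^sub>R v + a' *\<^sub>R w)"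
    unfolding 1(5)[symmetric] using 2(5) by (simp add: algebra_simps)
  then have eq: "dir_deriv w (dir_deriv v f) (x + a *\<^sub>R v + b *\<^sub>R w)
      = dir_deriv v (dir_deriv w f) (x + b' *\<^sub>R v + a' *\<^sub>R w)" using s by simp
  have "dist (dir_deriv w (dir_deriv v f) (x + a *\<^sub>R v + b *\<^sub>R w)) (dir_deriv w (dir_deriv v f) x) < e"
    using near[of a b] inS[of a b] 1 by (intro d1) (auto simp: d_def)
  moreover have "dist (dir_deriv v (dir_deriv w f) (x + b' *\<^sub>R v + a' *\<^sub>R w)) (dir_deriv v (dir_deriv w f) x) < e"
    using near[of b' a'] inS[of b' a'] 2 by (intro d2) (auto simp: d_def)
  ultimately have "\<bar>dir_deriv w (dir_deriv v f) x - dir_deriv v (dir_deriv w f) x\<bar> < 2 * e"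
    unfolding eq dist_real_def by linarith
  then show False by (simp add: e_def)
qed

text \<open>The mean value argument is real valued, so it is applied after composing with
  \<open>Re\<close> and \<open>Im\<close>.\<close>

lemma dir_deriv_commute:
  fixes f :: "'a::euclidean_space \<Rightarrow> complex"
  assumes "open S" "x \<in> S" "smooth_on S f"
  shows "dir_deriv w (dir_deriv v f) x = dir_deriv v (dir_deriv w f) x"
proof -
  have *: "l (dir_deriv w (dir_deriv v f) x) = l (dir_deriv v (dir_deriv w f) x)"
    if l: "bounded_linear l" for l :: "complex \<Rightarrow> real"
  proof -
    have d: "dir_deriv v (\<lambda>y. l (f y)) y = l (dir_deriv v f y)" if "y \<in> S" for v y
      using smooth_on_differentiable[OF assms(3) that] l by (simp add: dir_deriv_bounded_linear)
    have dd: "dir_deriv w (dir_deriv v (\<lambda>y. l (f y))) x = l (dir_deriv w (dir_deriv v f) x)" for v w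
      using smooth_on_differentiable[OF smooth_on_dir_deriv[OF assms(3)] assms(2)] l
      by (subst dir_deriv_cong_open[OF assms(1,2) d]) (auto simp: dir_deriv_bounded_linear)
    have "Ck_on 2 S (\<lambda>y. l (f y))"
      using smooth_on_bounded_linear[OF assms(1) l assms(3)] by (simp add: smooth_on_def)
    from dir_deriv_commute_real[OF assms(1,2) this] show ?thesis by (simp add: dd)
  qed
  show ?thesis
    using *[OF bounded_linear_Re] *[OF bounded_linear_Im] by (simp add: complex_eq_iff)
qed

section \<open>Complex vector fields and the Heisenberg frame\<close>

text \<open>A common form for \<open>Z\<close>, \<open>Zbar\<close> and \<open>d_t\<close>, so that
  the Leibniz, locality and chain rules are proved once. Three fixed directions suffice because each
  frame field involves only one real x, one real y and t; only the coefficients vary.\<close>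

definition complex_field :: "(('a::euclidean_space \<Rightarrow> complex) \<Rightarrow> 'a \<Rightarrow> complex) \<Rightarrow> bool" where
  "complex_field L \<longleftrightarrow> (\<exists>a b c u v w. smooth_on UNIV a \<and> smooth_on UNIV b \<and> smooth_on UNIV c \<and>
     (\<forall>f x. L f x = a x * dir_deriv u f x + b x * dir_deriv v f x + c x * dir_deriv w f x))"

lemma complex_field_cong:
  assumes "complex_field L" "open S" "x \<in> S" "\<And>y. y \<in> S \<Longrightarrow> f y = g y"
  shows "L f x = L g x"
proof -
  have "dir_deriv v f x = dir_deriv v g x" for v
    using assms(2-4) by (rule dir_deriv_cong_open)
  then show ?thesis using assms(1) unfolding complex_field_def by auto
qed

lemma complex_field_const: "complex_field L \<Longrightarrow> L (\<lambda>y. c) x = 0"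
  unfolding complex_field_def by auto

lemma complex_field_add:
  assumes "complex_field L" "f differentiable at x" "g differentiable at x"
  shows "L (\<lambda>y. f y + g y) x = L f x + L g x"
  using assms(1) unfolding complex_field_def
  by (auto simp: dir_deriv_add[OF assms(2,3)] algebra_simps)

lemma complex_field_mult:
  assumes "complex_field L" "f differentiable at x" "g differentiable at x"
  shows "L (\<lambda>y. f y * g y) x = L f x * g x + f x * L g x"
  using assms(1) unfolding complex_field_def
  by (auto simp: dir_deriv_mult[OF assms(2,3)] algebra_simps)

lemma complex_field_cmult:
  assumes "complex_field L" "f differentiable at x"
  shows "L (\<lambda>y. c * f y) x = c * L f x"
  using complex_field_mult[OF assms(1) differentiable_const assms(2)]
  by (simp add: complex_field_const[OF assms(1)])

lemma complex_field_minus: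
  assumes "complex_field L" "f differentiable at x"
  shows "L (\<lambda>y. - f y) x = - L f x"
  using complex_field_cmult[OF assms, of "-1"] by simp

lemma complex_field_diff:
  assumes "complex_field L" "f differentiable at x" "g differentiable at x"
  shows "L (\<lambda>y. f y - g y) x = L f x - L g x"
  using complex_field_add[OF assms(1,2), of "\<lambda>y. - g y"] assms
  by (simp add: complex_field_minus differentiable_minus)

lemma differentiable_sum_fun:
  "(\<And>i. i \<in> I \<Longrightarrow> f i differentiable at x) \<Longrightarrow> (\<lambda>y. \<Sum>i\<in>I. f i y) differentiable at x"
  by (induction I rule: infinite_finite_induct) auto

lemma complex_field_sum:
  assumes "complex_field L" "\<And>i. i \<in> I \<Longrightarrow> f i differentiable at x"
  shows "L (\<lambda>y. \<Sum>i\<in>I. f i y) x = (\<Sum>i\<in>I. L (f i) x)"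
  using assms(2)
proof (induction I rule: infinite_finite_induct)
  case (insert i I)
  then show ?case
    by (simp add: complex_field_add[OF assms(1)] differentiable_sum_fun)
qed (auto simp: complex_field_const[OF assms(1)])

lemma complex_field_real_chain:
  assumes "complex_field L" "f differentiable at x" "(\<phi> has_real_derivative d) (at (f x))"
  shows "L (\<lambda>y. complex_of_real (\<phi> (f y))) x = d * L (\<lambda>y. complex_of_real (f y)) x"
proof -
  have d: "(\<lambda>y. \<phi> (f y)) differentiable at x"
    using has_derivative_compose[OF has_derivative_dir_deriv[OF assms(2)]
        assms(3)[unfolded has_field_derivative_def]] by (auto simp: differentiable_def)
  have "dir_deriv v (\<lambda>y. complex_of_real (\<phi> (f y))) x
      = d * dir_deriv v (\<lambda>y. complex_of_real (f y)) x" for v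
    by (simp add: dir_deriv_bounded_linear[OF bounded_linear_of_real] assms(2) d
        dir_deriv_real_chain[OF assms(2,3)])
  then show ?thesis using assms(1) unfolding complex_field_def by (auto simp: algebra_simps)
qed

lemma complex_field_smooth:
  assumes "complex_field L" "open S" "smooth_on S f"
  shows "smooth_on S (L f)"
proof -
  obtain a b c u v w where L: "smooth_on UNIV a" "smooth_on UNIV b" "smooth_on UNIV c"
     "\<And>f x. L f x = a x * dir_deriv u f x + b x * dir_deriv v f x + c x * dir_deriv w f x"
    using assms(1) unfolding complex_field_def by blast
  have "L f = (\<lambda>x. a x * dir_deriv u f x + b x * dir_deriv v f x + c x * dir_deriv w f x)"
    using L(4) by blast
  then show ?thesis
    using L(1-3)[THEN smooth_on_subset, OF subset_UNIV] assms(2,3)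
    by (auto intro!: smooth_on_add smooth_on_mult smooth_on_dir_deriv)
qed

section \<open>The frame fields on coordinates, and their commutators\<close>

lemma bounded_linear_coord: "bounded_linear (\<lambda>\<xi>::'n::finite heis. fst \<xi> $ \<alpha>)"
  by (rule bounded_linear_compose[OF bounded_linear_vec_nth bounded_linear_fst])

lemma bounded_linear_cnj_coord: "bounded_linear (\<lambda>\<xi>::'n::finite heis. cnj (fst \<xi> $ \<alpha>))"
  by (rule bounded_linear_compose[OF bounded_linear_cnj bounded_linear_coord])

lemma bounded_linear_t: "bounded_linear (\<lambda>\<xi>::'n::finite heis. complex_of_real (snd \<xi>))"
  by (rule bounded_linear_compose[OF bounded_linear_of_real bounded_linear_snd])

lemmas smooth_on_coords =
  smooth_on_linear[OF bounded_linear_coord] smooth_on_linear[OF bounded_linear_cnj_coord]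
  smooth_on_linear[OF bounded_linear_t]

lemma Z_alt: "Z \<alpha> f \<xi> = 1/2 * dir_deriv (axis \<alpha> 1, 0) f \<xi> + (-\<i>/2) * dir_deriv (axis \<alpha> \<i>, 0) f \<xi>
    + (\<i> * cnj (fst \<xi> $ \<alpha>)) * dir_deriv (0, 1) f \<xi>"
  by (simp add: Z_def d_z_def d_t_def field_simps)

lemma Zbar_alt: "Zbar \<alpha> f \<xi> = 1/2 * dir_deriv (axis \<alpha> 1, 0) f \<xi> + (\<i>/2) * dir_deriv (axis \<alpha> \<i>, 0) f \<xi>
    + (- \<i> * (fst \<xi> $ \<alpha>)) * dir_deriv (0, 1) f \<xi>"
  by (simp add: Zbar_def d_zbar_def d_t_def field_simps)

lemma complex_field_Z: "complex_field (Z \<alpha>)"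
  unfolding complex_field_def Z_alt
  by (rule exI[of _ "\<lambda>_. 1/2"], rule exI[of _ "\<lambda>_. (-\<i>/2)"], rule exI[of _ "\<lambda>\<xi>. (\<i> * cnj (fst \<xi> $ \<alpha>))"])
     (rule exI[of _ "(axis \<alpha> 1, 0)"], rule exI[of _ "(axis \<alpha> \<i>, 0)"], rule exI[of _ "(0, 1)"],
      intro conjI allI refl smooth_on_mult smooth_on_const smooth_on_coords open_UNIV)

lemma complex_field_Zbar: "complex_field (Zbar \<alpha>)"
  unfolding complex_field_def Zbar_alt
  by (rule exI[of _ "\<lambda>_. 1/2"], rule exI[of _ "\<lambda>_. (\<i>/2)"], rule exI[of _ "\<lambda>\<xi>. (- \<i> * (fst \<xi> $ \<alpha>))"])
     (rule exI[of _ "(axis \<alpha> 1, 0)"], rule exI[of _ "(axis \<alpha> \<i>, 0)"], rule exI[of _ "(0, 1)"],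
      intro conjI allI refl smooth_on_mult smooth_on_const smooth_on_coords open_UNIV)

lemma complex_field_d_t: "complex_field d_t"
  unfolding complex_field_def d_t_def
  by (rule exI[of _ "\<lambda>x. 0"], rule exI[of _ "\<lambda>x. 0"], rule exI[of _ "\<lambda>x. 1"])
     (auto intro: smooth_on_const)

lemma Zbar_cnj: "f differentiable at \<xi> \<Longrightarrow> Zbar \<alpha> (\<lambda>\<eta>. cnj (f \<eta>)) \<xi> = cnj (Z \<alpha> f \<xi>)"
  by (simp add: Zbar_alt Z_alt dir_deriv_bounded_linear[OF bounded_linear_cnj])

lemma Z_cnj: "f differentiable at \<xi> \<Longrightarrow> Z \<alpha> (\<lambda>\<eta>. cnj (f \<eta>)) \<xi> = cnj (Zbar \<alpha> f \<xi>)"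
  by (simp add: Zbar_alt Z_alt dir_deriv_bounded_linear[OF bounded_linear_cnj])

lemma d_t_cnj: "f differentiable at \<xi> \<Longrightarrow> d_t (\<lambda>\<eta>. cnj (f \<eta>)) \<xi> = cnj (d_t f \<xi>)"
  by (simp add: d_t_def dir_deriv_bounded_linear[OF bounded_linear_cnj])

lemma axis_nth_if: "axis a x $ b = (if b = a then x else 0)"
  by (simp add: axis_def)

lemmas dir_deriv_coords =
  dir_deriv_linear_self[OF bounded_linear_coord] dir_deriv_linear_self[OF bounded_linear_cnj_coord]
  dir_deriv_linear_self[OF bounded_linear_t]

lemma Z_coords:
  "Z \<alpha> (\<lambda>\<eta>. fst \<eta> $ \<beta>) \<xi> = (if \<alpha> = \<beta> then 1 else 0)"
  "Z \<alpha> (\<lambda>\<eta>. cnj (fst \<eta> $ \<beta>)) \<xi> = 0"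
  "Z \<alpha> (\<lambda>\<eta>. complex_of_real (snd \<eta>)) \<xi> = \<i> * cnj (fst \<xi> $ \<alpha>)"
  by (auto simp: Z_alt dir_deriv_coords axis_nth_if)

lemma Zbar_coords:
  "Zbar \<alpha> (\<lambda>\<eta>. fst \<eta> $ \<beta>) \<xi> = 0"
  "Zbar \<alpha> (\<lambda>\<eta>. cnj (fst \<eta> $ \<beta>)) \<xi> = (if \<alpha> = \<beta> then 1 else 0)"
  "Zbar \<alpha> (\<lambda>\<eta>. complex_of_real (snd \<eta>)) \<xi> = - \<i> * (fst \<xi> $ \<alpha>)"
  by (auto simp: Zbar_alt dir_deriv_coords axis_nth_if)

lemma d_t_coords:
  "d_t (\<lambda>\<eta>. fst \<eta> $ \<beta>) \<xi> = 0"
  "d_t (\<lambda>\<eta>. cnj (fst \<eta> $ \<beta>)) \<xi> = 0"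
  by (auto simp: d_t_def dir_deriv_coords)

text \<open>The shape of \<open>Z_alt\<close> and \<open>Zbar_alt\<close>: constant coefficients on
  the horizontal directions, a multiple of a coordinate on the vertical one. It expands the
  composition of two frame fields.\<close>

lemma complex_field_combination:
  assumes "complex_field L" "A differentiable at x" "B differentiable at x"
    "C differentiable at x" "k differentiable at x"
  shows "L (\<lambda>y. a * A y + b * B y + (c * k y) * C y) x
    = a * L A x + b * L B x + (c * L k x) * C x + (c * k x) * L C x"
proof -
  have "L (\<lambda>y. (c * k y) * C y) x = (c * L k x) * C x + (c * k x) * L C x"
    using complex_field_mult[OF assms(1) differentiable_mult[OF differentiable_const assms(5)] assms(4)]
      complex_field_cmult[OF assms(1,5)] by simp
  moreover have "L (\<lambda>y. a * A y + b * B y) x = a * L A x + b * L B x"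
    using complex_field_add[OF assms(1), of "\<lambda>y. a * A y" x "\<lambda>y. b * B y"]
      complex_field_cmult[OF assms(1)] assms(2,3) by simp
  ultimately show ?thesis
    using complex_field_add[OF assms(1), of "\<lambda>y. a * A y + b * B y" x "\<lambda>y. (c * k y) * C y"] assms(2-5)
    by simp
qed

text \<open>Second order terms cancel by symmetry of mixed derivatives, so only derivatives of the
  coefficients survive: \<open>Zbar\<close> applied to the coefficient of \<open>d_t\<close> in
  \<open>Z\<close>, and \<open>Z\<close> applied to the one in \<open>Zbar\<close>, each contribute
  \<i> on the diagonal. This gives the factor 2\<i>.\<close>

lemma commutators:
  fixes \<xi> :: "'n::finite heis"
  assumes "open S" "\<xi> \<in> S" "smooth_on S f"
  shows "Z \<alpha> (Z \<beta> f) \<xi> = Z \<beta> (Z \<alpha> f) \<xi>"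
    and "Zbar \<alpha> (Zbar \<beta> f) \<xi> = Zbar \<beta> (Zbar \<alpha> f) \<xi>"
    and "Zbar \<alpha> (Z \<beta> f) \<xi> = Z \<beta> (Zbar \<alpha> f) \<xi> + (if \<alpha> = \<beta> then 2 * \<i> * d_t f \<xi> else 0)"
    and "d_t (Z \<beta> f) \<xi> = Z \<beta> (d_t f) \<xi>"
    and "d_t (Zbar \<beta> f) \<xi> = Zbar \<beta> (d_t f) \<xi>"
proof -
  note d = smooth_on_differentiable[OF smooth_on_dir_deriv[OF assms(3)] assms(2)]
  note dc = smooth_on_differentiable[OF smooth_on_coords(1) UNIV_I]
    smooth_on_differentiable[OF smooth_on_coords(2) UNIV_I]
  have ZZ: "Z \<beta> f = (\<lambda>\<xi>. 1/2 * dir_deriv (axis \<beta> 1, 0) f \<xi> + (-\<i>/2) * dir_deriv (axis \<beta> \<i>, 0) f \<xi>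
    + (\<i> * cnj (fst \<xi> $ \<beta>)) * dir_deriv (0, 1) f \<xi>)" for \<beta>
    by (rule ext) (rule Z_alt)
  have ZB: "Zbar \<beta> f = (\<lambda>\<xi>. 1/2 * dir_deriv (axis \<beta> 1, 0) f \<xi> + (\<i>/2) * dir_deriv (axis \<beta> \<i>, 0) f \<xi>
    + (- \<i> * (fst \<xi> $ \<beta>)) * dir_deriv (0, 1) f \<xi>)" for \<beta>
    by (rule ext) (rule Zbar_alt)
  have T: "d_t f = dir_deriv (0, 1) f" by (rule ext) (simp add: d_t_def)
  note cm = dir_deriv_commute[OF assms]
  note combZ = complex_field_combination[OF _ d d d dc(2)]
  note combB = complex_field_combination[OF _ d d d dc(1)]
  show "Z \<alpha> (Z \<beta> f) \<xi> = Z \<beta> (Z \<alpha> f) \<xi>"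
    unfolding ZZ unfolding combZ[OF complex_field_Z] Z_coords unfolding Z_alt
    by (simp add: cm algebra_simps)
  show "Zbar \<alpha> (Zbar \<beta> f) \<xi> = Zbar \<beta> (Zbar \<alpha> f) \<xi>"
    unfolding ZB unfolding combB[OF complex_field_Zbar] Zbar_coords unfolding Zbar_alt
    by (simp add: cm algebra_simps)
  show "Zbar \<alpha> (Z \<beta> f) \<xi> = Z \<beta> (Zbar \<alpha> f) \<xi> + (if \<alpha> = \<beta> then 2 * \<i> * d_t f \<xi> else 0)"
    unfolding ZB ZZ unfolding combB[OF complex_field_Z] combZ[OF complex_field_Zbar] Z_coords Zbar_coords
    unfolding Zbar_alt Z_alt T
    by (simp add: cm algebra_simps)
  show "d_t (Z \<beta> f) \<xi> = Z \<beta> (d_t f) \<xi>"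
    unfolding T unfolding ZZ unfolding combZ[OF complex_field_d_t] d_t_coords
    unfolding Z_alt d_t_def by (simp add: cm algebra_simps)
  show "d_t (Zbar \<beta> f) \<xi> = Zbar \<beta> (d_t f) \<xi>"
    unfolding T unfolding ZB unfolding combB[OF complex_field_d_t] d_t_coords
    unfolding Zbar_alt d_t_def by (simp add: cm algebra_simps)
qed

section \<open>Integration by parts\<close>

lemma compactly_supported_integrable:
  fixes f :: "'a::euclidean_space \<Rightarrow> 'b::euclidean_space"
  assumes "continuous_on UNIV f" "compact K" "\<And>x. x \<notin> K \<Longrightarrow> f x = 0"
  shows "integrable lborel f"
proof -
  have "integrable lborel (\<lambda>x. indicator K x *\<^sub>R f x)"
    using borel_integrable_compact[OF assms(2) continuous_on_subset[OF assms(1)]] by simp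
  moreover have "(\<lambda>x. indicator K x *\<^sub>R f x) = f"
    using assms(3) by (auto simp: indicator_def)
  ultimately show ?thesis by simp
qed

lemma dir_deriv_zero_outside:
  assumes "closed K" "\<And>x. x \<notin> K \<Longrightarrow> f x = 0" "x \<notin> K"
  shows "dir_deriv v f x = 0"
  using dir_deriv_cong_open[of "- K" x f "\<lambda>_. 0" v] assms by auto

lemma difference_norm_le:
  fixes f :: "'a::real_normed_vector \<Rightarrow> complex"
  assumes "\<And>x. f differentiable at x" "\<And>x. norm (dir_deriv v f x) \<le> M" "0 \<le> s"
  shows "norm (f (x + s *\<^sub>R v) - f x) \<le> M * s"
proof -
  have d: "((\<lambda>t. f (x + t *\<^sub>R v)) has_derivative (\<lambda>h. h *\<^sub>R dir_deriv v f (x + t *\<^sub>R v))) (at t)" for t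
  proof -
    have 1: "((\<lambda>t. x + t *\<^sub>R v) has_derivative (\<lambda>s. s *\<^sub>R v)) (at t)"
      by (auto intro!: derivative_eq_intros)
    note L = has_derivative_dir_deriv[OF assms(1)[of "x + t *\<^sub>R v"]]
    have "dir_deriv (s *\<^sub>R v) f (x + t *\<^sub>R v) = s *\<^sub>R dir_deriv v f (x + t *\<^sub>R v)" for s
      using linear_cmul[OF has_derivative_linear[OF L], of s v] by simp
    with has_derivative_compose[OF 1 L] show ?thesis by simp
  qed
  have "onorm (\<lambda>h. h *\<^sub>R dir_deriv v f (x + t *\<^sub>R v)) \<le> M" for t
  proof (rule onorm_le)
    show "norm (h *\<^sub>R dir_deriv v f (x + t *\<^sub>R v)) \<le> M * norm h" for h
      using mult_right_mono[OF assms(2)[of "x + t *\<^sub>R v"], of "norm h"] by (simp add: mult.commute)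
  qed
  then have "norm (f (x + s *\<^sub>R v) - f (x + 0 *\<^sub>R v)) \<le> M * norm (s - 0)"
    using d by (intro differentiable_bound[of UNIV]) auto
  then show ?thesis using assms(3) by simp
qed

lemma integral_translate:
  fixes f :: "'a::euclidean_space \<Rightarrow> complex"
  assumes "integrable lborel f"
  shows "integrable lborel (\<lambda>x. f (x + c))" "(\<integral>x. f (x + c) \<partial>lborel) = (\<integral>x. f x \<partial>lborel)"
proof -
  have f: "f \<in> borel_measurable borel" using assms by auto
  show "(\<integral>x. f (x + c) \<partial>lborel) = (\<integral>x. f x \<partial>lborel)"
    using integral_distr[of "(+) c" lborel borel f] f by (simp add: lborel_distr_plus add.commute)
  show "integrable lborel (\<lambda>x. f (x + c))"
    using integrable_distr_eq[of "(+) c" lborel borel f] f assms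
    by (simp add: lborel_distr_plus add.commute)
qed

text \<open>Translation invariance makes every difference quotient integrate to 0, and dominated
  convergence passes this to the derivative. Only one continuous derivative is used, which suits
  truncated powers as cutoffs.\<close>

lemma integral_dir_deriv_eq_0:
  fixes f :: "'a::euclidean_space \<Rightarrow> complex"
  assumes "\<And>x. f differentiable at x" "continuous_on UNIV (dir_deriv v f)"
    "compact K" "\<And>x. x \<notin> K \<Longrightarrow> f x = 0"
  shows "integrable lborel (dir_deriv v f)" "(\<integral>x. dir_deriv v f x \<partial>lborel) = 0"
proof -
  have g0: "dir_deriv v f x = 0" if "x \<notin> K" for x
    using dir_deriv_zero_outside[OF compact_imp_closed[OF assms(3)] assms(4) that] .
  show "integrable lborel (dir_deriv v f)"
    using compactly_supported_integrable[OF assms(2,3) g0] .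
  have "bounded (dir_deriv v f ` K)"
    using assms(2,3) by (intro compact_imp_bounded compact_continuous_image) (auto intro: continuous_on_subset)
  then obtain M where M: "M > 0" "\<And>x. x \<in> K \<Longrightarrow> norm (dir_deriv v f x) \<le> M"
    unfolding bounded_pos by auto
  then have M': "norm (dir_deriv v f x) \<le> M" for x
    using g0[of x] by (cases "x \<in> K") auto
  have cont: "continuous_on UNIV f"
    using assms(1) by (auto intro!: continuous_at_imp_continuous_on differentiable_imp_continuous_within)
  have f: "integrable lborel f" using compactly_supported_integrable[OF cont assms(3,4)] .
  define s :: "nat \<Rightarrow> real" where "s = (\<lambda>k. inverse (real (Suc k)))"
  have s: "0 < s k" "s k \<le> 1" for k by (auto simp: s_def field_simps)
  \<comment> \<open>The steps \<open>s k\<close> are at most 1, so all difference quotients vanish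
    off this one compact set; \<open>M\<close> times its indicator is the dominating
    function.\<close>
  define K' where "K' = {x + y | x y. x \<in> K \<and> y \<in> cball 0 (norm v)}"
  have K': "compact K'" unfolding K'_def by (intro compact_sums assms(3) compact_cball)
  define q where "q = (\<lambda>k x. (f (x + s k *\<^sub>R v) - f x) /\<^sub>R s k)"
  have q0: "q k x = 0" if "x \<notin> K'" for k x
  proof -
    have "x + s k *\<^sub>R v \<notin> K"
    proof
      assume "x + s k *\<^sub>R v \<in> K"
      moreover have "- (s k *\<^sub>R v) \<in> cball 0 (norm v)"
        using s[of k] by (simp add: mult_left_le_one_le)
      ultimately have "(x + s k *\<^sub>R v) + - (s k *\<^sub>R v) \<in> K'" unfolding K'_def by blast
      then show False using that by simp
    qed
    moreover have "x \<notin> K"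
    proof
      assume "x \<in> K"
      then have "x + 0 \<in> K'" unfolding K'_def by fastforce
      then show False using that by simp
    qed
    ultimately show ?thesis using assms(4) by (simp add: q_def)
  qed
  have qb: "norm (q k x) \<le> M * indicator K' x" for k x
  proof (cases "x \<in> K'")
    case True
    have "norm (q k x) \<le> inverse (s k) * (M * s k)"
      unfolding q_def norm_scaleR
      using difference_norm_le[OF assms(1) M', of "s k" x] s[of k]
      by (intro mult_mono) auto
    also have "inverse (s k) * (M * s k) = M" using s[of k] by simp
    finally show ?thesis using True by simp
  qed (simp add: q0)
  have qi: "integrable lborel (q k)" "integral\<^sup>L lborel (q k) = 0" for k
    unfolding q_def using integral_translate[OF f, of "s k *\<^sub>R v"] f by auto
  have lim: "(\<lambda>k. q k x) \<longlonglongrightarrow> dir_deriv v f x" for x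
  proof -
    note L = has_derivative_dir_deriv[OF assms(1)[of x]]
    have e: "dir_deriv (t *\<^sub>R v) f x = t *\<^sub>R dir_deriv v f x" for t
      using linear_cmul[OF has_derivative_linear[OF L], of t v] by simp
    have "((\<lambda>t. x + t *\<^sub>R v) has_derivative (\<lambda>t. t *\<^sub>R v)) (at 0)"
      by (auto intro!: derivative_eq_intros)
    from has_derivative_compose[OF this, of f "\<lambda>v. dir_deriv v f x"] L
    have "((\<lambda>t. f (x + t *\<^sub>R v)) has_derivative (\<lambda>t. t *\<^sub>R dir_deriv v f x)) (at 0)"
      by (simp add: e)
    then have "((\<lambda>t. norm (f (x + t *\<^sub>R v) - f x - t *\<^sub>R dir_deriv v f x) / norm t) \<longlongrightarrow> 0) (at 0)"
      by (simp add: has_derivative_iff_norm)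
    moreover have "norm (f (x + t *\<^sub>R v) - f x - t *\<^sub>R dir_deriv v f x) / norm t
        = norm ((f (x + t *\<^sub>R v) - f x) /\<^sub>R t - dir_deriv v f x)" if "t \<noteq> 0" for t
    proof -
      have "(f (x + t *\<^sub>R v) - f x) /\<^sub>R t - dir_deriv v f x
          = (f (x + t *\<^sub>R v) - f x - t *\<^sub>R dir_deriv v f x) /\<^sub>R t"
        using that by (simp add: scaleR_diff_right)
      then show ?thesis by (simp add: divide_inverse mult.commute)
    qed
    then have "\<forall>\<^sub>F t in at 0. norm (f (x + t *\<^sub>R v) - f x - t *\<^sub>R dir_deriv v f x) / norm t
        = norm ((f (x + t *\<^sub>R v) - f x) /\<^sub>R t - dir_deriv v f x)"
      by (simp add: eventually_at_filter)
    ultimately have "((\<lambda>t. norm ((f (x + t *\<^sub>R v) - f x) /\<^sub>R t - dir_deriv v f x)) \<longlongrightarrow> 0) (at 0)"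
      by (rule Lim_transform_eventually)
    then have "((\<lambda>h. (f (x + h *\<^sub>R v) - f x) /\<^sub>R h) \<longlongrightarrow> dir_deriv v f x) (at 0)"
      by (rule LIM_zero_cancel[OF tendsto_norm_zero_cancel])
    moreover have "filterlim s (at 0) sequentially"
      unfolding filterlim_at using s LIMSEQ_inverse_real_of_nat
      by (auto simp: s_def)
    ultimately show ?thesis unfolding q_def by (rule filterlim_compose)
  qed
  have "(\<lambda>k. integral\<^sup>L lborel (q k)) \<longlonglongrightarrow> integral\<^sup>L lborel (dir_deriv v f)"
  proof (rule integral_dominated_convergence[where w = "\<lambda>x. M * indicator K' x"])
    show "integrable lborel (\<lambda>x. M * indicator K' x)"
      using borel_integrable_compact[OF K', of "\<lambda>_. M"] by (simp add: mult.commute)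
  qed (use qi(1) lim qb \<open>integrable lborel (dir_deriv v f)\<close> in auto)
  then show "(\<integral>x. dir_deriv v f x \<partial>lborel) = 0"
    unfolding qi(2) by (simp add: LIMSEQ_const_iff)
qed

text \<open>The coefficient of \<open>d_t\<close> in \<open>Zbar\<close> does not depend on t, so it
  moves inside the t-derivative. What remains is a constant coefficient combination of derivatives
  of compactly supported functions.\<close>

lemma integral_Zbar_eq_0:
  fixes f :: "'n::finite heis \<Rightarrow> complex"
  assumes "\<And>x. f differentiable at x" "\<And>v. continuous_on UNIV (dir_deriv v f)"
    "compact K" "\<And>x. x \<notin> K \<Longrightarrow> f x = 0"
  shows "integrable lborel (Zbar \<alpha> f)" "(\<integral>\<xi>. Zbar \<alpha> f \<xi> \<partial>lborel) = 0"
proof -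
  let ?k = "\<lambda>\<xi>::'n heis. fst \<xi> $ \<alpha>" and ?e = "(0, 1) :: 'n heis"
  have k: "?k differentiable at \<xi>" for \<xi>
    by (rule bounded_linear_imp_differentiable[OF bounded_linear_coord])
  have g: "(\<lambda>\<xi>. ?k \<xi> * f \<xi>) differentiable at \<xi>" for \<xi>
    using assms(1) k by simp
  have dg: "dir_deriv ?e (\<lambda>\<xi>. ?k \<xi> * f \<xi>) = (\<lambda>\<xi>. ?k \<xi> * dir_deriv ?e f \<xi>)"
    by (rule ext) (simp add: dir_deriv_mult[OF k assms(1)] dir_deriv_coords)
  have cont: "continuous_on UNIV (dir_deriv ?e (\<lambda>\<xi>. ?k \<xi> * f \<xi>))"
    unfolding dg by (intro continuous_on_mult linear_continuous_on bounded_linear_coord assms(2))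
  have "?k \<xi> * f \<xi> = 0" if "\<xi> \<notin> K" for \<xi> using assms(4)[OF that] by simp
  note I = integral_dir_deriv_eq_0[OF assms(1,2,3,4)] integral_dir_deriv_eq_0[OF g cont assms(3) this]
  have eq: "Zbar \<alpha> f = (\<lambda>\<xi>. 1/2 * dir_deriv (axis \<alpha> 1, 0) f \<xi> + (\<i>/2) * dir_deriv (axis \<alpha> \<i>, 0) f \<xi>
     + (- \<i>) * dir_deriv ?e (\<lambda>\<xi>. ?k \<xi> * f \<xi>) \<xi>)"
    unfolding dg by (rule ext) (simp add: Zbar_alt)
  have "has_bochner_integral lborel (dir_deriv v f) 0" for v
    using I(1,2) by (simp add: has_bochner_integral_iff)
  moreover have "has_bochner_integral lborel (dir_deriv ?e (\<lambda>\<xi>. ?k \<xi> * f \<xi>)) 0"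
    using I(3,4) by (simp add: has_bochner_integral_iff)
  ultimately have "has_bochner_integral lborel (Zbar \<alpha> f) (1/2 * 0 + (\<i>/2) * 0 + (- \<i>) * 0)"
    unfolding eq by (intro has_bochner_integral_add has_bochner_integral_mult_right)
  then show "integrable lborel (Zbar \<alpha> f)" "(\<integral>\<xi>. Zbar \<alpha> f \<xi> \<partial>lborel) = 0"
    by (simp_all add: has_bochner_integral_iff)
qed

section \<open>Gauge balls\<close>

lemma heis_mult_inv_cancel: "heis_mult \<xi>0 (heis_mult (heis_inv \<xi>0) \<xi>) = \<xi>"
proof -
  have "Im (\<Sum>\<alpha>\<in>UNIV. fst \<xi>0 $ \<alpha> * cnj (fst \<xi>0 $ \<alpha>)) = 0" by (simp add: complex_mult_cnj)
  then show ?thesis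
    by (simp add: heis_mult_def heis_inv_def prod_eq_iff algebra_simps sum.distrib
        sum_negf sum_subtractf)
qed

lemma continuous_on_heis_mult: "continuous_on S (heis_mult \<xi>0)"
  unfolding heis_mult_def by (intro continuous_intros)

text \<open>The fourth power of the gauge distance to \<xi>0. Without the root it is a polynomial in
  the coordinates, hence smooth also at \<xi>0.\<close>

definition gauge4 :: "'n::finite heis \<Rightarrow> 'n heis \<Rightarrow> real" where
  "gauge4 \<xi>0 \<xi> = norm (fst (heis_mult (heis_inv \<xi>0) \<xi>)) ^ 4 + (snd (heis_mult (heis_inv \<xi>0) \<xi>))\<^sup>2"

lemma gauge4_nonneg: "0 \<le> gauge4 \<xi>0 \<xi>"
  by (simp add: gauge4_def)

lemma heis_ball_eq:
  assumes "r > 0"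
  shows "heis_ball \<xi>0 r = {\<xi>. gauge4 \<xi>0 \<xi> < r ^ 4}"
proof -
  have "heis_norm (heis_mult (heis_inv \<xi>0) \<xi>) < r \<longleftrightarrow> gauge4 \<xi>0 \<xi> < r ^ 4" for \<xi>
  proof -
    have "root 4 (gauge4 \<xi>0 \<xi>) < root 4 (r ^ 4) \<longleftrightarrow> gauge4 \<xi>0 \<xi> < r ^ 4"
      by (rule real_root_less_iff) simp
    then show ?thesis using assms by (simp add: heis_norm_def gauge4_def real_root_power_cancel)
  qed
  then show ?thesis by (simp add: heis_ball_def)
qed

lemma continuous_on_gauge4: "continuous_on S (gauge4 \<xi>0)"
  unfolding gauge4_def by (intro continuous_intros continuous_on_heis_mult)

lemma gauge4_le_imp:
  assumes "gauge4 \<xi>0 \<xi> \<le> R ^ 4" "R \<ge> 0"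
  shows "norm (fst (heis_mult (heis_inv \<xi>0) \<xi>)) \<le> R" "\<bar>snd (heis_mult (heis_inv \<xi>0) \<xi>)\<bar> \<le> R\<^sup>2"
proof -
  have R4: "R ^ 4 = (R\<^sup>2)\<^sup>2" by (simp flip: power_mult)
  have "norm (fst (heis_mult (heis_inv \<xi>0) \<xi>)) ^ 4 \<le> (R\<^sup>2)\<^sup>2"
    "(snd (heis_mult (heis_inv \<xi>0) \<xi>))\<^sup>2 \<le> (R\<^sup>2)\<^sup>2"
    using assms(1) zero_le_power[OF norm_ge_zero, of "fst (heis_mult (heis_inv \<xi>0) \<xi>)" 4]
      zero_le_power2[of "snd (heis_mult (heis_inv \<xi>0) \<xi>)"]
    unfolding gauge4_def R4 by linarith+
  then show "norm (fst (heis_mult (heis_inv \<xi>0) \<xi>)) \<le> R" "\<bar>snd (heis_mult (heis_inv \<xi>0) \<xi>)\<bar> \<le> R\<^sup>2"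
    using assms(2) abs_le_square_iff[of "snd (heis_mult (heis_inv \<xi>0) \<xi>)" "R\<^sup>2"]
    by (auto simp: power_mono_iff R4[symmetric])
qed

lemma closed_gauge4: "closed {\<xi>. gauge4 \<xi>0 \<xi> \<le> c}"
  by (intro closed_Collect_le continuous_on_gauge4 continuous_on_const)

text \<open>Left translation by \<xi>0 is continuous and carries a compact box onto a set containing
  this closed ball.\<close>

lemma compact_gauge4:
  assumes "R \<ge> 0"
  shows "compact {\<xi>. gauge4 \<xi>0 \<xi> \<le> R ^ 4}"
proof -
  let ?B = "heis_mult \<xi>0 ` (cball 0 R \<times> {- R\<^sup>2..R\<^sup>2})"
  have "compact ?B"
    by (intro compact_continuous_image continuous_on_heis_mult compact_Times compact_cball compact_Icc)
  moreover have "{\<xi>. gauge4 \<xi>0 \<xi> \<le> R ^ 4} \<subseteq> ?B"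
  proof
    fix \<xi> assume "\<xi> \<in> {\<xi>. gauge4 \<xi>0 \<xi> \<le> R ^ 4}"
    with gauge4_le_imp[of \<xi>0 \<xi> R] assms
    have "heis_mult (heis_inv \<xi>0) \<xi> \<in> cball 0 R \<times> {- R\<^sup>2..R\<^sup>2}"
      by (auto simp: mem_Times_iff)
    then show "\<xi> \<in> ?B" by (rule rev_image_eqI) (simp add: heis_mult_inv_cancel)
  qed
  ultimately show ?thesis
    using compact_Int_closed[OF _ closed_gauge4[of \<xi>0 "R ^ 4"], of ?B]
    by (simp add: Int_absorb1)
qed

text \<open>Slicing over z produces the homogeneous dimension: z ranges over a Euclidean ball of
  radius R in real dimension 2n, and each t-slice lies in an interval of length
  \<open>2 * R^2\<close>. Its centre \<open>c z\<close> is the vertical coordinate that the group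
  law assigns over z, so the interval moves with z but keeps its length.\<close>

lemma emeasure_gauge4_le:
  fixes \<xi>0 :: "'n::finite heis"
  assumes "R \<ge> 0"
  shows "emeasure lborel {\<xi>. gauge4 \<xi>0 \<xi> \<le> R ^ 4}
    \<le> ennreal (2 * unit_ball_vol (2 * real CARD('n)) * R ^ (2 * CARD('n) + 2))"
proof -
  let ?K = "{\<xi>. gauge4 \<xi>0 \<xi> \<le> R ^ 4}"
  define c where "c = (\<lambda>z :: complex ^ 'n. snd \<xi>0 + 2 * Im (\<Sum>\<alpha>\<in>UNIV. fst \<xi>0 $ \<alpha> * cnj (z $ \<alpha>)))"
  have sl: "emeasure lborel (Pair z -` ?K) \<le> ennreal (2 * R\<^sup>2) * indicator (cball (fst \<xi>0) R) z" for z
  proof -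
    have "Pair z -` ?K \<subseteq> (if z \<in> cball (fst \<xi>0) R then {c z - R\<^sup>2..c z + R\<^sup>2} else {})"
    proof
      fix t assume "t \<in> Pair z -` ?K"
      with gauge4_le_imp[of \<xi>0 "(z, t)" R] assms
      have "norm (z - fst \<xi>0) \<le> R" "\<bar>t - c z\<bar> \<le> R\<^sup>2"
        by (auto simp: heis_mult_def heis_inv_def c_def sum_negf algebra_simps)
      then show "t \<in> (if z \<in> cball (fst \<xi>0) R then {c z - R\<^sup>2..c z + R\<^sup>2} else {})"
        by (auto simp: dist_norm norm_minus_commute)
    qed
    then have "emeasure lborel (Pair z -` ?K)
        \<le> emeasure lborel (if z \<in> cball (fst \<xi>0) R then {c z - R\<^sup>2..c z + R\<^sup>2} else {})"
      by (rule emeasure_mono) auto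
    also have "\<dots> = ennreal (2 * R\<^sup>2) * indicator (cball (fst \<xi>0) R) z"
      by (auto simp: indicator_def)
    finally show ?thesis .
  qed
  have "?K \<in> sets (lborel \<Otimes>\<^sub>M lborel)"
    unfolding lborel_prod using closed_gauge4[of \<xi>0 "R ^ 4"] by (simp add: borel_closed)
  then have "emeasure (lborel \<Otimes>\<^sub>M lborel) ?K = (\<integral>\<^sup>+ z. emeasure lborel (Pair z -` ?K) \<partial>lborel)"
    by (rule lborel.emeasure_pair_measure_alt)
  also have "\<dots> \<le> (\<integral>\<^sup>+ z. ennreal (2 * R\<^sup>2) * indicator (cball (fst \<xi>0) R) z \<partial>lborel)"
    by (intro nn_integral_mono sl)
  also have "\<dots> = ennreal (2 * R\<^sup>2) * emeasure lborel (cball (fst \<xi>0) R)"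
    by (subst nn_integral_cmult_indicator) auto
  also have "\<dots> = ennreal (2 * R\<^sup>2) * ennreal (unit_ball_vol (real DIM(complex ^ 'n)) * R ^ DIM(complex ^ 'n))"
    using assms by (simp add: emeasure_cball)
  also have "\<dots> = ennreal (2 * unit_ball_vol (2 * real CARD('n)) * R ^ (2 * CARD('n) + 2))"
    using assms by (subst ennreal_mult[symmetric]) (auto simp: algebra_simps power_add power2_eq_square)
  finally show ?thesis unfolding lborel_prod .
qed

section \<open>The pointwise inequality\<close>

text \<open>Young's inequality with a small constant, for integer exponents only. If s is small
  compared with y, one factor s is traded for \<open>d * y\<close>; otherwise y is at most
  \<open>s / d\<close> and everything is a power of s.\<close>

lemma power_absorption:
  fixes A e :: real
  assumes "0 \<le> A" "0 < e" "i < m"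
  obtains C where "0 \<le> C" "\<And>s y :: real. 0 \<le> s \<Longrightarrow> 0 \<le> y \<Longrightarrow> A * (s ^ (m - i) * y ^ i) \<le> e * y ^ m + C * s ^ m"
proof -
  \<comment> \<open>With \<open>d <= 1\<close> any positive power of d is at most d, and the second
    entry ensures \<open>A * d <= e\<close>, also when A = 0.\<close>
  define d where "d = min 1 (e / (A + 1))"
  have d: "0 < d" "d \<le> 1" "A * d \<le> e"
  proof -
    show "0 < d" "d \<le> 1" using assms by (auto simp: d_def)
    have "A * d \<le> (A + 1) * (e / (A + 1))" using assms by (intro mult_mono) (auto simp: d_def)
    then show "A * d \<le> e" using assms by simp
  qed
  have *: "A * (s ^ (m - i) * y ^ i) \<le> e * y ^ m + A / d ^ i * s ^ m" if "0 \<le> s" "0 \<le> y" for s y :: real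
  proof (cases "s \<le> d * y")
    case True
    have "d ^ (m - i) \<le> d ^ 1" using d assms by (intro power_decreasing) auto
    then have "d ^ (m - i) * y ^ (m - i) \<le> d * y ^ (m - i)"
      using that by (intro mult_right_mono) auto
    then have "s ^ (m - i) \<le> d * y ^ (m - i)"
      using power_mono[OF True that(1), of "m - i"] by (simp add: power_mult_distrib)
    then have "A * (s ^ (m - i) * y ^ i) \<le> A * (d * y ^ (m - i) * y ^ i)"
      using that assms by (intro mult_left_mono mult_right_mono) auto
    also have "\<dots> = (A * d) * y ^ m" using assms(3) by (simp add: mult.assoc flip: power_add)
    also have "\<dots> \<le> e * y ^ m" using d that by (intro mult_right_mono) auto
    finally show ?thesis using assms d that by (simp add: add_increasing2)
  next
    case False
    then have "y \<le> s / d" using d by (simp add: field_simps)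
    then have "y ^ i \<le> (s / d) ^ i" using that by (intro power_mono) auto
    then have "A * (s ^ (m - i) * y ^ i) \<le> A * (s ^ (m - i) * (s / d) ^ i)"
      using that assms by (intro mult_left_mono) auto
    also have "\<dots> = A / d ^ i * s ^ m"
      using assms(3) power_add[of s "m - i" i] by (simp add: power_divide)
    finally show ?thesis using assms that by (simp add: add_increasing)
  qed
  show thesis using assms d by (intro that[of "A / d ^ i"] *) auto
qed

text \<open>All terms are homogeneous of degree 6 when y and \<open>\<tau>\<close> have weight 1, w and h weight 2, and
  \<open>\<sigma>\<close>, \<open>\<rho>\<close>, \<open>\<gamma>\<close> weight 3.\<close>

lemma pointwise_young:
  fixes n a s :: real
  assumes n: "1 \<le> n" and a: "0 < a" "a < 2" and s: "1 \<le> s"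
  obtains dl l \<kappa> C :: real where "0 < dl" "0 < l" "0 < \<kappa>" "0 \<le> C"
    "\<And>y w \<sigma> \<rho> \<gamma> h \<tau> :: real. 0 \<le> y \<Longrightarrow> 0 \<le> w \<Longrightarrow> 0 \<le> \<tau> \<Longrightarrow>
      l / 2 * w ^ 3 - C * \<tau> ^ 6 \<le>
        3 / 2 * \<sigma>\<^sup>2 + \<rho>\<^sup>2 / 2 + 3 * \<gamma>\<^sup>2 - 2 * (\<rho> * \<gamma>) - a * w * (\<sigma> * y) + (2 * n - 1) * a * w * y\<^sup>2 * (y\<^sup>2 + w)
        + dl * (n * y ^ 6 - (n + 2) * y ^ 4 * w - 2 * y\<^sup>2 * (\<sigma> * y))
        + l * (n * w ^ 3 - (n + 2 - 2 * a) * y\<^sup>2 * w\<^sup>2)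
        - s * \<tau> * ((y\<^sup>2 + w) * \<sigma> + \<bar>h\<bar> * (2 * \<rho> + 3 * \<gamma>) + dl * y ^ 5 + l * y * w\<^sup>2)
        + \<kappa> * \<tau>\<^sup>2 * (n * h\<^sup>2 - \<gamma> * y - (y\<^sup>2 + w) * y\<^sup>2)
        - s * \<kappa> * \<tau> ^ 3 * (\<bar>h\<bar> * y)"
proof -
  \<comment> \<open>\<open>dl * (n + 2) <= a\<close> lets \<open>a * w * y^4\<close> absorb the bad
    mixed term of the \<open>dl\<close> field, and \<open>dl <= 1/16\<close> limits its cost in
    \<sigma> to an eighth of the square. The choice of l gives \<open>l * (n + 2) = a / 4\<close>, a
    quarter of the available \<open>a * w^2 * y^2\<close>. The 20 in \<kappa> is 10 + 9 + 1, the
    amounts of \<open>s^2 * \<tau>^2 * h^2\<close> spent in \<open>E3\<close>, \<open>E4\<close> and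
    \<open>E7\<close>.\<close>
  define dl l \<kappa> where "dl = min (1/16) (a / (n + 2))" and "l = a / (4 * (n + 2))" and "\<kappa> = 20 * s\<^sup>2"
  have "dl * (n + 2) \<le> a / (n + 2) * (n + 2)"
    using n by (intro mult_right_mono) (auto simp: dl_def)
  moreover have "dl \<le> 1/16" unfolding dl_def by (rule min.cobounded1)
  ultimately have dl: "0 < dl" "dl \<le> 1/16" "dl * (n + 2) \<le> a"
    using n a by (auto simp: dl_def)
  have l: "0 < l" "l * (n + 2) = a / 4" using n a by (auto simp: l_def field_simps)
  have \<kappa>: "0 < \<kappa>" using s by (simp add: \<kappa>_def)
  \<comment> \<open>\<open>C1\<close>, \<open>C2\<close>, \<open>C3\<close> handle the mixed terms
    \<open>\<tau>^2 * y^4\<close>, \<open>\<tau>^4 * y^2\<close> and \<open>\<tau> * y^5\<close>,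
    each at the price of a third of the remaining \<open>dl / 2 * y^6\<close>. \<open>C4\<close>
    handles \<open>\<tau>^2 * w^2\<close>; it is applied with \<open>\<tau>^2\<close> as base, so
    that its cube is again \<open>\<tau>^6\<close>.\<close>
  obtain C1 where C1: "0 \<le> C1" "\<And>s' y :: real. 0 \<le> s' \<Longrightarrow> 0 \<le> y \<Longrightarrow>
      (2 * s\<^sup>2 + 2 * \<kappa>) * (s' ^ (6 - 4) * y ^ 4) \<le> dl / 6 * y ^ 6 + C1 * s' ^ 6"
    using power_absorption[of "2 * s\<^sup>2 + 2 * \<kappa>" "dl / 6" 4 6] dl \<kappa> s by auto
  obtain C2 where C2: "0 \<le> C2" "\<And>s' y :: real. 0 \<le> s' \<Longrightarrow> 0 \<le> y \<Longrightarrow>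
      (5/4 * \<kappa>\<^sup>2) * (s' ^ (6 - 2) * y ^ 2) \<le> dl / 6 * y ^ 6 + C2 * s' ^ 6"
    using power_absorption[of "5/4 * \<kappa>\<^sup>2" "dl / 6" 2 6] dl by auto
  obtain C3 where C3: "0 \<le> C3" "\<And>s' y :: real. 0 \<le> s' \<Longrightarrow> 0 \<le> y \<Longrightarrow>
      (s * dl) * (s' ^ (6 - 5) * y ^ 5) \<le> dl / 6 * y ^ 6 + C3 * s' ^ 6"
    using power_absorption[of "s * dl" "dl / 6" 5 6] dl s by auto
  obtain C4 where C4: "0 \<le> C4" "\<And>s' y :: real. 0 \<le> s' \<Longrightarrow> 0 \<le> y \<Longrightarrow>
      (2 * s\<^sup>2 + s\<^sup>2 * l\<^sup>2 / a + \<kappa>) * (s' ^ (3 - 2) * y ^ 2) \<le> l / 2 * y ^ 3 + C4 * s' ^ 3"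
    using power_absorption[of "2 * s\<^sup>2 + s\<^sup>2 * l\<^sup>2 / a + \<kappa>" "l / 2" 2 3] l \<kappa> s a by auto
  have main: "l / 2 * w ^ 3 - (C1 + C2 + C3 + C4) * \<tau> ^ 6 \<le>
        3 / 2 * \<sigma>\<^sup>2 + \<rho>\<^sup>2 / 2 + 3 * \<gamma>\<^sup>2 - 2 * (\<rho> * \<gamma>) - a * w * (\<sigma> * y) + (2 * n - 1) * a * w * y\<^sup>2 * (y\<^sup>2 + w)
        + dl * (n * y ^ 6 - (n + 2) * y ^ 4 * w - 2 * y\<^sup>2 * (\<sigma> * y))
        + l * (n * w ^ 3 - (n + 2 - 2 * a) * y\<^sup>2 * w\<^sup>2)
        - s * \<tau> * ((y\<^sup>2 + w) * \<sigma> + \<bar>h\<bar> * (2 * \<rho> + 3 * \<gamma>) + dl * y ^ 5 + l * y * w\<^sup>2)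
        + \<kappa> * \<tau>\<^sup>2 * (n * h\<^sup>2 - \<gamma> * y - (y\<^sup>2 + w) * y\<^sup>2)
        - s * \<kappa> * \<tau> ^ 3 * (\<bar>h\<bar> * y)"
    if y: "0 \<le> y" and w: "0 \<le> w" and \<tau>: "0 \<le> \<tau>" for y w \<sigma> \<rho> \<gamma> h \<tau> :: real
  proof -
    have amgm: "u * v \<le> u\<^sup>2 * k / 2 + v\<^sup>2 / (2 * k)" if "0 < k" for u v k :: real
    proof -
      have "0 \<le> (k * u - v)\<^sup>2 / (2 * k)" using that by simp
      also have "\<dots> = u\<^sup>2 * k / 2 + v\<^sup>2 / (2 * k) - u * v"
        using that by (simp add: power2_eq_square field_simps)
      finally show ?thesis by simp
    qed
    \<comment> \<open>The form in \<rho> and \<gamma> is positive definite. The split with weight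
      4/5 leaves exactly the \<rho> part spent in \<open>E3\<close> and two quarters of the \<gamma>
      square for \<open>E4\<close> and \<open>E5\<close>.\<close>
    have A: "\<rho>\<^sup>2 / 10 + \<gamma>\<^sup>2 / 2 \<le> \<rho>\<^sup>2 / 2 + 3 * \<gamma>\<^sup>2 - 2 * (\<rho> * \<gamma>)"
      using amgm[of "4/5" "\<rho>" "2 * \<gamma>"] by (simp add: power2_eq_square field_simps)
    \<comment> \<open>Here \<open>a < 2\<close> enters: \<open>a^2 / 4 <= a / 2\<close>, so half of
      the good \<open>a * w^2 * y^2\<close> survives, a quarter for \<open>B6\<close> and a quarter
      for \<open>E8\<close>.\<close>
    have B: "a * w * (\<sigma> * y) \<le> \<sigma>\<^sup>2 + a / 2 * (w\<^sup>2 * y\<^sup>2)"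
    proof -
      have "a * w * (\<sigma> * y) \<le> \<sigma>\<^sup>2 + (a * w * y)\<^sup>2 / 4"
        using amgm[of 2 \<sigma> "a * w * y"] by (simp add: mult_ac)
      also have "(a * w * y)\<^sup>2 / 4 = (a * a) / 4 * (w\<^sup>2 * y\<^sup>2)" by (simp add: power2_eq_square)
      also have "\<dots> \<le> (a * 2) / 4 * (w\<^sup>2 * y\<^sup>2)" using a by (intro mult_right_mono divide_right_mono mult_left_mono) auto
      finally show ?thesis by simp
    qed
    have B2: "a * (w * y ^ 4) + a * (w\<^sup>2 * y\<^sup>2) \<le> (2 * n - 1) * a * w * y\<^sup>2 * (y\<^sup>2 + w)"
    proof -
      have "1 * (a * w * y\<^sup>2 * (y\<^sup>2 + w)) \<le> (2 * n - 1) * (a * w * y\<^sup>2 * (y\<^sup>2 + w))"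
        using n a w by (intro mult_right_mono) auto
      then show ?thesis by (simp add: algebra_simps power2_eq_square eval_nat_numeral)
    qed
    have B3: "dl * ((n + 2) * y ^ 4 * w) \<le> a * (w * y ^ 4)"
      using mult_right_mono[OF dl(3), of "w * y ^ 4"] w by (simp add: mult_ac)
    have B4: "dl * y ^ 6 \<le> dl * (n * y ^ 6)"
      using dl n mult_right_mono[OF n, of "y ^ 6"] by (intro mult_left_mono) auto
    have B5: "dl * (2 * y\<^sup>2 * (\<sigma> * y)) \<le> dl / 2 * y ^ 6 + \<sigma>\<^sup>2 / 8"
    proof -
      have "2 * y\<^sup>2 * (\<sigma> * y) \<le> y ^ 6 / 2 + 2 * \<sigma>\<^sup>2"
        using amgm[of 1 "y ^ 3" "2 * \<sigma>"] by (simp add: field_simps eval_nat_numeral)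
      then have "dl * (2 * y\<^sup>2 * (\<sigma> * y)) \<le> dl * (y ^ 6 / 2 + 2 * \<sigma>\<^sup>2)"
        using dl by (intro mult_left_mono) auto
      moreover have "dl * (2 * \<sigma>\<^sup>2) \<le> 1/16 * (2 * \<sigma>\<^sup>2)" using dl by (intro mult_right_mono) auto
      ultimately show ?thesis by (simp add: algebra_simps)
    qed
    have B6: "l * ((n + 2 - 2 * a) * y\<^sup>2 * w\<^sup>2) \<le> a / 4 * (w\<^sup>2 * y\<^sup>2)"
    proof -
      have "l * (n + 2 - 2 * a) \<le> a / 4" using l a by (simp add: algebra_simps)
      from mult_right_mono[OF this, of "w\<^sup>2 * y\<^sup>2"] show ?thesis by (simp add: mult_ac)
    qed
    have B7: "l * w ^ 3 \<le> l * (n * w ^ 3)"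
      using l n w mult_right_mono[OF n, of "w ^ 3"] by (intro mult_left_mono) auto
    have E1: "s * \<tau> * (y\<^sup>2 * \<sigma>) \<le> \<sigma>\<^sup>2 / 8 + 2 * s\<^sup>2 * (\<tau>\<^sup>2 * y ^ 4)"
      using amgm[of "1/4" \<sigma> "s * \<tau> * y\<^sup>2"] by (simp add: power_mult_distrib mult_ac flip: power_mult)
    have E2: "s * \<tau> * (w * \<sigma>) \<le> \<sigma>\<^sup>2 / 8 + 2 * s\<^sup>2 * (\<tau>\<^sup>2 * w\<^sup>2)"
      using amgm[of "1/4" \<sigma> "s * \<tau> * w"] by (simp add: power_mult_distrib mult_ac)
    have E3: "s * \<tau> * (\<bar>h\<bar> * (2 * \<rho>)) \<le> \<rho>\<^sup>2 / 10 + 10 * (s\<^sup>2 * \<tau>\<^sup>2 * h\<^sup>2)"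
      using amgm[of "1/5" \<rho> "s * \<tau> * (2 * \<bar>h\<bar>)"] by (simp add: power_mult_distrib mult_ac)
    have E4: "s * \<tau> * (\<bar>h\<bar> * (3 * \<gamma>)) \<le> \<gamma>\<^sup>2 / 4 + 9 * (s\<^sup>2 * \<tau>\<^sup>2 * h\<^sup>2)"
      using amgm[of "1/2" \<gamma> "s * \<tau> * (3 * \<bar>h\<bar>)"] by (simp add: power_mult_distrib mult_ac)
    have E5: "\<kappa> * \<tau>\<^sup>2 * (\<gamma> * y) \<le> \<gamma>\<^sup>2 / 4 + \<kappa>\<^sup>2 * (\<tau> ^ 4 * y\<^sup>2)"
      using amgm[of "1/2" \<gamma> "\<kappa> * \<tau>\<^sup>2 * y"] by (simp add: power_mult_distrib mult_ac flip: power_mult)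
    have E6: "20 * (s\<^sup>2 * \<tau>\<^sup>2 * h\<^sup>2) \<le> \<kappa> * \<tau>\<^sup>2 * (n * h\<^sup>2)"
    proof -
      have "1 * (\<kappa> * \<tau>\<^sup>2 * h\<^sup>2) \<le> n * (\<kappa> * \<tau>\<^sup>2 * h\<^sup>2)" using n \<kappa> by (intro mult_right_mono) auto
      then show ?thesis by (simp add: \<kappa>_def mult_ac)
    qed
    have E7: "s * \<kappa> * \<tau> ^ 3 * (\<bar>h\<bar> * y) \<le> s\<^sup>2 * \<tau>\<^sup>2 * h\<^sup>2 + \<kappa>\<^sup>2 / 4 * (\<tau> ^ 4 * y\<^sup>2)"
    proof -
      have "s * \<kappa> * \<tau> ^ 3 * (\<bar>h\<bar> * y) = (s * \<tau> * \<bar>h\<bar>) * (\<kappa> * \<tau>\<^sup>2 * y)"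
        by (simp add: eval_nat_numeral mult_ac)
      also have "\<dots> \<le> (s * \<tau> * \<bar>h\<bar>)\<^sup>2 * 2 / 2 + (\<kappa> * \<tau>\<^sup>2 * y)\<^sup>2 / (2 * 2)" by (rule amgm) simp
      finally show ?thesis by (simp add: power_mult_distrib mult_ac flip: power_mult)
    qed
    have E8: "s * \<tau> * (l * y * w\<^sup>2) \<le> a / 4 * (w\<^sup>2 * y\<^sup>2) + s\<^sup>2 * l\<^sup>2 / a * (\<tau>\<^sup>2 * w\<^sup>2)"
    proof -
      have "s * \<tau> * (l * y * w\<^sup>2) = (w * y) * (s * \<tau> * l * w)" by (simp add: power2_eq_square mult_ac)
      also have "\<dots> \<le> (w * y)\<^sup>2 * (a / 2) / 2 + (s * \<tau> * l * w)\<^sup>2 / (2 * (a / 2))" using a by (intro amgm) simp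
      finally show ?thesis by (simp add: power_mult_distrib mult_ac)
    qed
    have E9: "\<kappa> * \<tau>\<^sup>2 * (w * y\<^sup>2) \<le> \<kappa> * (\<tau>\<^sup>2 * w\<^sup>2) + \<kappa> * (\<tau>\<^sup>2 * y ^ 4)"
    proof -
      have "w * y\<^sup>2 \<le> w\<^sup>2 * 2 / 2 + (y\<^sup>2)\<^sup>2 / (2 * 2)" by (rule amgm) simp
      also have "\<dots> \<le> w\<^sup>2 + y ^ 4" by (simp flip: power_mult)
      finally have "\<kappa> * \<tau>\<^sup>2 * (w * y\<^sup>2) \<le> \<kappa> * \<tau>\<^sup>2 * (w\<^sup>2 + y ^ 4)" using \<kappa> by (intro mult_left_mono) auto
      then show ?thesis by (simp add: algebra_simps)
    qed
    have T: "(\<tau>\<^sup>2) ^ 3 = \<tau> ^ 6" by (simp flip: power_mult)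
    have c1: "2 * s\<^sup>2 * (\<tau>\<^sup>2 * y ^ 4) + 2 * \<kappa> * (\<tau>\<^sup>2 * y ^ 4) \<le> dl / 6 * y ^ 6 + C1 * \<tau> ^ 6"
      using C1(2)[OF \<tau> y] by (simp add: algebra_simps)
    have c2: "\<kappa>\<^sup>2 * (\<tau> ^ 4 * y\<^sup>2) + \<kappa>\<^sup>2 / 4 * (\<tau> ^ 4 * y\<^sup>2) \<le> dl / 6 * y ^ 6 + C2 * \<tau> ^ 6"
      using C2(2)[OF \<tau> y] by (simp add: algebra_simps)
    have c3: "s * \<tau> * (dl * y ^ 5) \<le> dl / 6 * y ^ 6 + C3 * \<tau> ^ 6"
      using C3(2)[OF \<tau> y] by (simp add: algebra_simps)
    have c4: "2 * s\<^sup>2 * (\<tau>\<^sup>2 * w\<^sup>2) + s\<^sup>2 * l\<^sup>2 / a * (\<tau>\<^sup>2 * w\<^sup>2) + \<kappa> * (\<tau>\<^sup>2 * w\<^sup>2) \<le> l / 2 * w ^ 3 + C4 * \<tau> ^ 6"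
      using C4(2)[OF zero_le_power2[of \<tau>] w] by (simp add: algebra_simps T)
    have y4: "y\<^sup>2 * y\<^sup>2 = y ^ 4" by (simp flip: power_add)
    have r1: "dl * (n * y ^ 6 - (n + 2) * y ^ 4 * w - 2 * y\<^sup>2 * (\<sigma> * y))
      = dl * (n * y ^ 6) - dl * ((n + 2) * y ^ 4 * w) - dl * (2 * y\<^sup>2 * (\<sigma> * y))" by (simp only: right_diff_distrib)
    have r2: "l * (n * w ^ 3 - (n + 2 - 2 * a) * y\<^sup>2 * w\<^sup>2)
      = l * (n * w ^ 3) - l * ((n + 2 - 2 * a) * y\<^sup>2 * w\<^sup>2)" by (simp only: right_diff_distrib)
    have r3: "s * \<tau> * ((y\<^sup>2 + w) * \<sigma> + \<bar>h\<bar> * (2 * \<rho> + 3 * \<gamma>) + dl * y ^ 5 + l * y * w\<^sup>2)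
      = s * \<tau> * (y\<^sup>2 * \<sigma>) + s * \<tau> * (w * \<sigma>) + s * \<tau> * (\<bar>h\<bar> * (2 * \<rho>)) + s * \<tau> * (\<bar>h\<bar> * (3 * \<gamma>))
        + s * \<tau> * (dl * y ^ 5) + s * \<tau> * (l * y * w\<^sup>2)"
      by (simp only: distrib_left distrib_right add.assoc)
    have r4: "\<kappa> * \<tau>\<^sup>2 * (n * h\<^sup>2 - \<gamma> * y - (y\<^sup>2 + w) * y\<^sup>2)
      = \<kappa> * \<tau>\<^sup>2 * (n * h\<^sup>2) - \<kappa> * \<tau>\<^sup>2 * (\<gamma> * y) - \<kappa> * (\<tau>\<^sup>2 * y ^ 4) - \<kappa> * \<tau>\<^sup>2 * (w * y\<^sup>2)"
      by (simp add: right_diff_distrib distrib_right distrib_left y4 mult.assoc)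
    have r5: "(C1 + C2 + C3 + C4) * \<tau> ^ 6 = C1 * \<tau> ^ 6 + C2 * \<tau> ^ 6 + C3 * \<tau> ^ 6 + C4 * \<tau> ^ 6"
      by (simp only: distrib_right)
    \<comment> \<open>The budget left for the cutoff errors. Of the 3/2 in front of the \<sigma>
      square, \<open>B\<close> took 1 and \<open>B5\<close> took 1/8; \<open>E1\<close> and
      \<open>E2\<close> will take 1/8 each.\<close>
    have g1: "3 / 8 * \<sigma>\<^sup>2 + \<rho>\<^sup>2 / 10 + \<gamma>\<^sup>2 / 2 + a / 4 * (w\<^sup>2 * y\<^sup>2) + dl / 2 * y ^ 6 + l * w ^ 3
      \<le> 3 / 2 * \<sigma>\<^sup>2 + \<rho>\<^sup>2 / 2 + 3 * \<gamma>\<^sup>2 - 2 * (\<rho> * \<gamma>) - a * w * (\<sigma> * y) + (2 * n - 1) * a * w * y\<^sup>2 * (y\<^sup>2 + w)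
        + dl * (n * y ^ 6 - (n + 2) * y ^ 4 * w - 2 * y\<^sup>2 * (\<sigma> * y))
        + l * (n * w ^ 3 - (n + 2 - 2 * a) * y\<^sup>2 * w\<^sup>2)"
      unfolding r1 r2 using A B B2 B3 B4 B5 B6 B7 by linarith
    have g2: "s * \<tau> * ((y\<^sup>2 + w) * \<sigma> + \<bar>h\<bar> * (2 * \<rho> + 3 * \<gamma>) + dl * y ^ 5 + l * y * w\<^sup>2)
      \<le> \<sigma>\<^sup>2 / 4 + 2 * s\<^sup>2 * (\<tau>\<^sup>2 * y ^ 4) + 2 * s\<^sup>2 * (\<tau>\<^sup>2 * w\<^sup>2) + \<rho>\<^sup>2 / 10 + \<gamma>\<^sup>2 / 4
        + 19 * (s\<^sup>2 * \<tau>\<^sup>2 * h\<^sup>2) + s * \<tau> * (dl * y ^ 5) + (a / 4 * (w\<^sup>2 * y\<^sup>2) + s\<^sup>2 * l\<^sup>2 / a * (\<tau>\<^sup>2 * w\<^sup>2))"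
      unfolding r3
      by (rule order_trans[OF add_mono[OF add_mono[OF add_mono[OF add_mono[OF add_mono[OF E1 E2] E3] E4] order_refl] E8]]) linarith
    have g3: "20 * (s\<^sup>2 * \<tau>\<^sup>2 * h\<^sup>2) - \<gamma>\<^sup>2 / 4 - \<kappa>\<^sup>2 * (\<tau> ^ 4 * y\<^sup>2) - 2 * \<kappa> * (\<tau>\<^sup>2 * y ^ 4) - \<kappa> * (\<tau>\<^sup>2 * w\<^sup>2)
      \<le> \<kappa> * \<tau>\<^sup>2 * (n * h\<^sup>2 - \<gamma> * y - (y\<^sup>2 + w) * y\<^sup>2)"
      unfolding r4 using E5 E6 E9 by linarith
    show ?thesis unfolding r5
      using g1 g2 g3 E7 c1 c2 c3 c4 zero_le_power2[of \<sigma>] by linarith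
  qed
  show thesis
    using dl(1) l(1) \<kappa> C1(1) C2(1) C3(1) C4(1) by (intro that[OF _ _ _ _ main]) auto
qed

section \<open>The Jerison--Lee calculus\<close>

definition div_bar :: "('n::finite \<Rightarrow> 'n heis \<Rightarrow> complex) \<Rightarrow> 'n heis \<Rightarrow> complex" where
  "div_bar V \<xi> = (\<Sum>\<alpha>\<in>UNIV. Zbar \<alpha> (V \<alpha>) \<xi>)"

lemma div_bar_scale:
  assumes "k differentiable at \<xi>" "\<And>\<alpha>. V \<alpha> differentiable at \<xi>"
  shows "div_bar (\<lambda>\<alpha> \<eta>. k \<eta> * V \<alpha> \<eta>) \<xi> = k \<xi> * div_bar V \<xi> + (\<Sum>\<alpha>\<in>UNIV. Zbar \<alpha> k \<xi> * V \<alpha> \<xi>)"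
  using assms
  by (simp add: div_bar_def complex_field_mult[OF complex_field_Zbar] sum.distrib sum_distrib_left add.commute)

lemma div_bar_add:
  assumes "\<And>\<alpha>. U \<alpha> differentiable at \<xi>" "\<And>\<alpha>. V \<alpha> differentiable at \<xi>"
  shows "div_bar (\<lambda>\<alpha> \<eta>. U \<alpha> \<eta> + V \<alpha> \<eta>) \<xi> = div_bar U \<xi> + div_bar V \<xi>"
  using assms by (simp add: div_bar_def complex_field_add[OF complex_field_Zbar] sum.distrib)

lemma sum_delta_mult:
  "(\<Sum>\<beta>\<in>UNIV. (if \<alpha> = \<beta> then c else 0) * k \<beta>) = c * (k (\<alpha>::'n::finite) :: complex)"
  "(\<Sum>\<beta>\<in>UNIV. k \<beta> * (if \<alpha> = \<beta> then c else 0)) = k \<alpha> * c"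
  "(\<Sum>\<beta>\<in>UNIV. (if \<beta> = \<alpha> then c else 0) * k \<beta>) = c * k \<alpha>"
  "(\<Sum>\<beta>\<in>UNIV. k \<beta> * (if \<beta> = \<alpha> then c else 0)) = k \<alpha> * c"
  by (simp_all add: if_distrib[of "\<lambda>x. x * _"] if_distrib[of "\<lambda>x. _ * x"] cong: if_cong)

text \<open>Only the trace of \<open>Zbar Z\<close> appears in the equation: the opposite order
  differs by the commutator, and symmetrizing is what puts the term with \<open>d_t\<close> on the
  right. \<open>n\<close> is kept as a complex constant because it multiplies complex tensors
  throughout.\<close>

locale heis_solution =
  fixes S :: "'n::finite heis set" and f :: "'n heis \<Rightarrow> real" and p :: real and n :: complex
  assumes n_eq: "n = of_nat CARD('n)" and open_S: "open S" and smooth_f: "smooth_on S f"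
    and equation: "\<And>\<xi>. \<xi> \<in> S \<Longrightarrow>
      (\<Sum>\<alpha>\<in>UNIV. Zbar \<alpha> (Z \<alpha> (\<lambda>\<eta>. complex_of_real (f \<eta>))) \<xi>)
      = - n * ((\<Sum>\<alpha>\<in>UNIV. Z \<alpha> (\<lambda>\<eta>. complex_of_real (f \<eta>)) \<xi> * Zbar \<alpha> (\<lambda>\<eta>. complex_of_real (f \<eta>)) \<xi>)
         + exp ((2 + p) * f \<xi>) - \<i> * d_t (\<lambda>\<eta>. complex_of_real (f \<eta>)) \<xi>)"
begin

text \<open>In index notation \<open>a \<alpha>\<close> is $f_\alpha$, \<open>ab \<alpha>\<close> is $f_{\bar\alpha}$, \<open>h\<close> is $f_0$, and
  $f_{\alpha\beta}$ is \<open>Z \<beta> (Z \<alpha> f)\<close>; \<open>D\<close> and \<open>E\<close> are the contractions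
  $D_{\alpha\beta}f_{\bar\beta}$ and $E_{\alpha\bar\beta}f_\beta$ of the tensors \<open>Dm\<close> and \<open>Em\<close>.\<close>

definition F :: "'n heis \<Rightarrow> complex" where "F \<xi> = complex_of_real (f \<xi>)"
definition a :: "'n \<Rightarrow> 'n heis \<Rightarrow> complex" where "a \<alpha> = Z \<alpha> F"
definition ab :: "'n \<Rightarrow> 'n heis \<Rightarrow> complex" where "ab \<alpha> = Zbar \<alpha> F"
definition h :: "'n heis \<Rightarrow> complex" where "h = d_t F"
definition X :: "'n heis \<Rightarrow> complex" where "X \<xi> = (\<Sum>\<alpha>\<in>UNIV. a \<alpha> \<xi> * ab \<alpha> \<xi>)"
definition W :: "'n heis \<Rightarrow> complex" where "W \<xi> = complex_of_real (exp ((2 + p) * f \<xi>))"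
definition g :: "'n heis \<Rightarrow> complex" where "g \<xi> = X \<xi> + W \<xi> - \<i> * h \<xi>"
definition Dm :: "'n \<Rightarrow> 'n \<Rightarrow> 'n heis \<Rightarrow> complex" where
  "Dm \<alpha> \<beta> \<xi> = Z \<beta> (a \<alpha>) \<xi> - 2 * a \<alpha> \<xi> * a \<beta> \<xi>"
text \<open>Adding g on the diagonal makes the tensor trace free, since the equation says that the
  trace of the mixed second derivatives is -n g.\<close>

definition Em :: "'n \<Rightarrow> 'n \<Rightarrow> 'n heis \<Rightarrow> complex" where
  "Em \<alpha> \<beta> \<xi> = Zbar \<beta> (a \<alpha>) \<xi> + (if \<alpha> = \<beta> then 1 else 0) * g \<xi>"
definition D :: "'n \<Rightarrow> 'n heis \<Rightarrow> complex" where "D \<alpha> \<xi> = (\<Sum>\<beta>\<in>UNIV. Dm \<alpha> \<beta> \<xi> * ab \<beta> \<xi>)"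
definition E :: "'n \<Rightarrow> 'n heis \<Rightarrow> complex" where "E \<alpha> \<xi> = (\<Sum>\<beta>\<in>UNIV. Em \<alpha> \<beta> \<xi> * a \<beta> \<xi>)"
text \<open>Equivalently \<open>G \<alpha> = \<i> * Z \<alpha> h + g * a \<alpha>\<close>. Written
  this way, \<open>D\<close>, \<open>E\<close> and \<open>G\<close> express the derivatives of X, h
  and g up to multiples of the gradient of f.\<close>

definition G :: "'n \<Rightarrow> 'n heis \<Rightarrow> complex" where
  "G \<alpha> \<xi> = \<i> * Z \<alpha> h \<xi> - \<i> * (h \<xi> * a \<alpha> \<xi>) + (X \<xi> + W \<xi>) * a \<alpha> \<xi>"

lemma smooth_F: "smooth_on S F"
  using smooth_on_bounded_linear[OF open_S bounded_linear_of_real smooth_f] by (simp add: F_def[abs_def])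

lemma smooth_a: "smooth_on S (a \<alpha>)"
  unfolding a_def by (rule complex_field_smooth[OF complex_field_Z open_S smooth_F])
lemma smooth_ab: "smooth_on S (ab \<alpha>)"
  unfolding ab_def by (rule complex_field_smooth[OF complex_field_Zbar open_S smooth_F])
lemma smooth_h: "smooth_on S h"
  unfolding h_def by (rule complex_field_smooth[OF complex_field_d_t open_S smooth_F])
lemma smooth_X: "smooth_on S X"
  unfolding X_def[abs_def] by (intro smooth_on_sum smooth_on_mult open_S smooth_a smooth_ab)

lemma smooth_exp_f: "smooth_on S (\<lambda>\<xi>. complex_of_real (exp (c * f \<xi>)))"
  by (intro smooth_on_bounded_linear[OF open_S bounded_linear_of_real] smooth_on_exp smooth_on_mult
      smooth_on_const open_S smooth_f)

lemma smooth_W: "smooth_on S W"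
  unfolding W_def[abs_def] by (rule smooth_exp_f)
lemma smooth_g: "smooth_on S g"
  unfolding g_def[abs_def]
  by (intro smooth_on_diff smooth_on_add smooth_on_mult smooth_on_const open_S smooth_X smooth_W smooth_h)
lemma smooth_Dm: "smooth_on S (Dm \<alpha> \<beta>)"
  unfolding Dm_def[abs_def]
  by (intro smooth_on_diff smooth_on_mult smooth_on_const open_S smooth_a complex_field_smooth[OF complex_field_Z])
lemma smooth_Em: "smooth_on S (Em \<alpha> \<beta>)"
  unfolding Em_def[abs_def]
  by (intro smooth_on_add smooth_on_mult smooth_on_const open_S smooth_a smooth_g complex_field_smooth[OF complex_field_Zbar])
lemma smooth_D: "smooth_on S (D \<alpha>)"
  unfolding D_def[abs_def] by (intro smooth_on_sum smooth_on_mult open_S smooth_Dm smooth_ab)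
lemma smooth_E: "smooth_on S (E \<alpha>)"
  unfolding E_def[abs_def]
  by (intro smooth_on_sum smooth_on_mult open_S smooth_Em smooth_a)
lemma smooth_G: "smooth_on S (G \<alpha>)"
  unfolding G_def[abs_def]
  by (intro smooth_on_diff smooth_on_add smooth_on_mult smooth_on_const open_S smooth_X smooth_W smooth_h
      smooth_a complex_field_smooth[OF complex_field_Z])

lemmas smooth_all = smooth_F smooth_a smooth_ab smooth_h smooth_X smooth_W smooth_g smooth_Dm smooth_Em
  smooth_D smooth_E smooth_G

lemmas diff_all = smooth_all[THEN smooth_on_differentiable]

lemmas diff_second =
  smooth_on_differentiable[OF complex_field_smooth[OF complex_field_Z open_S smooth_a]]
  smooth_on_differentiable[OF complex_field_smooth[OF complex_field_Zbar open_S smooth_a]]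
  smooth_on_differentiable[OF complex_field_smooth[OF complex_field_Z open_S smooth_h]]

lemmas Zr = complex_field_mult[OF complex_field_Z] complex_field_add[OF complex_field_Z]
  complex_field_diff[OF complex_field_Z] complex_field_const[OF complex_field_Z]
  complex_field_sum[OF complex_field_Z]
lemmas Br = complex_field_mult[OF complex_field_Zbar] complex_field_add[OF complex_field_Zbar]
  complex_field_diff[OF complex_field_Zbar] complex_field_const[OF complex_field_Zbar]
  complex_field_sum[OF complex_field_Zbar]
lemmas Tr = complex_field_mult[OF complex_field_d_t] complex_field_add[OF complex_field_d_t]
  complex_field_diff[OF complex_field_d_t] complex_field_const[OF complex_field_d_t]
  complex_field_sum[OF complex_field_d_t]

lemma cnj_F: "cnj (F \<xi>) = F \<xi>" by (simp add: F_def)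

lemma ab_eq: assumes "\<xi> \<in> S" shows "ab \<alpha> \<xi> = cnj (a \<alpha> \<xi>)"
  using Zbar_cnj[OF diff_all(1)[OF assms], of \<alpha>] by (simp add: cnj_F a_def ab_def)

lemma cnj_h: assumes "\<xi> \<in> S" shows "cnj (h \<xi>) = h \<xi>"
  using d_t_cnj[OF diff_all(1)[OF assms], symmetric] by (simp add: cnj_F h_def)

lemma cnj_X: assumes "\<xi> \<in> S" shows "cnj (X \<xi>) = X \<xi>"
  using assms by (simp add: X_def ab_eq mult.commute)

lemma cnj_W: "cnj (W \<xi>) = W \<xi>" by (simp add: W_def)

lemma field_exp_f:
  assumes "complex_field L" "\<xi> \<in> S"
  shows "L (\<lambda>\<xi>. complex_of_real (exp (c * f \<xi>))) \<xi> = c * complex_of_real (exp (c * f \<xi>)) * L F \<xi>"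
proof -
  have "((\<lambda>x. exp (c * x)) has_real_derivative c * exp (c * f \<xi>)) (at (f \<xi>))"
    by (auto intro!: derivative_eq_intros)
  from complex_field_real_chain[OF assms(1) smooth_on_differentiable[OF smooth_f assms(2)] this]
  show ?thesis by (simp add: F_def[abs_def])
qed

lemma Z_W: "\<xi> \<in> S \<Longrightarrow> Z \<alpha> W \<xi> = (2 + p) * W \<xi> * a \<alpha> \<xi>"
  using field_exp_f[OF complex_field_Z] by (simp add: W_def[abs_def] a_def)
lemma Zbar_W: "\<xi> \<in> S \<Longrightarrow> Zbar \<alpha> W \<xi> = (2 + p) * W \<xi> * ab \<alpha> \<xi>"
  using field_exp_f[OF complex_field_Zbar] by (simp add: W_def[abs_def] ab_def)
lemma d_t_W: "\<xi> \<in> S \<Longrightarrow> d_t W \<xi> = (2 + p) * W \<xi> * h \<xi>"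
  using field_exp_f[OF complex_field_d_t] by (simp add: W_def[abs_def] h_def)

lemma Z_a: "Z \<beta> (a \<alpha>) \<xi> = Dm \<alpha> \<beta> \<xi> + 2 * a \<alpha> \<xi> * a \<beta> \<xi>"
  by (simp add: Dm_def)

lemma Zbar_a: "Zbar \<beta> (a \<alpha>) \<xi> = Em \<alpha> \<beta> \<xi> - (if \<alpha> = \<beta> then 1 else 0) * g \<xi>"
  by (simp add: Em_def)

lemma Dm_sym: "\<xi> \<in> S \<Longrightarrow> Dm \<alpha> \<beta> \<xi> = Dm \<beta> \<alpha> \<xi>"
  using commutators(1)[OF open_S _ smooth_F] by (simp add: Dm_def a_def mult.commute)

lemma Zbar_cnj_fun:
  assumes "\<xi> \<in> S" "k differentiable at \<xi>" "\<And>\<eta>. \<eta> \<in> S \<Longrightarrow> k' \<eta> = cnj (k \<eta>)"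
  shows "Zbar \<alpha> k' \<xi> = cnj (Z \<alpha> k \<xi>)"
  using complex_field_cong[OF complex_field_Zbar open_S assms(1,3)] Zbar_cnj[OF assms(2)] by simp

lemma Z_ab: assumes "\<xi> \<in> S"
  shows "Z \<alpha> (ab \<beta>) \<xi> = Em \<alpha> \<beta> \<xi> - (if \<alpha> = \<beta> then 1 else 0) * (g \<xi> + 2 * \<i> * h \<xi>)"
  using commutators(3)[OF open_S assms smooth_F, of \<beta> \<alpha>]
  by (auto simp: ab_def Em_def a_def h_def algebra_simps)

text \<open>The mixed second derivatives alone are not Hermitian: exchanging the order costs
  \<open>2 * \<i> * h\<close> on the diagonal. That is exactly the difference between the conjugate
  of g and g, so the corrected tensor is Hermitian.\<close>

lemma cnj_Em: assumes "\<xi> \<in> S" shows "cnj (Em \<alpha> \<beta> \<xi>) = Em \<beta> \<alpha> \<xi>"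
proof -
  have "cnj (Zbar \<beta> (a \<alpha>) \<xi>) = Z \<beta> (ab \<alpha>) \<xi>"
    using Z_cnj[OF diff_all(2)[OF assms], of \<beta> \<alpha>]
      complex_field_cong[OF complex_field_Z open_S assms, of "ab \<alpha>" "\<lambda>\<eta>. cnj (a \<alpha> \<eta>)"] ab_eq by simp
  then show ?thesis using assms
    by (cases "\<alpha> = \<beta>") (auto simp: Zbar_a Z_ab g_def cnj_h cnj_X cnj_W algebra_simps)
qed

lemma div_a: assumes "\<xi> \<in> S" shows "(\<Sum>\<alpha>\<in>UNIV. Zbar \<alpha> (a \<alpha>) \<xi>) = - n * g \<xi>"
  using equation[OF assms]
  by (simp add: a_def ab_def g_def X_def W_def h_def F_def[abs_def])

lemma trace_Em: assumes "\<xi> \<in> S" shows "(\<Sum>\<alpha>\<in>UNIV. Em \<alpha> \<alpha> \<xi>) = 0"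
  using div_a[OF assms] by (simp add: Em_def sum.distrib n_eq)

lemma Z_X: assumes "\<xi> \<in> S"
  shows "Z \<alpha> X \<xi> = D \<alpha> \<xi> + E \<alpha> \<xi> + (X \<xi> - W \<xi> - \<i> * h \<xi>) * a \<alpha> \<xi>"
proof -
  have "Z \<alpha> X \<xi> = (\<Sum>\<beta>\<in>UNIV. Z \<alpha> (a \<beta>) \<xi> * ab \<beta> \<xi> + a \<beta> \<xi> * Z \<alpha> (ab \<beta>) \<xi>)"
    unfolding X_def[abs_def] using assms by (simp add: Zr diff_all)
  also have "\<dots> = (\<Sum>\<beta>\<in>UNIV. (Dm \<alpha> \<beta> \<xi> * ab \<beta> \<xi> + 2 * a \<alpha> \<xi> * (a \<beta> \<xi> * ab \<beta> \<xi>))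
     + (Em \<alpha> \<beta> \<xi> * a \<beta> \<xi> - (if \<alpha> = \<beta> then 1 else 0) * (a \<beta> \<xi> * (g \<xi> + 2 * \<i> * h \<xi>))))"
    using assms by (intro sum.cong refl) (simp add: Z_a Z_ab Dm_sym[of \<xi> \<alpha>] algebra_simps)
  also have "\<dots> = D \<alpha> \<xi> + 2 * a \<alpha> \<xi> * X \<xi> + (E \<alpha> \<xi> - a \<alpha> \<xi> * (g \<xi> + 2 * \<i> * h \<xi>))"
    unfolding sum.distrib sum_subtractf sum_delta_mult D_def E_def X_def sum_distrib_left by simp
  finally show ?thesis by (simp add: g_def algebra_simps)
qed

lemma Z_h: "Z \<alpha> h \<xi> = - \<i> * G \<alpha> \<xi> + h \<xi> * a \<alpha> \<xi> + \<i> * (X \<xi> + W \<xi>) * a \<alpha> \<xi>"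
  by (simp add: G_def algebra_simps)

lemma Zbar_X: assumes "\<xi> \<in> S"
  shows "Zbar \<alpha> X \<xi> = cnj (D \<alpha> \<xi> + E \<alpha> \<xi>) + (X \<xi> - W \<xi> + \<i> * h \<xi>) * ab \<alpha> \<xi>"
  using assms Zbar_cnj_fun[OF assms, of X X \<alpha>]
  by (simp add: cnj_X cnj_W cnj_h diff_all Z_X ab_eq)

lemma Zbar_h: assumes "\<xi> \<in> S"
  shows "Zbar \<alpha> h \<xi> = \<i> * cnj (G \<alpha> \<xi>) + h \<xi> * ab \<alpha> \<xi> - \<i> * (X \<xi> + W \<xi>) * ab \<alpha> \<xi>"
  using assms Zbar_cnj_fun[OF assms, of h h \<alpha>]
  by (simp add: cnj_X cnj_W cnj_h diff_all Z_h ab_eq)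

text \<open>At the critical exponent p = 0 the last term disappears and the system closes in
  \<open>D\<close>, \<open>E\<close>, \<open>G\<close>. Since g is not real, the conjugate
  derivative in \<open>Zbar_g\<close> has the opposite sign at \<open>G\<close> and no term
  \<open>2 * g * ab \<alpha>\<close>.\<close>

lemma Z_g: assumes "\<xi> \<in> S"
  shows "Z \<alpha> g \<xi> = D \<alpha> \<xi> + E \<alpha> \<xi> - G \<alpha> \<xi> + 2 * g \<xi> * a \<alpha> \<xi> + p * W \<xi> * a \<alpha> \<xi>"
  unfolding g_def[abs_def] using assms
  by (simp add: Zr diff_all Z_X Z_W Z_h algebra_simps)

lemma Zbar_g: assumes "\<xi> \<in> S"
  shows "Zbar \<alpha> g \<xi> = cnj (D \<alpha> \<xi> + E \<alpha> \<xi> + G \<alpha> \<xi>) + p * W \<xi> * ab \<alpha> \<xi>"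
  unfolding g_def[abs_def] using assms
  by (simp add: Br diff_all Zbar_X Zbar_W Zbar_h algebra_simps)

section \<open>Divergences of the three vector fields \<open>D\<close>, \<open>E\<close> and
  \<open>G\<close>\<close>

definition pr :: "('n \<Rightarrow> 'n heis \<Rightarrow> complex) \<Rightarrow> 'n heis \<Rightarrow> complex" where
  "pr V \<xi> = (\<Sum>\<alpha>\<in>UNIV. V \<alpha> \<xi> * ab \<alpha> \<xi>)"

lemma cnj_pr: "\<xi> \<in> S \<Longrightarrow> cnj (pr V \<xi>) = (\<Sum>\<alpha>\<in>UNIV. cnj (V \<alpha> \<xi>) * a \<alpha> \<xi>)"
  by (simp add: pr_def ab_eq)

lemma pr_a: "pr a \<xi> = X \<xi>"
  by (simp add: pr_def X_def)

lemma pr_E_real: assumes "\<xi> \<in> S" shows "cnj (pr E \<xi>) = pr E \<xi>"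
proof -
  have "pr E \<xi> = (\<Sum>\<alpha>\<in>UNIV. \<Sum>\<beta>\<in>UNIV. Em \<alpha> \<beta> \<xi> * a \<beta> \<xi> * ab \<alpha> \<xi>)"
    by (simp add: pr_def E_def sum_distrib_right)
  moreover have "cnj (pr E \<xi>) = (\<Sum>\<alpha>\<in>UNIV. \<Sum>\<beta>\<in>UNIV. Em \<beta> \<alpha> \<xi> * ab \<beta> \<xi> * a \<alpha> \<xi>)"
    using assms by (simp add: pr_def E_def sum_distrib_right cnj_Em ab_eq)
  ultimately show ?thesis
    by (subst (asm) sum.swap) (simp add: mult_ac)
qed

lemma sum_Zbar_g: assumes "\<xi> \<in> S"
  shows "(\<Sum>\<alpha>\<in>UNIV. Zbar \<alpha> g \<xi> * a \<alpha> \<xi>) = cnj (pr D \<xi> + pr E \<xi> + pr G \<xi>) + p * W \<xi> * X \<xi>"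
  using assms
  by (simp add: Zbar_g cnj_pr X_def algebra_simps sum.distrib sum_distrib_left)

text \<open>A contracted Bianchi argument: the fields \<open>Zbar\<close> commute among themselves,
  so the divergence of the mixed second derivatives is \<open>Zbar\<close> of their trace -n g. The
  diagonal correction gives one g back, hence the factor n - 1. Hermitian symmetry turns the
  quadratic term into a sum of squares.\<close>

lemma div_bar_E: assumes "\<xi> \<in> S"
  shows "div_bar E \<xi> = of_real (\<Sum>\<alpha>\<in>UNIV. \<Sum>\<beta>\<in>UNIV. (cmod (Em \<alpha> \<beta> \<xi>))\<^sup>2)
     - (n - 1) * (cnj (pr D \<xi> + pr E \<xi> + pr G \<xi>) + p * W \<xi> * X \<xi>)"
proof -
  have g': "Zbar \<beta> (\<lambda>\<eta>. - n * g \<eta>) \<xi> = - n * Zbar \<beta> g \<xi>" for \<beta>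
    by (rule complex_field_cmult[OF complex_field_Zbar diff_all(7)[OF assms]])
  have tr: "(\<Sum>\<alpha>\<in>UNIV. Zbar \<alpha> (Zbar \<beta> (a \<alpha>)) \<xi>) = - n * Zbar \<beta> g \<xi>" for \<beta>
  proof -
    have "(\<Sum>\<alpha>\<in>UNIV. Zbar \<alpha> (Zbar \<beta> (a \<alpha>)) \<xi>) = (\<Sum>\<alpha>\<in>UNIV. Zbar \<beta> (Zbar \<alpha> (a \<alpha>)) \<xi>)"
      using commutators(2)[OF open_S assms smooth_a] by simp
    also have "\<dots> = Zbar \<beta> (\<lambda>\<eta>. \<Sum>\<alpha>\<in>UNIV. Zbar \<alpha> (a \<alpha>) \<eta>) \<xi>"
      using assms by (subst complex_field_sum[OF complex_field_Zbar]) (auto intro: diff_second)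
    also have "\<dots> = Zbar \<beta> (\<lambda>\<eta>. - n * g \<eta>) \<xi>"
      using div_a by (intro complex_field_cong[OF complex_field_Zbar open_S assms]) auto
    also note g'
    finally show ?thesis .
  qed
  have "div_bar E \<xi> = (\<Sum>\<alpha>\<in>UNIV. \<Sum>\<beta>\<in>UNIV. Zbar \<alpha> (Zbar \<beta> (a \<alpha>)) \<xi> * a \<beta> \<xi>
      + (if \<alpha> = \<beta> then 1 else 0) * (Zbar \<alpha> g \<xi> * a \<beta> \<xi>)
      + (Em \<alpha> \<beta> \<xi> * Em \<beta> \<alpha> \<xi> - Em \<alpha> \<beta> \<xi> * (if \<alpha> = \<beta> then 1 else 0) * g \<xi>))"
  proof -
    have 1: "Zbar \<alpha> (\<lambda>\<eta>. \<Sum>\<beta>\<in>UNIV. Em \<alpha> \<beta> \<eta> * a \<beta> \<eta>) \<xi>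
        = (\<Sum>\<beta>\<in>UNIV. Zbar \<alpha> (Em \<alpha> \<beta>) \<xi> * a \<beta> \<xi> + Em \<alpha> \<beta> \<xi> * Zbar \<alpha> (a \<beta>) \<xi>)" for \<alpha>
      using assms by (simp add: Br diff_all)
    have 2: "Zbar \<alpha> (Em \<alpha> \<beta>) \<xi> = Zbar \<alpha> (Zbar \<beta> (a \<alpha>)) \<xi> + (if \<alpha> = \<beta> then 1 else 0) * Zbar \<alpha> g \<xi>" for \<alpha> \<beta>
      unfolding Em_def[abs_def] using assms
      by (simp add: Br diff_all diff_second complex_field_cmult[OF complex_field_Zbar])
    show ?thesis unfolding div_bar_def E_def[abs_def] 1 2 Zbar_a
      by (intro sum.cong refl) (auto simp: algebra_simps)
  qed
  also have "\<dots> = (\<Sum>\<beta>\<in>UNIV. (\<Sum>\<alpha>\<in>UNIV. Zbar \<alpha> (Zbar \<beta> (a \<alpha>)) \<xi>) * a \<beta> \<xi>)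
     + (\<Sum>\<alpha>\<in>UNIV. Zbar \<alpha> g \<xi> * a \<alpha> \<xi>)
     + ((\<Sum>\<alpha>\<in>UNIV. \<Sum>\<beta>\<in>UNIV. Em \<alpha> \<beta> \<xi> * Em \<beta> \<alpha> \<xi>) - (\<Sum>\<alpha>\<in>UNIV. Em \<alpha> \<alpha> \<xi>) * g \<xi>)"
    unfolding sum.distrib sum_subtractf sum_distrib_right[symmetric] sum_delta_mult
    by (subst sum.swap) (simp add: sum_distrib_right)
  also have "(\<Sum>\<alpha>\<in>UNIV. \<Sum>\<beta>\<in>UNIV. Em \<alpha> \<beta> \<xi> * Em \<beta> \<alpha> \<xi>)
      = of_real (\<Sum>\<alpha>\<in>UNIV. \<Sum>\<beta>\<in>UNIV. (cmod (Em \<alpha> \<beta> \<xi>))\<^sup>2)"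
    unfolding of_real_sum
    by (intro sum.cong refl) (metis assms cnj_Em complex_norm_square)
  also have "(\<Sum>\<beta>\<in>UNIV. (\<Sum>\<alpha>\<in>UNIV. Zbar \<alpha> (Zbar \<beta> (a \<alpha>)) \<xi>) * a \<beta> \<xi>)
     = - n * (\<Sum>\<beta>\<in>UNIV. Zbar \<beta> g \<xi> * a \<beta> \<xi>)"
    unfolding tr by (simp add: sum_distrib_left mult_ac sum_negf)
  finally show ?thesis
    unfolding trace_Em[OF assms] sum_Zbar_g[OF assms] by (simp add: algebra_simps)
qed

text \<open>Here the divergence field and the second derivative do not commute; besides -n
  \<open>Z g\<close> the trace acquires \<open>2 * \<i> * Z h\<close>. Expressing both through
  \<open>D\<close>, \<open>E\<close>, \<open>G\<close> gives the coefficient n + 2 at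
  \<open>pr G\<close>, and the terms without a tensor cancel except the one with p.\<close>

lemma div_bar_D: assumes "\<xi> \<in> S"
  shows "div_bar D \<xi> = of_real (\<Sum>\<alpha>\<in>UNIV. \<Sum>\<beta>\<in>UNIV. (cmod (Dm \<alpha> \<beta> \<xi>))\<^sup>2)
     - (n - 2) * pr D \<xi> - (n + 2) * (pr E \<xi> - pr G \<xi>) - n * p * W \<xi> * X \<xi>"
proof -
  have tr: "(\<Sum>\<alpha>\<in>UNIV. Zbar \<alpha> (Z \<beta> (a \<alpha>)) \<xi>) = - n * Z \<beta> g \<xi> + 2 * \<i> * Z \<beta> h \<xi>" for \<beta>
  proof -
    have "(\<Sum>\<alpha>\<in>UNIV. Zbar \<alpha> (Z \<beta> (a \<alpha>)) \<xi>) =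
        (\<Sum>\<alpha>\<in>UNIV. Z \<beta> (Zbar \<alpha> (a \<alpha>)) \<xi> + (if \<alpha> = \<beta> then 2 * \<i> * d_t (a \<alpha>) \<xi> else 0))"
      using commutators(3)[OF open_S assms smooth_a] by simp
    also have "\<dots> = Z \<beta> (\<lambda>\<eta>. \<Sum>\<alpha>\<in>UNIV. Zbar \<alpha> (a \<alpha>) \<eta>) \<xi> + 2 * \<i> * d_t (a \<beta>) \<xi>"
      using assms by (subst complex_field_sum[OF complex_field_Z]) (auto intro: diff_second simp: sum.distrib)
    also have "Z \<beta> (\<lambda>\<eta>. \<Sum>\<alpha>\<in>UNIV. Zbar \<alpha> (a \<alpha>) \<eta>) \<xi> = Z \<beta> (\<lambda>\<eta>. - n * g \<eta>) \<xi>"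
      using div_a by (intro complex_field_cong[OF complex_field_Z open_S assms]) auto
    also have "\<dots> = - n * Z \<beta> g \<xi>"
      by (rule complex_field_cmult[OF complex_field_Z diff_all(7)[OF assms]])
    also have "d_t (a \<beta>) \<xi> = Z \<beta> h \<xi>"
      unfolding a_def h_def by (rule commutators(4)[OF open_S assms smooth_F])
    finally show ?thesis .
  qed
  have aZ: "(\<Sum>\<alpha>\<in>UNIV. a \<alpha> \<xi> * Zbar \<alpha> (a \<beta>) \<xi>) = E \<beta> \<xi> - g \<xi> * a \<beta> \<xi>" for \<beta>
  proof -
    have "(\<Sum>\<alpha>\<in>UNIV. a \<alpha> \<xi> * Zbar \<alpha> (a \<beta>) \<xi>)
      = (\<Sum>\<alpha>\<in>UNIV. Em \<beta> \<alpha> \<xi> * a \<alpha> \<xi> - (if \<beta> = \<alpha> then 1 else 0) * (g \<xi> * a \<alpha> \<xi>))"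
      by (intro sum.cong refl) (simp add: Zbar_a algebra_simps)
    then show ?thesis unfolding sum_subtractf sum_delta_mult by (simp add: E_def)
  qed
  have "div_bar D \<xi> = (\<Sum>\<alpha>\<in>UNIV. \<Sum>\<beta>\<in>UNIV.
      (Zbar \<alpha> (Z \<beta> (a \<alpha>)) \<xi> - 2 * (Zbar \<alpha> (a \<alpha>) \<xi> * a \<beta> \<xi>)
         - 2 * (a \<alpha> \<xi> * Zbar \<alpha> (a \<beta>) \<xi>)) * ab \<beta> \<xi>
      + (Dm \<alpha> \<beta> \<xi> * cnj (Dm \<alpha> \<beta> \<xi>) + 2 * (Dm \<alpha> \<beta> \<xi> * ab \<beta> \<xi>) * ab \<alpha> \<xi>))"
  proof -
    have 1: "Zbar \<alpha> (\<lambda>\<eta>. \<Sum>\<beta>\<in>UNIV. Dm \<alpha> \<beta> \<eta> * ab \<beta> \<eta>) \<xi>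
        = (\<Sum>\<beta>\<in>UNIV. Zbar \<alpha> (Dm \<alpha> \<beta>) \<xi> * ab \<beta> \<xi> + Dm \<alpha> \<beta> \<xi> * Zbar \<alpha> (ab \<beta>) \<xi>)" for \<alpha>
      using assms by (simp add: Br diff_all)
    have 2: "Zbar \<alpha> (Dm \<alpha> \<beta>) \<xi> = Zbar \<alpha> (Z \<beta> (a \<alpha>)) \<xi> - 2 * (Zbar \<alpha> (a \<alpha>) \<xi> * a \<beta> \<xi>)
         - 2 * (a \<alpha> \<xi> * Zbar \<alpha> (a \<beta>) \<xi>)" for \<alpha> \<beta>
      unfolding Dm_def[abs_def] using assms
      by (simp add: Br diff_all diff_second algebra_simps)
    have 3: "Zbar \<alpha> (ab \<beta>) \<xi> = cnj (Dm \<alpha> \<beta> \<xi>) + 2 * ab \<alpha> \<xi> * ab \<beta> \<xi>" for \<alpha> \<beta>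
      using Zbar_cnj_fun[OF assms diff_all(2)[OF assms], of "ab \<beta>" \<beta> \<alpha>] ab_eq assms
      by (simp add: Z_a Dm_sym[of \<xi> \<alpha>] mult_ac)
    show ?thesis unfolding div_bar_def D_def[abs_def] 1 2 3
      by (intro sum.cong refl) (auto simp: algebra_simps)
  qed
  also have "\<dots> = (\<Sum>\<beta>\<in>UNIV. ((\<Sum>\<alpha>\<in>UNIV. Zbar \<alpha> (Z \<beta> (a \<alpha>)) \<xi>) - 2 * ((\<Sum>\<alpha>\<in>UNIV. Zbar \<alpha> (a \<alpha>) \<xi>) * a \<beta> \<xi>)
         - 2 * (\<Sum>\<alpha>\<in>UNIV. a \<alpha> \<xi> * Zbar \<alpha> (a \<beta>) \<xi>)) * ab \<beta> \<xi>)
      + ((\<Sum>\<alpha>\<in>UNIV. \<Sum>\<beta>\<in>UNIV. Dm \<alpha> \<beta> \<xi> * cnj (Dm \<alpha> \<beta> \<xi>)) + 2 * pr D \<xi>)"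
  proof -
    have "(\<Sum>\<alpha>\<in>UNIV. \<Sum>\<beta>\<in>UNIV. 2 * (Dm \<alpha> \<beta> \<xi> * ab \<beta> \<xi>) * ab \<alpha> \<xi>) = 2 * pr D \<xi>"
      by (simp add: pr_def D_def sum_distrib_left sum_distrib_right mult_ac)
    then show ?thesis unfolding sum.distrib
      by (subst sum.swap)
        (simp flip: sum_distrib_left sum_distrib_right add: sum_subtractf)
  qed
  also have "(\<Sum>\<alpha>\<in>UNIV. \<Sum>\<beta>\<in>UNIV. Dm \<alpha> \<beta> \<xi> * cnj (Dm \<alpha> \<beta> \<xi>))
      = of_real (\<Sum>\<alpha>\<in>UNIV. \<Sum>\<beta>\<in>UNIV. (cmod (Dm \<alpha> \<beta> \<xi>))\<^sup>2)"
    by (simp only: of_real_sum complex_norm_square)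
  also have "(\<Sum>\<beta>\<in>UNIV. ((\<Sum>\<alpha>\<in>UNIV. Zbar \<alpha> (Z \<beta> (a \<alpha>)) \<xi>) - 2 * ((\<Sum>\<alpha>\<in>UNIV. Zbar \<alpha> (a \<alpha>) \<xi>) * a \<beta> \<xi>)
         - 2 * (\<Sum>\<alpha>\<in>UNIV. a \<alpha> \<xi> * Zbar \<alpha> (a \<beta>) \<xi>)) * ab \<beta> \<xi>)
      = (\<Sum>\<beta>\<in>UNIV. (- n) * (D \<beta> \<xi> * ab \<beta> \<xi>) + (- n - 2) * (E \<beta> \<xi> * ab \<beta> \<xi>) + (n + 2) * (G \<beta> \<xi> * ab \<beta> \<xi>)
          + (- n * p * W \<xi>) * (a \<beta> \<xi> * ab \<beta> \<xi>))"
    unfolding tr aZ div_a[OF assms] Z_g[OF assms] Z_h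
    by (intro sum.cong refl) (simp add: g_def algebra_simps)
  also have "\<dots> = - n * pr D \<xi> + (- n - 2) * pr E \<xi> + (n + 2) * pr G \<xi> - n * p * W \<xi> * X \<xi>"
    unfolding sum.distrib sum_distrib_left[symmetric] pr_def X_def by simp
  finally show ?thesis by (simp add: algebra_simps)
qed

text \<open>Commuting \<open>d_t\<close> past the frame turns the trace of the second derivatives of
  h into -n \<open>d_t g\<close>. The unwanted \<open>d_t h\<close> therefore enters with the real
  coefficient -n, and the purely imaginary factor \<open>- \<i> * h\<close> later removes it from
  the real part.\<close>

lemma div_bar_G: assumes "\<xi> \<in> S"
  shows "div_bar G \<xi> = - \<i> * n * (2 * of_real (Im (pr G \<xi>)) + 2 * h \<xi> * X \<xi> + (2 + p) * W \<xi> * h \<xi> - \<i> * d_t h \<xi>)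
     + cnj (pr D \<xi> + pr E \<xi> + pr G \<xi>) + p * W \<xi> * X \<xi> - n * (g \<xi>)\<^sup>2"
proof -
  have dX: "d_t X \<xi> = 2 * of_real (Im (pr G \<xi>)) + 2 * h \<xi> * X \<xi>"
  proof -
    have "d_t X \<xi> = (\<Sum>\<alpha>\<in>UNIV. d_t (a \<alpha>) \<xi> * ab \<alpha> \<xi> + a \<alpha> \<xi> * d_t (ab \<alpha>) \<xi>)"
      unfolding X_def[abs_def] using assms by (simp add: Tr diff_all)
    also have "\<dots> = (\<Sum>\<alpha>\<in>UNIV. Z \<alpha> h \<xi> * ab \<alpha> \<xi> + a \<alpha> \<xi> * Zbar \<alpha> h \<xi>)"
      using commutators(4,5)[OF open_S assms smooth_F] by (simp add: a_def ab_def h_def)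
    also have "\<dots> = (\<Sum>\<alpha>\<in>UNIV. (- \<i>) * (G \<alpha> \<xi> * ab \<alpha> \<xi>) + \<i> * (cnj (G \<alpha> \<xi>) * a \<alpha> \<xi>)
        + 2 * h \<xi> * (a \<alpha> \<xi> * ab \<alpha> \<xi>))"
      unfolding Z_h Zbar_h[OF assms] by (intro sum.cong refl) (simp add: algebra_simps)
    also have "\<dots> = (- \<i>) * pr G \<xi> + \<i> * cnj (pr G \<xi>) + 2 * h \<xi> * X \<xi>"
      unfolding sum.distrib sum_distrib_left[symmetric] cnj_pr[OF assms] unfolding pr_def X_def ..
    also have "(- \<i>) * pr G \<xi> + \<i> * cnj (pr G \<xi>) = 2 * of_real (Im (pr G \<xi>))"
      by (simp add: complex_eq_iff)
    finally show ?thesis .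
  qed
  have dg: "d_t g \<xi> = 2 * of_real (Im (pr G \<xi>)) + 2 * h \<xi> * X \<xi> + (2 + p) * W \<xi> * h \<xi> - \<i> * d_t h \<xi>"
    unfolding g_def[abs_def] using assms by (simp add: Tr diff_all dX d_t_W)
  have tr: "(\<Sum>\<alpha>\<in>UNIV. Zbar \<alpha> (Z \<alpha> h) \<xi>) = - n * d_t g \<xi>"
  proof -
    have "Zbar \<alpha> (Z \<alpha> h) \<xi> = Zbar \<alpha> (d_t (a \<alpha>)) \<xi>" for \<alpha>
      unfolding a_def h_def
      using commutators(4)[OF open_S _ smooth_F]
      by (intro complex_field_cong[OF complex_field_Zbar open_S assms]) auto
    then have "(\<Sum>\<alpha>\<in>UNIV. Zbar \<alpha> (Z \<alpha> h) \<xi>) = (\<Sum>\<alpha>\<in>UNIV. d_t (Zbar \<alpha> (a \<alpha>)) \<xi>)"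
      using commutators(5)[OF open_S assms smooth_a] by simp
    also have "\<dots> = d_t (\<lambda>\<eta>. \<Sum>\<alpha>\<in>UNIV. Zbar \<alpha> (a \<alpha>) \<eta>) \<xi>"
      using assms by (subst complex_field_sum[OF complex_field_d_t]) (auto intro: diff_second)
    also have "\<dots> = d_t (\<lambda>\<eta>. - n * g \<eta>) \<xi>"
      using div_a by (intro complex_field_cong[OF complex_field_d_t open_S assms]) auto
    also have "\<dots> = - n * d_t g \<xi>"
      by (rule complex_field_cmult[OF complex_field_d_t diff_all(7)[OF assms]])
    finally show ?thesis .
  qed
  have "G \<alpha> = (\<lambda>\<eta>. \<i> * Z \<alpha> h \<eta> + g \<eta> * a \<alpha> \<eta>)" for \<alpha>
    by (rule ext) (simp add: G_def g_def algebra_simps)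
  then have "div_bar G \<xi> = (\<Sum>\<alpha>\<in>UNIV. \<i> * Zbar \<alpha> (Z \<alpha> h) \<xi> + (Zbar \<alpha> g \<xi> * a \<alpha> \<xi> + g \<xi> * Zbar \<alpha> (a \<alpha>) \<xi>))"
    unfolding div_bar_def using assms by (simp add: Br diff_all diff_second)
  also have "\<dots> = \<i> * (\<Sum>\<alpha>\<in>UNIV. Zbar \<alpha> (Z \<alpha> h) \<xi>) + ((\<Sum>\<alpha>\<in>UNIV. Zbar \<alpha> g \<xi> * a \<alpha> \<xi>)
      + g \<xi> * (\<Sum>\<alpha>\<in>UNIV. Zbar \<alpha> (a \<alpha>) \<xi>))"
    unfolding sum.distrib sum_distrib_left ..
  finally show ?thesis
    unfolding tr dg sum_Zbar_g[OF assms] div_a[OF assms] by (simp add: algebra_simps power2_eq_square)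
qed

end

section \<open>Real parts of the divergences of the weighted fields\<close>

lemma div_bar_add3:
  assumes "\<And>\<alpha>. A \<alpha> differentiable at \<xi>" "\<And>\<alpha>. B \<alpha> differentiable at \<xi>" "\<And>\<alpha>. C \<alpha> differentiable at \<xi>"
  shows "div_bar (\<lambda>\<alpha> \<eta>. A \<alpha> \<eta> + (B \<alpha> \<eta> + C \<alpha> \<eta>)) \<xi> = div_bar A \<xi> + (div_bar B \<xi> + div_bar C \<xi>)"
  using div_bar_add[of A \<xi> "\<lambda>\<alpha> \<eta>. B \<alpha> \<eta> + C \<alpha> \<eta>"] div_bar_add[of B \<xi> C] assms by simp

context heis_solution
begin

text \<open>In terms of u this is u^(2(n-1)/n). Its logarithmic derivative contributes 2(n-1), which
  cancels the dimension against -(n-2) - (n-1) at \<open>pr D\<close> and against -(n+2) - (n-1) at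
  \<open>pr E\<close> in the part with factor X + W.\<close>

definition weight :: "'n heis \<Rightarrow> complex" where
  "weight \<xi> = complex_of_real (exp (2 * (real CARD('n) - 1) * f \<xi>))"

text \<open>The coefficients 2, -2, 3 are those for which all terms linear in \<open>pr G\<close> cancel in the
  real part of the divergence.\<close>

definition V :: "real \<Rightarrow> real \<Rightarrow> 'n \<Rightarrow> 'n heis \<Rightarrow> complex" where
  "V dl l \<alpha> \<xi> = (X \<xi> + W \<xi>) * (D \<alpha> \<xi> + E \<alpha> \<xi>)
     + ((- \<i> * h \<xi>) * (2 * (D \<alpha> \<xi> - E \<alpha> \<xi>) + 3 * G \<alpha> \<xi>)
     + (dl * (X \<xi>)\<^sup>2 - l * (W \<xi>)\<^sup>2) * a \<alpha> \<xi>)"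

definition N :: "'n \<Rightarrow> 'n heis \<Rightarrow> complex" where
  "N \<alpha> \<xi> = (- \<i> * h \<xi>) * a \<alpha> \<xi>"

lemma smooth_weight: "smooth_on S weight"
  unfolding weight_def[abs_def] by (rule smooth_exp_f)

lemma smooth_V: "smooth_on S (V dl l \<alpha>)"
  unfolding V_def[abs_def]
  by (intro smooth_on_diff smooth_on_add smooth_on_mult smooth_on_const smooth_on_power open_S smooth_all)

lemma smooth_N: "smooth_on S (N \<alpha>)"
  unfolding N_def[abs_def]
  by (intro smooth_on_mult smooth_on_const open_S smooth_all)

lemma div_bar_a: "\<xi> \<in> S \<Longrightarrow> div_bar a \<xi> = - n * g \<xi>"
  using div_a by (simp add: div_bar_def)

lemma div_bar_weight:
  assumes "\<xi> \<in> S" "\<And>\<alpha>. U \<alpha> differentiable at \<xi>"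
  shows "div_bar (\<lambda>\<alpha> \<eta>. weight \<eta> * U \<alpha> \<eta>) \<xi> = weight \<xi> * (div_bar U \<xi> + 2 * (n - 1) * pr U \<xi>)"
proof -
  have "Zbar \<alpha> weight \<xi> = 2 * (n - 1) * weight \<xi> * ab \<alpha> \<xi>" for \<alpha>
    using field_exp_f[OF complex_field_Zbar assms(1)]
    by (simp add: weight_def[abs_def] ab_def n_eq)
  then have "(\<Sum>\<alpha>\<in>UNIV. Zbar \<alpha> weight \<xi> * U \<alpha> \<xi>) = weight \<xi> * (2 * (n - 1) * pr U \<xi>)"
    by (simp add: pr_def sum_distrib_left mult_ac)
  then show ?thesis
    using div_bar_scale[OF smooth_on_differentiable[OF smooth_weight assms(1)] assms(2)]
    by (simp add: distrib_left)
qed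

lemma Zbar_ih: assumes "\<xi> \<in> S"
  shows "Zbar \<alpha> (\<lambda>\<eta>. - \<i> * h \<eta>) \<xi> = cnj (G \<alpha> \<xi>) - (X \<xi> + W \<xi> + \<i> * h \<xi>) * ab \<alpha> \<xi>"
  using assms complex_field_cmult[OF complex_field_Zbar diff_all(4)[OF assms], of \<alpha> "- \<i>"]
  by (simp add: Zbar_h algebra_simps)

lemma div_bar_ih:
  assumes "\<xi> \<in> S" "\<And>\<alpha>. U \<alpha> differentiable at \<xi>"
  shows "div_bar (\<lambda>\<alpha> \<eta>. (- \<i> * h \<eta>) * U \<alpha> \<eta>) \<xi> = (- \<i> * h \<xi>) * div_bar U \<xi>
    + ((\<Sum>\<alpha>\<in>UNIV. cnj (G \<alpha> \<xi>) * U \<alpha> \<xi>) - (X \<xi> + W \<xi> + \<i> * h \<xi>) * pr U \<xi>)"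
proof -
  have d: "(\<lambda>\<eta>. - \<i> * h \<eta>) differentiable at \<xi>" using assms(1) by (simp add: diff_all)
  have "(\<Sum>\<alpha>\<in>UNIV. (cnj (G \<alpha> \<xi>) - c * ab \<alpha> \<xi>) * U \<alpha> \<xi>)
      = (\<Sum>\<alpha>\<in>UNIV. cnj (G \<alpha> \<xi>) * U \<alpha> \<xi>) - c * pr U \<xi>" for c
    unfolding pr_def sum_distrib_left sum_subtractf[symmetric]
    by (intro sum.cong refl) (simp add: algebra_simps)
  then show ?thesis
    unfolding div_bar_scale[OF d assms(2)] Zbar_ih[OF assms(1)] by simp
qed

lemma of_real_h: "\<xi> \<in> S \<Longrightarrow> h \<xi> = of_real (Re (h \<xi>))"
  using cnj_h[of \<xi>] by (simp add: complex_eq_iff)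

lemma of_real_X: "\<xi> \<in> S \<Longrightarrow> X \<xi> = of_real (\<Sum>\<alpha>\<in>UNIV. (cmod (a \<alpha> \<xi>))\<^sup>2)"
  unfolding X_def of_real_sum by (intro sum.cong refl) (simp only: ab_eq complex_norm_square)

text \<open>The square of h comes from \<open>- \<i> * h\<close> meeting the imaginary part of g in
  \<open>div_bar a = - n * g\<close>. Thus it appears without a factor W, at the price of lower
  order terms.\<close>

lemma Re_div_bar_N: assumes "\<xi> \<in> S"
  shows "Re (div_bar (\<lambda>\<alpha> \<eta>. weight \<eta> * N \<alpha> \<eta>) \<xi>) = Re (weight \<xi>) *
    (real CARD('n) * (Re (h \<xi>))\<^sup>2 + Re (pr G \<xi>) - (Re (X \<xi>) + Re (W \<xi>)) * Re (X \<xi>))"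
proof -
  obtain x where x: "X \<xi> = of_real x" using of_real_X[OF assms] by blast
  obtain t where t: "h \<xi> = of_real t" using of_real_h[OF assms] by blast
  obtain w where w: "W \<xi> = of_real w" by (simp add: W_def)
  obtain m where m: "weight \<xi> = of_real m" by (simp add: weight_def)
  have N: "N = (\<lambda>\<alpha> \<eta>. (- \<i> * h \<eta>) * a \<alpha> \<eta>)" by (intro ext) (simp add: N_def)
  have prN: "pr N \<xi> = - \<i> * h \<xi> * X \<xi>"
    by (simp add: pr_def N_def X_def sum_distrib_left mult_ac)
  have G: "(\<Sum>\<alpha>\<in>UNIV. cnj (G \<alpha> \<xi>) * a \<alpha> \<xi>) = cnj (pr G \<xi>)" using cnj_pr[OF assms] by simp
  have eq: "div_bar (\<lambda>\<alpha> \<eta>. weight \<eta> * N \<alpha> \<eta>) \<xi> = weight \<xi> * (((- \<i> * h \<xi>) * (- n * g \<xi>)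
    + (cnj (pr G \<xi>) - (X \<xi> + W \<xi> + \<i> * h \<xi>) * X \<xi>)) + 2 * (n - 1) * (- \<i> * h \<xi> * X \<xi>))"
    unfolding div_bar_weight[OF assms smooth_on_differentiable[OF smooth_N assms]] prN
    unfolding N div_bar_ih[OF assms diff_all(2)[OF assms]] div_bar_a[OF assms] G pr_a ..
  show ?thesis unfolding eq
    by (simp add: x t w m n_eq g_def algebra_simps power2_eq_square)
qed

text \<open>The Jerison-Lee type identity. The terms linear in \<open>pr D\<close>,
  \<open>pr E\<close> and \<open>pr G\<close> cancel between the product rule, the weight and the
  three divergences, except those multiplied by p or dl. What the first two fields of
  \<open>V\<close> produce at p = 0 is the first three lines of the bracket.\<close>

lemma Re_div_bar_V: assumes "\<xi> \<in> S"
  shows "Re (div_bar (\<lambda>\<alpha> \<eta>. weight \<eta> * V dl l \<alpha> \<eta>) \<xi>) = Re (weight \<xi>) *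
    ((Re (X \<xi>) + Re (W \<xi>)) * ((\<Sum>\<alpha>\<in>UNIV. \<Sum>\<beta>\<in>UNIV. (cmod (Dm \<alpha> \<beta> \<xi>))\<^sup>2)
        + (\<Sum>\<alpha>\<in>UNIV. \<Sum>\<beta>\<in>UNIV. (cmod (Em \<alpha> \<beta> \<xi>))\<^sup>2))
      + (\<Sum>\<alpha>\<in>UNIV. (cmod (D \<alpha> \<xi> + E \<alpha> \<xi>))\<^sup>2)
      + Re (\<Sum>\<alpha>\<in>UNIV. cnj (G \<alpha> \<xi>) * (2 * (D \<alpha> \<xi> - E \<alpha> \<xi>) + 3 * G \<alpha> \<xi>))
      + p * Re (W \<xi>) * Re (pr D \<xi> + pr E \<xi>) - 3 * real CARD('n) * p * Re (W \<xi>) * (Re (h \<xi>))\<^sup>2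
      - (2 * real CARD('n) - 1) * p * Re (W \<xi>) * Re (X \<xi>) * (Re (X \<xi>) + Re (W \<xi>))
      + dl * (real CARD('n) * Re (X \<xi>) ^ 3 - (real CARD('n) + 2) * (Re (X \<xi>))\<^sup>2 * Re (W \<xi>)
          + 2 * Re (X \<xi>) * Re (pr D \<xi> + pr E \<xi>))
      + l * (real CARD('n) * Re (W \<xi>) ^ 3
          - (real CARD('n) + 2 + 2 * p) * Re (X \<xi>) * (Re (W \<xi>))\<^sup>2))"
proof -
  obtain x where x: "X \<xi> = of_real x" using of_real_X[OF assms] by blast
  obtain t where t: "h \<xi> = of_real t" using of_real_h[OF assms] by blast
  obtain w where w: "W \<xi> = of_real w" by (simp add: W_def)
  obtain m where m: "weight \<xi> = of_real m" by (simp add: weight_def)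
  obtain e where e: "pr E \<xi> = of_real e"
    using pr_E_real[OF assms] by (metis Reals_cnj_iff Reals_cases)
  \<comment> \<open>Reality of \<open>d_t h\<close> is what makes the second t-derivative of f
    disappear: it occurs only multiplied by a purely imaginary factor.\<close>
  obtain t0 where t0: "d_t h \<xi> = of_real t0"
  proof -
    have "d_t (\<lambda>\<eta>. cnj (h \<eta>)) \<xi> = d_t h \<xi>"
      by (rule complex_field_cong[OF complex_field_d_t open_S assms]) (simp add: cnj_h)
    then have "cnj (d_t h \<xi>) = d_t h \<xi>" using d_t_cnj[OF diff_all(4)[OF assms]] by simp
    then show thesis using that by (metis Reals_cnj_iff Reals_cases)
  qed
  define Q where "Q = (\<Sum>\<alpha>\<in>UNIV. (cmod (D \<alpha> \<xi> + E \<alpha> \<xi>))\<^sup>2)"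
  define R where "R = (\<Sum>\<alpha>\<in>UNIV. cnj (G \<alpha> \<xi>) * (2 * (D \<alpha> \<xi> - E \<alpha> \<xi>) + 3 * G \<alpha> \<xi>))"
  define qD qE where "qD = (\<Sum>\<alpha>\<in>UNIV. \<Sum>\<beta>\<in>UNIV. (cmod (Dm \<alpha> \<beta> \<xi>))\<^sup>2)"
    and "qE = (\<Sum>\<alpha>\<in>UNIV. \<Sum>\<beta>\<in>UNIV. (cmod (Em \<alpha> \<beta> \<xi>))\<^sup>2)"
  note d = diff_all[OF assms]
  have Q': "(\<Sum>\<alpha>\<in>UNIV. cnj (D \<alpha> \<xi> + E \<alpha> \<xi>) * (D \<alpha> \<xi> + E \<alpha> \<xi>)) = of_real Q"
    unfolding Q_def of_real_sum complex_norm_square by (intro sum.cong refl) (simp add: mult.commute)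
  have prs: "(\<Sum>\<alpha>\<in>UNIV. ab \<alpha> \<xi> * U \<alpha> \<xi>) = pr U \<xi>" for U by (simp add: pr_def mult.commute)
  have V1: "div_bar (\<lambda>\<alpha> \<eta>. (X \<eta> + W \<eta>) * (D \<alpha> \<eta> + E \<alpha> \<eta>)) \<xi>
     = (X \<xi> + W \<xi>) * (div_bar D \<xi> + div_bar E \<xi>) + (of_real Q + (X \<xi> + (1 + p) * W \<xi> + \<i> * h \<xi>) * (pr D \<xi> + pr E \<xi>))"
  proof -
    have z: "Zbar \<alpha> (\<lambda>\<eta>. X \<eta> + W \<eta>) \<xi> = cnj (D \<alpha> \<xi> + E \<alpha> \<xi>) + (X \<xi> + (1 + p) * W \<xi> + \<i> * h \<xi>) * ab \<alpha> \<xi>" for \<alpha>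
      using assms by (simp add: Br d Zbar_X Zbar_W algebra_simps)
    have "(\<Sum>\<alpha>\<in>UNIV. (cnj (D \<alpha> \<xi> + E \<alpha> \<xi>) + (X \<xi> + (1 + p) * W \<xi> + \<i> * h \<xi>) * ab \<alpha> \<xi>) * (D \<alpha> \<xi> + E \<alpha> \<xi>))
      = of_real Q + (X \<xi> + (1 + p) * W \<xi> + \<i> * h \<xi>) * (pr D \<xi> + pr E \<xi>)"
      unfolding Q'[symmetric] prs[symmetric] sum.distrib[symmetric] sum_distrib_left
      by (intro sum.cong refl) (simp add: algebra_simps)
    then show ?thesis
      by (subst div_bar_scale) (simp_all add: d div_bar_add z)
  qed
  have dRfun: "(\<lambda>\<eta>. 2 * (D \<alpha> \<eta> - E \<alpha> \<eta>) + 3 * G \<alpha> \<eta>) differentiable at \<xi>" for \<alpha>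
    using d by simp
  have dR: "div_bar (\<lambda>\<alpha> \<eta>. 2 * (D \<alpha> \<eta> - E \<alpha> \<eta>) + 3 * G \<alpha> \<eta>) \<xi>
      = 2 * (div_bar D \<xi> - div_bar E \<xi>) + 3 * div_bar G \<xi>"
  proof -
    have "Zbar \<alpha> (\<lambda>\<eta>. 2 * (D \<alpha> \<eta> - E \<alpha> \<eta>) + 3 * G \<alpha> \<eta>) \<xi>
      = 2 * (Zbar \<alpha> (D \<alpha>) \<xi> - Zbar \<alpha> (E \<alpha>) \<xi>) + 3 * Zbar \<alpha> (G \<alpha>) \<xi>" for \<alpha>
      by (simp add: Br d)
    then show ?thesis by (simp add: div_bar_def sum.distrib sum_subtractf sum_distrib_left)
  qed
  have prR: "pr (\<lambda>\<alpha> \<eta>. 2 * (D \<alpha> \<eta> - E \<alpha> \<eta>) + 3 * G \<alpha> \<eta>) \<xi> = 2 * (pr D \<xi> - pr E \<xi>) + 3 * pr G \<xi>"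
    by (simp add: pr_def algebra_simps sum.distrib sum_subtractf sum_distrib_left)
  have V2: "div_bar (\<lambda>\<alpha> \<eta>. (- \<i> * h \<eta>) * (2 * (D \<alpha> \<eta> - E \<alpha> \<eta>) + 3 * G \<alpha> \<eta>)) \<xi>
     = (- \<i> * h \<xi>) * (2 * (div_bar D \<xi> - div_bar E \<xi>) + 3 * div_bar G \<xi>)
       + (R - (X \<xi> + W \<xi> + \<i> * h \<xi>) * (2 * (pr D \<xi> - pr E \<xi>) + 3 * pr G \<xi>))"
    unfolding div_bar_ih[OF assms dRfun] dR prR R_def ..
  have V3: "div_bar (\<lambda>\<alpha> \<eta>. (dl * (X \<eta>)\<^sup>2 - l * (W \<eta>)\<^sup>2) * a \<alpha> \<eta>) \<xi>
     = (dl * (X \<xi>)\<^sup>2 - l * (W \<xi>)\<^sup>2) * (- n * g \<xi>)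
       + (2 * dl * X \<xi> * (cnj (pr D \<xi> + pr E \<xi>) + (X \<xi> - W \<xi> + \<i> * h \<xi>) * X \<xi>)
          - 2 * l * (2 + p) * (W \<xi>)\<^sup>2 * X \<xi>)"
  proof -
    have z: "Zbar \<alpha> (\<lambda>\<eta>. dl * (X \<eta>)\<^sup>2 - l * (W \<eta>)\<^sup>2) \<xi>
      = 2 * dl * X \<xi> * (cnj (D \<alpha> \<xi> + E \<alpha> \<xi>) + (X \<xi> - W \<xi> + \<i> * h \<xi>) * ab \<alpha> \<xi>)
        - 2 * l * (2 + p) * (W \<xi>)\<^sup>2 * ab \<alpha> \<xi>" for \<alpha>
      unfolding power2_eq_square using assms by (simp add: Br d Zbar_X Zbar_W algebra_simps)
    have "(\<Sum>\<alpha>\<in>UNIV. (2 * dl * X \<xi> * (cnj (D \<alpha> \<xi> + E \<alpha> \<xi>) + (X \<xi> - W \<xi> + \<i> * h \<xi>) * ab \<alpha> \<xi>)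
        - 2 * l * (2 + p) * (W \<xi>)\<^sup>2 * ab \<alpha> \<xi>) * a \<alpha> \<xi>)
      = (2 * dl * X \<xi> * ((\<Sum>\<alpha>\<in>UNIV. cnj (D \<alpha> \<xi>) * a \<alpha> \<xi>) + (\<Sum>\<alpha>\<in>UNIV. cnj (E \<alpha> \<xi>) * a \<alpha> \<xi>)
           + (X \<xi> - W \<xi> + \<i> * h \<xi>) * (\<Sum>\<alpha>\<in>UNIV. ab \<alpha> \<xi> * a \<alpha> \<xi>))
          - 2 * l * (2 + p) * (W \<xi>)\<^sup>2 * (\<Sum>\<alpha>\<in>UNIV. ab \<alpha> \<xi> * a \<alpha> \<xi>))"
      unfolding sum_distrib_left sum.distrib[symmetric] sum_subtractf[symmetric]
      by (intro sum.cong refl) (simp add: algebra_simps)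
    also have "\<dots> = 2 * dl * X \<xi> * (cnj (pr D \<xi> + pr E \<xi>) + (X \<xi> - W \<xi> + \<i> * h \<xi>) * X \<xi>)
          - 2 * l * (2 + p) * (W \<xi>)\<^sup>2 * X \<xi>"
      unfolding prs pr_a cnj_pr[OF assms, symmetric] by simp
    finally show ?thesis
      using div_bar_scale[of "\<lambda>\<eta>. dl * (X \<eta>)\<^sup>2 - l * (W \<eta>)\<^sup>2" \<xi> a] div_bar_a[OF assms]
      by (simp add: d z)
  qed
  have Veq: "V dl l = (\<lambda>\<alpha> \<eta>. (X \<eta> + W \<eta>) * (D \<alpha> \<eta> + E \<alpha> \<eta>)
     + ((- \<i> * h \<eta>) * (2 * (D \<alpha> \<eta> - E \<alpha> \<eta>) + 3 * G \<alpha> \<eta>) + (dl * (X \<eta>)\<^sup>2 - l * (W \<eta>)\<^sup>2) * a \<alpha> \<eta>))"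
    by (intro ext) (simp add: V_def)
  have dV: "div_bar (V dl l) \<xi> = div_bar (\<lambda>\<alpha> \<eta>. (X \<eta> + W \<eta>) * (D \<alpha> \<eta> + E \<alpha> \<eta>)) \<xi>
    + (div_bar (\<lambda>\<alpha> \<eta>. (- \<i> * h \<eta>) * (2 * (D \<alpha> \<eta> - E \<alpha> \<eta>) + 3 * G \<alpha> \<eta>)) \<xi>
      + div_bar (\<lambda>\<alpha> \<eta>. (dl * (X \<eta>)\<^sup>2 - l * (W \<eta>)\<^sup>2) * a \<alpha> \<eta>) \<xi>)"
    unfolding Veq
    by (rule div_bar_add3) (simp_all add: d)
  have prV: "pr (V dl l) \<xi> = (X \<xi> + W \<xi>) * (pr D \<xi> + pr E \<xi>)
     + ((- \<i> * h \<xi>) * (2 * (pr D \<xi> - pr E \<xi>) + 3 * pr G \<xi>) + (dl * (X \<xi>)\<^sup>2 - l * (W \<xi>)\<^sup>2) * X \<xi>)"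
    unfolding pr_a[symmetric] Veq pr_def sum_distrib_left sum.distrib[symmetric] sum_subtractf[symmetric]
    by (intro sum.cong refl) (simp add: algebra_simps)
  \<comment> \<open>With every complex quantity split into real and imaginary parts, the claim
    becomes a polynomial identity over the reals.\<close>
  obtain dr di where dd: "pr D \<xi> = Complex dr di" by (cases "pr D \<xi>")
  obtain gr gi where gg: "pr G \<xi> = Complex gr gi" by (cases "pr G \<xi>")
  obtain Rr Ri where RR: "R = Complex Rr Ri" by (cases R)
  have eq: "div_bar (\<lambda>\<alpha> \<eta>. weight \<eta> * V dl l \<alpha> \<eta>) \<xi> = weight \<xi> * (div_bar (V dl l) \<xi> + 2 * (n - 1) * pr (V dl l) \<xi>)"
    by (rule div_bar_weight[OF assms smooth_on_differentiable[OF smooth_V assms]])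
  show ?thesis
    unfolding eq dV V1 V2 V3 prV div_bar_D[OF assms] div_bar_E[OF assms] div_bar_G[OF assms] n_eq
    unfolding qD_def[symmetric] qE_def[symmetric] Q_def[symmetric] R_def[symmetric]
    by (simp add: x t w m e t0 dd gg RR g_def power2_eq_square)
       (simp add: algebra_simps power2_eq_square power3_eq_cube)
qed

end

section \<open>The cutoff and the integral estimate\<close>

text \<open>For \<open>m >= 2\<close> the one-sided derivatives agree at 0, so powers of a positive
  part are differentiable cutoffs and no smooth bump function has to be built.\<close>

lemma max_power_has_derivative:
  fixes x :: real
  assumes "2 \<le> m"
  shows "((\<lambda>x. max 0 x ^ m) has_real_derivative real m * max 0 x ^ (m - 1)) (at x)"
proof -
  consider "x > 0" | "x < 0" | "x = 0" by linarith
  then show ?thesis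
  proof cases
    case 1
    have d: "((\<lambda>x. x ^ m) has_real_derivative real m * x ^ (m - 1)) (at x)"
      using DERIV_pow[of m x] by simp
    have ev: "\<forall>\<^sub>F y in nhds x. y ^ m = max 0 y ^ m"
      using 1 eventually_nhds_in_open[of "{0<..}" x] by (auto elim!: eventually_mono)
    have "((\<lambda>x. max 0 x ^ m) has_real_derivative real m * x ^ (m - 1)) (at x)"
      by (rule DERIV_cong_ev[THEN iffD1, OF refl ev refl d])
    then show ?thesis using 1 by simp
  next
    case 2
    have ev: "\<forall>\<^sub>F y in nhds x. 0 = max 0 y ^ m"
      using 2 assms eventually_nhds_in_open[of "{..<0}" x] by (auto elim!: eventually_mono)
    have "((\<lambda>x. max 0 x ^ m) has_real_derivative 0) (at x)"
      by (rule DERIV_cong_ev[THEN iffD1, OF refl ev refl DERIV_const])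
    then show ?thesis using 2 assms by (auto simp: power_0_left)
  next
    case 3
    have "((\<lambda>h. (max 0 (0 + h) ^ m - max 0 0 ^ m) / h) \<longlongrightarrow> 0) (at (0::real))"
    proof (rule tendsto_norm_zero_cancel, rule tendsto_sandwich[OF _ _ tendsto_const])
      show "\<forall>\<^sub>F h in at 0. norm ((max 0 (0 + h) ^ m - max 0 0 ^ m) / h) \<le> \<bar>h :: real\<bar> ^ (m - 1)"
      proof (rule always_eventually, rule allI)
        fix h :: real
        have "max 0 h ^ m \<le> \<bar>h\<bar> ^ m" by (intro power_mono) auto
        also have "\<dots> = \<bar>h\<bar> ^ (m - 1) * \<bar>h\<bar>" using assms by (simp flip: power_Suc2)
        finally show "norm ((max 0 (0 + h) ^ m - max 0 0 ^ m) / h) \<le> \<bar>h\<bar> ^ (m - 1)"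
          using assms by (cases "h = 0") (auto simp: abs_mult divide_le_eq power_0_left)
      qed
      have "((\<lambda>h::real. \<bar>h\<bar> ^ (m - 1)) \<longlongrightarrow> \<bar>0\<bar> ^ (m - 1)) (at 0)"
        by (intro tendsto_intros)
      then show "((\<lambda>h::real. \<bar>h\<bar> ^ (m - 1)) \<longlongrightarrow> 0) (at 0)"
        by (rule tendsto_eq_rhs) (use assms in \<open>auto simp: power_0_left\<close>)
    qed auto
    then show ?thesis using 3 assms by (auto simp: DERIV_def power_0_left)
  qed
qed

section \<open>Hermitian norms of frame vectors, and reduction of the divergence to scalars\<close>

definition vnorm :: "('n::finite \<Rightarrow> complex) \<Rightarrow> real" where
  "vnorm A = L2_set (\<lambda>\<alpha>. cmod (A \<alpha>)) UNIV"

lemma vnorm_nonneg [simp]: "0 \<le> vnorm A"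
  by (simp add: vnorm_def)

lemma vnorm_sq: "(vnorm A)\<^sup>2 = (\<Sum>\<alpha>\<in>UNIV. (cmod (A \<alpha>))\<^sup>2)"
  by (simp add: vnorm_def L2_set_def sum_nonneg)

lemma vnorm_cnj: "vnorm (\<lambda>\<alpha>. cnj (A \<alpha>)) = vnorm A"
  by (simp add: vnorm_def)

lemma vnorm_Cauchy_Schwarz: "cmod (\<Sum>\<alpha>\<in>UNIV. A \<alpha> * B \<alpha>) \<le> vnorm A * vnorm B"
proof -
  have "cmod (\<Sum>\<alpha>\<in>UNIV. A \<alpha> * B \<alpha>) \<le> (\<Sum>\<alpha>\<in>UNIV. \<bar>cmod (A \<alpha>)\<bar> * \<bar>cmod (B \<alpha>)\<bar>)"
    by (rule order_trans[OF norm_sum]) (simp add: norm_mult)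
  also have "\<dots> \<le> vnorm A * vnorm B" unfolding vnorm_def by (rule L2_set_mult_ineq)
  finally show ?thesis .
qed

text \<open>The operator norm is at most the Hilbert-Schmidt norm.\<close>

lemma vnorm_matrix_le:
  "(vnorm (\<lambda>\<alpha>. \<Sum>\<beta>\<in>UNIV. M \<alpha> \<beta> * B \<beta>))\<^sup>2 \<le> (vnorm B)\<^sup>2 * (\<Sum>\<alpha>\<in>UNIV. \<Sum>\<beta>\<in>UNIV. (cmod (M \<alpha> \<beta>))\<^sup>2)"
proof -
  have "(cmod (\<Sum>\<beta>\<in>UNIV. M \<alpha> \<beta> * B \<beta>))\<^sup>2 \<le> (vnorm B)\<^sup>2 * (\<Sum>\<beta>\<in>UNIV. (cmod (M \<alpha> \<beta>))\<^sup>2)" for \<alpha>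
    using power_mono[OF vnorm_Cauchy_Schwarz[of "M \<alpha>" B], of 2]
    by (simp add: power_mult_distrib vnorm_sq[of "M \<alpha>"] mult.commute)
  then show ?thesis by (simp add: vnorm_sq[of "\<lambda>\<alpha>. \<Sum>\<beta>\<in>UNIV. M \<alpha> \<beta> * B \<beta>"] sum_distrib_left sum_mono)
qed

lemma vnorm_parallelogram:
  "(vnorm (\<lambda>\<alpha>. A \<alpha> + B \<alpha>))\<^sup>2 + (vnorm (\<lambda>\<alpha>. A \<alpha> - B \<alpha>))\<^sup>2 = 2 * (vnorm A)\<^sup>2 + 2 * (vnorm B)\<^sup>2"
proof -
  have "(cmod (x + y))\<^sup>2 + (cmod (x - y))\<^sup>2 = 2 * (cmod x)\<^sup>2 + 2 * (cmod y)\<^sup>2" for x y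
    unfolding cmod_power2 by (simp add: power2_eq_square algebra_simps)
  then show ?thesis unfolding vnorm_sq sum_distrib_left sum.distrib[symmetric] by simp
qed

lemma Re_ge_neg: "cmod z \<le> c \<Longrightarrow> - c \<le> Re z"
  using abs_Re_le_cmod[of z] by linarith

context heis_solution
begin

text \<open>The factor X = \<open>y^2\<close> in front of the squared tensors controls the
  contracted vectors \<open>D\<close> and \<open>E\<close>, and the parallelogram law rewrites them
  through \<sigma> and \<rho>. This gives half of each square; the explicit square of
  \<open>D + E\<close> raises the first to 3/2.\<close>

lemma Re_div_bar_V_lower_bound:
  assumes "\<xi> \<in> S" "p \<le> 0" "0 \<le> dl"
  defines "y \<equiv> vnorm (\<lambda>\<alpha>. a \<alpha> \<xi>)" and "w \<equiv> Re (W \<xi>)"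
    and "\<sigma> \<equiv> vnorm (\<lambda>\<alpha>. D \<alpha> \<xi> + E \<alpha> \<xi>)" and "\<rho> \<equiv> vnorm (\<lambda>\<alpha>. D \<alpha> \<xi> - E \<alpha> \<xi>)"
    and "\<gamma> \<equiv> vnorm (\<lambda>\<alpha>. G \<alpha> \<xi>)" and "c \<equiv> real CARD('n)"
  shows "Re (weight \<xi>) * (3 / 2 * \<sigma>\<^sup>2 + \<rho>\<^sup>2 / 2 + 3 * \<gamma>\<^sup>2 - 2 * (\<rho> * \<gamma>) - (- p) * w * (\<sigma> * y)
        + (2 * c - 1) * (- p) * w * y\<^sup>2 * (y\<^sup>2 + w)
        + dl * (c * y ^ 6 - (c + 2) * y ^ 4 * w - 2 * y\<^sup>2 * (\<sigma> * y))
        + l * (c * w ^ 3 - (c + 2 - 2 * (- p)) * y\<^sup>2 * w\<^sup>2))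
     \<le> Re (div_bar (\<lambda>\<alpha> \<eta>. weight \<eta> * V dl l \<alpha> \<eta>) \<xi>)"
proof -
  have x: "Re (X \<xi>) = y\<^sup>2" using of_real_X[OF assms(1)] by (simp add: y_def vnorm_sq)
  have w0: "0 \<le> w" by (simp add: w_def W_def)
  have wt: "0 \<le> Re (weight \<xi>)" by (simp add: weight_def)
  define qD qE where "qD = (\<Sum>\<alpha>\<in>UNIV. \<Sum>\<beta>\<in>UNIV. (cmod (Dm \<alpha> \<beta> \<xi>))\<^sup>2)"
    and "qE = (\<Sum>\<alpha>\<in>UNIV. \<Sum>\<beta>\<in>UNIV. (cmod (Em \<alpha> \<beta> \<xi>))\<^sup>2)"
  have q0: "0 \<le> qD" "0 \<le> qE" by (auto simp: qD_def qE_def intro!: sum_nonneg)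
  have "(vnorm (\<lambda>\<alpha>. D \<alpha> \<xi>))\<^sup>2 \<le> y\<^sup>2 * qD"
    using vnorm_matrix_le[of "\<lambda>\<alpha> \<beta>. Dm \<alpha> \<beta> \<xi>" "\<lambda>\<beta>. ab \<beta> \<xi>"] vnorm_cnj[of "\<lambda>\<alpha>. a \<alpha> \<xi>"]
    by (simp add: D_def y_def qD_def ab_eq[OF assms(1)])
  moreover have "(vnorm (\<lambda>\<alpha>. E \<alpha> \<xi>))\<^sup>2 \<le> y\<^sup>2 * qE"
    using vnorm_matrix_le[of "\<lambda>\<alpha> \<beta>. Em \<alpha> \<beta> \<xi>" "\<lambda>\<beta>. a \<beta> \<xi>"]
    by (simp add: E_def y_def qE_def)
  moreover have "0 \<le> w * (qD + qE)" using w0 q0 by simp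
  ultimately have 1: "(\<sigma>\<^sup>2 + \<rho>\<^sup>2) / 2 \<le> (y\<^sup>2 + w) * (qD + qE)"
    using vnorm_parallelogram[of "\<lambda>\<alpha>. D \<alpha> \<xi>" "\<lambda>\<alpha>. E \<alpha> \<xi>"]
    by (simp add: \<sigma>_def \<rho>_def algebra_simps)
  have 2: "3 * \<gamma>\<^sup>2 - 2 * (\<rho> * \<gamma>) \<le> Re (\<Sum>\<alpha>\<in>UNIV. cnj (G \<alpha> \<xi>) * (2 * (D \<alpha> \<xi> - E \<alpha> \<xi>) + 3 * G \<alpha> \<xi>))"
  proof -
    have "(\<Sum>\<alpha>\<in>UNIV. cnj (G \<alpha> \<xi>) * (2 * (D \<alpha> \<xi> - E \<alpha> \<xi>) + 3 * G \<alpha> \<xi>))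
      = 2 * (\<Sum>\<alpha>\<in>UNIV. cnj (G \<alpha> \<xi>) * (D \<alpha> \<xi> - E \<alpha> \<xi>)) + 3 * of_real (\<gamma>\<^sup>2)"
      unfolding \<gamma>_def vnorm_sq of_real_sum sum_distrib_left sum.distrib[symmetric] complex_norm_square
      by (intro sum.cong refl) (simp add: algebra_simps)
    moreover have "- (\<gamma> * \<rho>) \<le> Re (\<Sum>\<alpha>\<in>UNIV. cnj (G \<alpha> \<xi>) * (D \<alpha> \<xi> - E \<alpha> \<xi>))"
      using vnorm_Cauchy_Schwarz[of "\<lambda>\<alpha>. cnj (G \<alpha> \<xi>)" "\<lambda>\<alpha>. D \<alpha> \<xi> - E \<alpha> \<xi>"]
      by (intro Re_ge_neg) (simp add: vnorm_cnj \<gamma>_def \<rho>_def)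
    ultimately show ?thesis by (simp add: mult.commute)
  qed
  define e where "e = Re (pr D \<xi> + pr E \<xi>)"
  have e: "\<bar>e\<bar> \<le> \<sigma> * y"
  proof -
    have "pr D \<xi> + pr E \<xi> = (\<Sum>\<alpha>\<in>UNIV. (D \<alpha> \<xi> + E \<alpha> \<xi>) * ab \<alpha> \<xi>)"
      by (simp add: pr_def sum.distrib distrib_right)
    then have "cmod (pr D \<xi> + pr E \<xi>) \<le> \<sigma> * y"
      using vnorm_Cauchy_Schwarz[of "\<lambda>\<alpha>. D \<alpha> \<xi> + E \<alpha> \<xi>" "\<lambda>\<alpha>. ab \<alpha> \<xi>"] vnorm_cnj[of "\<lambda>\<alpha>. a \<alpha> \<xi>"]
      by (simp add: \<sigma>_def y_def ab_eq[OF assms(1)])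
    then show ?thesis unfolding e_def using abs_Re_le_cmod order_trans by blast
  qed
  have 3: "- ((- p) * w * (\<sigma> * y)) \<le> p * w * e"
  proof -
    have "0 \<le> (- p) * w" using assms(2) w0 by (intro mult_nonneg_nonneg) auto
    moreover have "e \<le> \<sigma> * y" using e by linarith
    ultimately have "(- p) * w * e \<le> (- p) * w * (\<sigma> * y)" by (intro mult_left_mono)
    then show ?thesis by (simp only: mult_minus_left minus_le_iff neg_le_iff_le)
  qed
  have 4: "- (dl * (2 * y\<^sup>2 * (\<sigma> * y))) \<le> dl * (2 * y\<^sup>2 * e)"
  proof -
    have "- e \<le> \<sigma> * y" using e by linarith
    moreover have "0 \<le> dl * (2 * y\<^sup>2)" using assms(3) by simp
    ultimately have "dl * (2 * y\<^sup>2) * (- e) \<le> dl * (2 * y\<^sup>2) * (\<sigma> * y)" by (rule mult_left_mono)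
    then show ?thesis by (simp only: mult.assoc mult_minus_right neg_le_iff_le minus_le_iff)
  qed
  \<comment> \<open>The only term in h is discarded: its sign is good, but its factor w has no lower
    bound, so it cannot absorb cutoff errors.\<close>
  have 5: "0 \<le> - 3 * c * p * w * (Re (h \<xi>))\<^sup>2"
  proof -
    have "p * w \<le> 0" using assms(2) w0 by (rule mult_nonpos_nonneg)
    then have "0 \<le> 3 * c * (- (p * w)) * (Re (h \<xi>))\<^sup>2"
      by (intro mult_nonneg_nonneg) (auto simp: c_def)
    then show ?thesis by (simp add: mult_ac)
  qed
  have y: "(y\<^sup>2) ^ 3 = y ^ 6" "(y\<^sup>2)\<^sup>2 = y ^ 4" by (simp_all flip: power_mult)
  have s2: "(\<Sum>\<alpha>\<in>UNIV. (cmod (D \<alpha> \<xi> + E \<alpha> \<xi>))\<^sup>2) = \<sigma>\<^sup>2" by (simp add: \<sigma>_def vnorm_sq)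
  show ?thesis
    unfolding Re_div_bar_V[OF assms(1)] x qD_def[symmetric] qE_def[symmetric] w_def[symmetric] e_def[symmetric]
      c_def[symmetric] y s2
  proof (rule mult_left_mono[OF _ wt], goal_cases)
    case 1
    have "dl * (c * y ^ 6 - (c + 2) * y ^ 4 * w - 2 * y\<^sup>2 * (\<sigma> * y))
        = dl * (c * y ^ 6 - (c + 2) * y ^ 4 * w) - dl * (2 * y\<^sup>2 * (\<sigma> * y))"
      "dl * (c * y ^ 6 - (c + 2) * y ^ 4 * w + 2 * y\<^sup>2 * e)
        = dl * (c * y ^ 6 - (c + 2) * y ^ 4 * w) + dl * (2 * y\<^sup>2 * e)"
      "(2 * c - 1) * (- p) * w * y\<^sup>2 * (y\<^sup>2 + w) = - ((2 * c - 1) * p * w * y\<^sup>2 * (y\<^sup>2 + w))"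
      "c + 2 - 2 * (- p) = c + 2 + 2 * p"
      by (simp_all add: algebra_simps)
    then show ?case using \<open>(\<sigma>\<^sup>2 + \<rho>\<^sup>2) / 2 \<le> (y\<^sup>2 + w) * (qD + qE)\<close> 2 3 4 5 by argo
  qed
qed

lemma cutoff_product:
  fixes \<theta> :: "'n heis \<Rightarrow> real"
  assumes "\<xi> \<in> S" "\<theta> differentiable at \<xi>" "2 \<le> m" "\<And>\<alpha>. U \<alpha> differentiable at \<xi>"
  shows "div_bar (\<lambda>\<alpha> \<eta>. complex_of_real (max 0 (\<theta> \<eta>) ^ m) * (weight \<eta> * U \<alpha> \<eta>)) \<xi>
    = of_real (max 0 (\<theta> \<xi>) ^ m) * div_bar (\<lambda>\<alpha> \<eta>. weight \<eta> * U \<alpha> \<eta>) \<xi>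
      + of_real (real m * max 0 (\<theta> \<xi>) ^ (m - 1)) * weight \<xi>
        * (\<Sum>\<alpha>\<in>UNIV. Zbar \<alpha> (\<lambda>\<eta>. complex_of_real (\<theta> \<eta>)) \<xi> * U \<alpha> \<xi>)"
proof -
  note chain = complex_field_real_chain[OF complex_field_Zbar assms(2) max_power_has_derivative[OF assms(3)]]
  have d: "(\<lambda>\<eta>. complex_of_real (max 0 (\<theta> \<eta>) ^ m)) differentiable at \<xi>"
  proof -
    have "((\<lambda>\<eta>. max 0 (\<theta> \<eta>) ^ m) has_derivative
        (\<lambda>v. real m * max 0 (\<theta> \<xi>) ^ (m - 1) * dir_deriv v \<theta> \<xi>)) (at \<xi>)"
      using has_derivative_compose[OF has_derivative_dir_deriv[OF assms(2)]
          max_power_has_derivative[OF assms(3), of "\<theta> \<xi>", unfolded has_field_derivative_def]] by simp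
    from bounded_linear.has_derivative[OF bounded_linear_of_real this]
    show ?thesis by (rule differentiableI)
  qed
  have "(\<lambda>\<eta>. weight \<eta> * U \<alpha> \<eta>) differentiable at \<xi>" for \<alpha>
    using assms(4) smooth_on_differentiable[OF smooth_weight assms(1)] by simp
  then show ?thesis
    unfolding div_bar_scale[OF d \<open>\<And>\<alpha>. (\<lambda>\<eta>. weight \<eta> * U \<alpha> \<eta>) differentiable at \<xi>\<close>] chain sum_distrib_left
    by (simp add: mult_ac)
qed

text \<open>Each derivative of the cutoff costs one power of it and a factor 1/r, that is, a factor
  \<tau> = 1/(r \<theta>) relative to the common \<open>\<theta> ^ s\<close>. Giving
  \<open>N\<close> two powers less and the prefactor \<open>\<kappa> / r^2\<close> places it at
  order \<open>\<tau>^2\<close>, as required by the scalar inequality.\<close>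

lemma cutoff_div_lower_bound:
  fixes \<theta> :: "'n heis \<Rightarrow> real"
  assumes "\<xi> \<in> S" "\<theta> differentiable at \<xi>" "7 \<le> s" "p \<le> 0" "0 < dl" "0 < l" "0 < \<kappa>" "0 < r"
    and grad: "0 < \<theta> \<xi> \<Longrightarrow> vnorm (\<lambda>\<alpha>. Zbar \<alpha> (\<lambda>\<eta>. complex_of_real (\<theta> \<eta>)) \<xi>) \<le> 1 / r"
    and young: "\<And>y w \<sigma> \<rho> \<gamma> h \<tau> :: real. 0 \<le> y \<Longrightarrow> 0 \<le> w \<Longrightarrow> 0 \<le> \<tau> \<Longrightarrow>
      l / 2 * w ^ 3 - C * \<tau> ^ 6 \<le>
        3 / 2 * \<sigma>\<^sup>2 + \<rho>\<^sup>2 / 2 + 3 * \<gamma>\<^sup>2 - 2 * (\<rho> * \<gamma>) - (- p) * w * (\<sigma> * y)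
        + (2 * real CARD('n) - 1) * (- p) * w * y\<^sup>2 * (y\<^sup>2 + w)
        + dl * (real CARD('n) * y ^ 6 - (real CARD('n) + 2) * y ^ 4 * w - 2 * y\<^sup>2 * (\<sigma> * y))
        + l * (real CARD('n) * w ^ 3 - (real CARD('n) + 2 - 2 * (- p)) * y\<^sup>2 * w\<^sup>2)
        - real s * \<tau> * ((y\<^sup>2 + w) * \<sigma> + \<bar>h\<bar> * (2 * \<rho> + 3 * \<gamma>) + dl * y ^ 5 + l * y * w\<^sup>2)
        + \<kappa> * \<tau>\<^sup>2 * (real CARD('n) * h\<^sup>2 - \<gamma> * y - (y\<^sup>2 + w) * y\<^sup>2)
        - real s * \<kappa> * \<tau> ^ 3 * (\<bar>h\<bar> * y)"
  shows "exp (2 * (real CARD('n) - 1) * f \<xi>)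
      * (l / 2 * (max 0 (\<theta> \<xi>) ^ s * exp ((2 + p) * f \<xi>) ^ 3) - C / r ^ 6 * max 0 (\<theta> \<xi>) ^ (s - 6))
    \<le> Re (div_bar (\<lambda>\<alpha> \<eta>. complex_of_real (max 0 (\<theta> \<eta>) ^ s) * (weight \<eta> * V dl l \<alpha> \<eta>)) \<xi>)
      + \<kappa> / r\<^sup>2 * Re (div_bar (\<lambda>\<alpha> \<eta>. complex_of_real (max 0 (\<theta> \<eta>) ^ (s - 2)) * (weight \<eta> * N \<alpha> \<eta>)) \<xi>)"
proof -
  note dV = smooth_on_differentiable[OF smooth_V assms(1)]
  note dN = smooth_on_differentiable[OF smooth_N assms(1)]
  have s2: "2 \<le> s" "2 \<le> s - 2" using assms(3) by auto
  note TV = cutoff_product[OF assms(1,2) s2(1) dV] and TN = cutoff_product[OF assms(1,2) s2(2) dN]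
  show ?thesis
  proof (cases "\<theta> \<xi> > 0")
    \<comment> \<open>Since \<open>7 <= s\<close>, all the exponents, down to s - 6, are positive;
      both sides vanish where \<theta> is not positive.\<close>
    case False
    then have "max 0 (\<theta> \<xi>) = 0" by simp
    then show ?thesis unfolding TV TN using assms(3) by (auto simp: power_0_left)
  next
    case True
    define e where "e = \<theta> \<xi>"
    have e: "0 < e" "max 0 (\<theta> \<xi>) = e" using True by (auto simp: e_def)
    define \<tau> where "\<tau> = 1 / (r * e)"
    have \<tau>: "0 \<le> \<tau>" using e assms(8) by (simp add: \<tau>_def)
    define m where "m = exp (2 * (real CARD('n) - 1) * f \<xi>)"
    have m: "weight \<xi> = of_real m" "0 < m" by (auto simp: weight_def m_def)
    define y w \<sigma> \<rho> \<gamma> t where "y = vnorm (\<lambda>\<alpha>. a \<alpha> \<xi>)" and "w = exp ((2 + p) * f \<xi>)"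
      and "\<sigma> = vnorm (\<lambda>\<alpha>. D \<alpha> \<xi> + E \<alpha> \<xi>)" and "\<rho> = vnorm (\<lambda>\<alpha>. D \<alpha> \<xi> - E \<alpha> \<xi>)"
      and "\<gamma> = vnorm (\<lambda>\<alpha>. G \<alpha> \<xi>)" and "t = Re (h \<xi>)"
    have w: "W \<xi> = of_real w" by (simp add: W_def w_def)
    have x: "X \<xi> = of_real (y\<^sup>2)" using of_real_X[OF assms(1)] by (simp add: y_def vnorm_sq)
    have t: "h \<xi> = of_real t" using of_real_h[OF assms(1)] by (simp add: t_def)
    have nn: "0 \<le> y" "0 \<le> w" "0 \<le> \<sigma>" "0 \<le> \<rho>" "0 \<le> \<gamma>"
      by (auto simp: y_def w_def \<sigma>_def \<rho>_def \<gamma>_def)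
    define z where "z = (\<lambda>\<alpha>. Zbar \<alpha> (\<lambda>\<eta>. complex_of_real (\<theta> \<eta>)) \<xi>)"
    have z: "cmod (\<Sum>\<alpha>\<in>UNIV. z \<alpha> * A \<alpha>) \<le> vnorm A / r" for A
    proof -
      have "cmod (\<Sum>\<alpha>\<in>UNIV. z \<alpha> * A \<alpha>) \<le> vnorm z * vnorm A" by (rule vnorm_Cauchy_Schwarz)
      also have "\<dots> \<le> 1 / r * vnorm A" using grad[OF True] by (intro mult_right_mono) (auto simp: z_def)
      finally show ?thesis by simp
    qed
    define AV AN where "AV = Re (div_bar (\<lambda>\<alpha> \<eta>. weight \<eta> * V dl l \<alpha> \<eta>) \<xi>)"
      and "AN = Re (div_bar (\<lambda>\<alpha> \<eta>. weight \<eta> * N \<alpha> \<eta>) \<xi>)"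
    define BV where "BV = (y\<^sup>2 + w) * \<sigma> + \<bar>t\<bar> * (2 * \<rho> + 3 * \<gamma>) + dl * y ^ 5 + l * y * w\<^sup>2"
    have BV: "- (BV / r) \<le> Re (\<Sum>\<alpha>\<in>UNIV. z \<alpha> * V dl l \<alpha> \<xi>)"
    proof (rule Re_ge_neg)
      have eq: "(\<Sum>\<alpha>\<in>UNIV. z \<alpha> * V dl l \<alpha> \<xi>) = of_real (y\<^sup>2 + w) * (\<Sum>\<alpha>\<in>UNIV. z \<alpha> * (D \<alpha> \<xi> + E \<alpha> \<xi>))
        + (- \<i> * of_real t) * (2 * (\<Sum>\<alpha>\<in>UNIV. z \<alpha> * (D \<alpha> \<xi> - E \<alpha> \<xi>)) + 3 * (\<Sum>\<alpha>\<in>UNIV. z \<alpha> * G \<alpha> \<xi>))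
        + of_real (dl * y ^ 4 - l * w\<^sup>2) * (\<Sum>\<alpha>\<in>UNIV. z \<alpha> * a \<alpha> \<xi>)"
        unfolding sum_distrib_left sum.distrib[symmetric]
        by (intro sum.cong refl) (simp add: V_def x w t algebra_simps flip: power_mult)
      have "cmod (\<Sum>\<alpha>\<in>UNIV. z \<alpha> * V dl l \<alpha> \<xi>) \<le> cmod (of_real (y\<^sup>2 + w) * (\<Sum>\<alpha>\<in>UNIV. z \<alpha> * (D \<alpha> \<xi> + E \<alpha> \<xi>)))
        + cmod ((- \<i> * of_real t) * (2 * (\<Sum>\<alpha>\<in>UNIV. z \<alpha> * (D \<alpha> \<xi> - E \<alpha> \<xi>)) + 3 * (\<Sum>\<alpha>\<in>UNIV. z \<alpha> * G \<alpha> \<xi>)))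
        + cmod (of_real (dl * y ^ 4 - l * w\<^sup>2) * (\<Sum>\<alpha>\<in>UNIV. z \<alpha> * a \<alpha> \<xi>))"
        unfolding eq by (rule order_trans[OF norm_triangle_ineq add_right_mono[OF norm_triangle_ineq]])
      also have "\<dots> \<le> (y\<^sup>2 + w) * (\<sigma> / r) + \<bar>t\<bar> * (2 * (\<rho> / r) + 3 * (\<gamma> / r)) + (dl * y ^ 4 + l * w\<^sup>2) * (y / r)"
      proof (intro add_mono)
        show "cmod (of_real (y\<^sup>2 + w) * (\<Sum>\<alpha>\<in>UNIV. z \<alpha> * (D \<alpha> \<xi> + E \<alpha> \<xi>))) \<le> (y\<^sup>2 + w) * (\<sigma> / r)"
          unfolding norm_mult norm_of_real using z[of "\<lambda>\<alpha>. D \<alpha> \<xi> + E \<alpha> \<xi>"] nn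
          by (intro mult_mono) (auto simp: \<sigma>_def)
        have "cmod (2 * (\<Sum>\<alpha>\<in>UNIV. z \<alpha> * (D \<alpha> \<xi> - E \<alpha> \<xi>)) + 3 * (\<Sum>\<alpha>\<in>UNIV. z \<alpha> * G \<alpha> \<xi>))
          \<le> 2 * (\<rho> / r) + 3 * (\<gamma> / r)"
          using z[of "\<lambda>\<alpha>. D \<alpha> \<xi> - E \<alpha> \<xi>"] z[of "\<lambda>\<alpha>. G \<alpha> \<xi>"]
          by (intro order_trans[OF norm_triangle_ineq] add_mono) (auto simp: norm_mult \<rho>_def \<gamma>_def)
        then show "cmod ((- \<i> * of_real t) * (2 * (\<Sum>\<alpha>\<in>UNIV. z \<alpha> * (D \<alpha> \<xi> - E \<alpha> \<xi>)) + 3 * (\<Sum>\<alpha>\<in>UNIV. z \<alpha> * G \<alpha> \<xi>)))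
          \<le> \<bar>t\<bar> * (2 * (\<rho> / r) + 3 * (\<gamma> / r))"
          unfolding norm_mult by (intro mult_mono) auto
        have "\<bar>dl * y ^ 4 - l * w\<^sup>2\<bar> \<le> dl * y ^ 4 + l * w\<^sup>2"
          using assms(5,6) by (intro order_trans[OF abs_triangle_ineq4]) (auto simp: abs_mult)
        then show "cmod (of_real (dl * y ^ 4 - l * w\<^sup>2) * (\<Sum>\<alpha>\<in>UNIV. z \<alpha> * a \<alpha> \<xi>)) \<le> (dl * y ^ 4 + l * w\<^sup>2) * (y / r)"
          unfolding norm_mult norm_of_real using z[of "\<lambda>\<alpha>. a \<alpha> \<xi>"]
          by (intro mult_mono) (auto simp: y_def)
      qed
      also have "\<dots> = BV / r"
        using assms(8) by (simp add: BV_def field_simps eval_nat_numeral)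
      finally show "cmod (\<Sum>\<alpha>\<in>UNIV. z \<alpha> * V dl l \<alpha> \<xi>) \<le> BV / r" .
    qed
    have BN: "- (\<bar>t\<bar> * y / r) \<le> Re (\<Sum>\<alpha>\<in>UNIV. z \<alpha> * N \<alpha> \<xi>)"
    proof (rule Re_ge_neg)
      have eq: "(\<Sum>\<alpha>\<in>UNIV. z \<alpha> * N \<alpha> \<xi>) = (- \<i> * of_real t) * (\<Sum>\<alpha>\<in>UNIV. z \<alpha> * a \<alpha> \<xi>)"
        unfolding sum_distrib_left by (intro sum.cong refl) (simp add: N_def t)
      have "cmod (\<Sum>\<alpha>\<in>UNIV. z \<alpha> * N \<alpha> \<xi>) = \<bar>t\<bar> * cmod (\<Sum>\<alpha>\<in>UNIV. z \<alpha> * a \<alpha> \<xi>)"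
        unfolding eq by (simp add: norm_mult)
      also have "\<dots> \<le> \<bar>t\<bar> * (y / r)" using z[of "\<lambda>\<alpha>. a \<alpha> \<xi>"] by (intro mult_left_mono) (auto simp: y_def)
      finally show "cmod (\<Sum>\<alpha>\<in>UNIV. z \<alpha> * N \<alpha> \<xi>) \<le> \<bar>t\<bar> * y / r" by simp
    qed
    define c where "c = real CARD('n)"
    have AN: "m * (c * t\<^sup>2 - \<gamma> * y - (y\<^sup>2 + w) * y\<^sup>2) \<le> AN"
    proof -
      have "- (\<gamma> * y) \<le> Re (pr G \<xi>)"
        using vnorm_Cauchy_Schwarz[of "\<lambda>\<alpha>. G \<alpha> \<xi>" "\<lambda>\<alpha>. ab \<alpha> \<xi>"] vnorm_cnj[of "\<lambda>\<alpha>. a \<alpha> \<xi>"]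
        by (intro Re_ge_neg) (simp add: \<gamma>_def y_def pr_def ab_eq[OF assms(1)])
      then have "c * t\<^sup>2 - \<gamma> * y - (y\<^sup>2 + w) * y\<^sup>2 \<le> c * t\<^sup>2 + Re (pr G \<xi>) - (y\<^sup>2 + w) * y\<^sup>2" by simp
      from mult_left_mono[OF this less_imp_le[OF m(2)]] show ?thesis
        unfolding AN_def Re_div_bar_N[OF assms(1)] m x w t c_def Re_complex_of_real .
    qed
    define MV where "MV = 3 / 2 * \<sigma>\<^sup>2 + \<rho>\<^sup>2 / 2 + 3 * \<gamma>\<^sup>2 - 2 * (\<rho> * \<gamma>) - (- p) * w * (\<sigma> * y)
        + (2 * c - 1) * (- p) * w * y\<^sup>2 * (y\<^sup>2 + w)
        + dl * (c * y ^ 6 - (c + 2) * y ^ 4 * w - 2 * y\<^sup>2 * (\<sigma> * y))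
        + l * (c * w ^ 3 - (c + 2 - 2 * (- p)) * y\<^sup>2 * w\<^sup>2)"
    have AV: "m * MV \<le> AV"
      by (rule Re_div_bar_V_lower_bound[OF assms(1,4) less_imp_le[OF assms(5)], of l,
          folded y_def \<sigma>_def \<rho>_def \<gamma>_def c_def AV_def, unfolded m(1) w Re_complex_of_real, folded MV_def])
    have pk: "e ^ s = e ^ (s - k) * e ^ k" if "k \<le> s" for k
      using that by (simp flip: power_add)
    have kt: "e ^ (s - k) / r ^ k = e ^ s * \<tau> ^ k" if "k \<le> s" for k
      using e(1) assms(8) pk[OF that] by (simp add: \<tau>_def power_divide power_mult_distrib)
    have k1: "e ^ (s - 1) / r = e ^ s * \<tau>" "e ^ (s - 2) / r\<^sup>2 = e ^ s * \<tau>\<^sup>2"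
      "e ^ (s - 3) / r ^ 3 = e ^ s * \<tau> ^ 3" "e ^ (s - 6) / r ^ 6 = e ^ s * \<tau> ^ 6"
      using kt[of 1] kt[of 2] kt[of 3] kt[of 6] assms(3) by simp_all
    have "e ^ s * m * (l / 2 * w ^ 3 - C * \<tau> ^ 6)
      \<le> e ^ s * m * (MV - real s * \<tau> * BV + \<kappa> * \<tau>\<^sup>2 * (c * t\<^sup>2 - \<gamma> * y - (y\<^sup>2 + w) * y\<^sup>2)
          - real s * \<kappa> * \<tau> ^ 3 * (\<bar>t\<bar> * y))"
      using young[OF nn(1,2) \<tau>, of \<sigma> \<rho> \<gamma> t] e(1) m(2)
      by (intro mult_left_mono) (auto simp: MV_def BV_def c_def)
    also have "\<dots> = e ^ s * (m * MV) - real s * (e ^ s * \<tau>) * m * BV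
        + \<kappa> * (e ^ s * \<tau>\<^sup>2) * (m * (c * t\<^sup>2 - \<gamma> * y - (y\<^sup>2 + w) * y\<^sup>2))
        - real s * \<kappa> * (e ^ s * \<tau> ^ 3) * m * (\<bar>t\<bar> * y)"
      by (simp add: algebra_simps)
    also have "\<dots> \<le> e ^ s * AV + real s * e ^ (s - 1) * m * Re (\<Sum>\<alpha>\<in>UNIV. z \<alpha> * V dl l \<alpha> \<xi>)
        + \<kappa> * (e ^ s * \<tau>\<^sup>2) * AN
        + \<kappa> / r\<^sup>2 * (real (s - 2) * e ^ (s - 3) * m * Re (\<Sum>\<alpha>\<in>UNIV. z \<alpha> * N \<alpha> \<xi>))"
    proof -
      have "real s * e ^ (s - 1) * m * (- (BV / r)) \<le> real s * e ^ (s - 1) * m * Re (\<Sum>\<alpha>\<in>UNIV. z \<alpha> * V dl l \<alpha> \<xi>)"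
        using BV e m by (intro mult_left_mono) auto
      then have a1: "- (real s * (e ^ s * \<tau>) * m * BV) \<le> real s * e ^ (s - 1) * m * Re (\<Sum>\<alpha>\<in>UNIV. z \<alpha> * V dl l \<alpha> \<xi>)"
        unfolding k1(1)[symmetric] by (simp add: mult_ac)
      have "\<kappa> / r\<^sup>2 * (real (s - 2) * e ^ (s - 3) * m * (- (\<bar>t\<bar> * y / r)))
          \<le> \<kappa> / r\<^sup>2 * (real (s - 2) * e ^ (s - 3) * m * Re (\<Sum>\<alpha>\<in>UNIV. z \<alpha> * N \<alpha> \<xi>))"
        using BN e m assms(7,8) by (intro mult_left_mono) auto
      moreover have "\<kappa> / r\<^sup>2 * (real (s - 2) * e ^ (s - 3) * m * (- (\<bar>t\<bar> * y / r)))
          = - (real (s - 2) * (\<kappa> * (e ^ (s - 3) / r ^ 3) * m * (\<bar>t\<bar> * y)))"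
        by (simp add: power2_eq_square power3_eq_cube)
      \<comment> \<open>The differentiated power of the cutoff on \<open>N\<close> yields s - 2; it
        is enlarged to s so that a single constant occurs in the scalar inequality.\<close>
      moreover have "real (s - 2) * (\<kappa> * (e ^ (s - 3) / r ^ 3) * m * (\<bar>t\<bar> * y))
          \<le> real s * (\<kappa> * (e ^ (s - 3) / r ^ 3) * m * (\<bar>t\<bar> * y))"
        using e m assms(7,8) nn by (intro mult_right_mono) auto
      ultimately have a2: "- (real s * \<kappa> * (e ^ s * \<tau> ^ 3) * m * (\<bar>t\<bar> * y))
          \<le> \<kappa> / r\<^sup>2 * (real (s - 2) * e ^ (s - 3) * m * Re (\<Sum>\<alpha>\<in>UNIV. z \<alpha> * N \<alpha> \<xi>))"
        unfolding k1(3)[symmetric] mult.assoc by linarith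
      have a3: "e ^ s * (m * MV) \<le> e ^ s * AV" using AV e by (intro mult_left_mono) auto
      have a4: "\<kappa> * (e ^ s * \<tau>\<^sup>2) * (m * (c * t\<^sup>2 - \<gamma> * y - (y\<^sup>2 + w) * y\<^sup>2)) \<le> \<kappa> * (e ^ s * \<tau>\<^sup>2) * AN"
        using AN e assms(7) by (intro mult_left_mono) auto
      show ?thesis using a1 a2 a3 a4 by linarith
    qed
    also have "\<dots> = Re (div_bar (\<lambda>\<alpha> \<eta>. complex_of_real (max 0 (\<theta> \<eta>) ^ s) * (weight \<eta> * V dl l \<alpha> \<eta>)) \<xi>)
      + \<kappa> / r\<^sup>2 * Re (div_bar (\<lambda>\<alpha> \<eta>. complex_of_real (max 0 (\<theta> \<eta>) ^ (s - 2)) * (weight \<eta> * N \<alpha> \<eta>)) \<xi>)"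
    proof -
      have s3: "s - 2 - 1 = s - 3" using assms(3) by simp
      have Re3: "Re (of_real u * of_real v * q) = u * v * Re q" for u v q by simp
      have zz: "Zbar \<alpha> (\<lambda>\<eta>. complex_of_real (\<theta> \<eta>)) \<xi> = z \<alpha>" for \<alpha> by (simp add: z_def)
      show ?thesis
        unfolding TV TN e(2) m(1) s3 zz plus_complex.sel Re3 k1(2)[symmetric]
        by (simp add: AV_def AN_def distrib_left mult_ac)
    qed
    also have "e ^ s * m * (l / 2 * w ^ 3 - C * \<tau> ^ 6)
        = m * (l / 2 * (e ^ s * w ^ 3) - C * (e ^ s * \<tau> ^ 6))"
      by (simp add: algebra_simps)
    finally show ?thesis unfolding k1(4)[symmetric] e(2) by (simp add: m_def w_def)
  qed
qed

end

text \<open>\<open>A\<close> is smooth only on S, yet the product has a continuous derivative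
  everywhere: S and the complement of the support set form an open cover of the space, and the
  product vanishes on the latter. Integration by parts then applies globally.\<close>

lemma cutoff_integral:
  fixes \<theta> :: "'n::finite heis \<Rightarrow> real" and A :: "'n heis \<Rightarrow> complex"
  assumes "open S" "smooth_on UNIV \<theta>" "smooth_on S A" "2 \<le> m"
    and K: "compact {\<xi>. 0 \<le> \<theta> \<xi>}" "{\<xi>. 0 \<le> \<theta> \<xi>} \<subseteq> S"
  defines "\<Psi> \<equiv> \<lambda>\<eta>. complex_of_real (max 0 (\<theta> \<eta>) ^ m) * A \<eta>"
  shows "integrable lborel (Zbar \<alpha> \<Psi>)" "(\<integral>\<xi>. Zbar \<alpha> \<Psi> \<xi> \<partial>lborel) = 0"
    "\<And>\<xi>. \<theta> \<xi> < 0 \<Longrightarrow> Zbar \<alpha> \<Psi> \<xi> = 0"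
proof -
  let ?K = "{\<xi>. 0 \<le> \<theta> \<xi>}"
  define \<psi> where "\<psi> = (\<lambda>\<eta>. complex_of_real (max 0 (\<theta> \<eta>) ^ m))"
  have \<Psi>\<psi>: "\<Psi> = (\<lambda>\<eta>. \<psi> \<eta> * A \<eta>)" by (simp add: \<Psi>_def \<psi>_def)
  have \<theta>: "\<theta> differentiable at \<xi>" for \<xi>
    using smooth_on_differentiable[OF assms(2)] by simp
  have d\<psi>: "(\<psi> has_derivative (\<lambda>v. complex_of_real (real m * max 0 (\<theta> \<xi>) ^ (m - 1) * dir_deriv v \<theta> \<xi>))) (at \<xi>)" for \<xi>
  proof -
    have "((\<lambda>\<eta>. max 0 (\<theta> \<eta>) ^ m) has_derivative
        (\<lambda>v. real m * max 0 (\<theta> \<xi>) ^ (m - 1) * dir_deriv v \<theta> \<xi>)) (at \<xi>)"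
      using has_derivative_compose[OF has_derivative_dir_deriv[OF \<theta>[of \<xi>]]
          max_power_has_derivative[OF assms(4), of "\<theta> \<xi>", unfolded has_field_derivative_def]] by simp
    from bounded_linear.has_derivative[OF bounded_linear_of_real this]
    show ?thesis unfolding \<psi>_def .
  qed
  have \<psi>: "\<psi> differentiable at \<xi>" for \<xi> using d\<psi> by (rule differentiableI)
  have out: "\<Psi> \<xi> = 0" if "\<xi> \<notin> ?K" for \<xi>
    using that assms(4) by (simp add: \<Psi>_def max_def power_0_left)
  have Kc: "open (- ?K)" using K(1) by (simp add: compact_imp_closed open_Compl)
  have inS: "\<Psi> differentiable at \<xi>" "dir_deriv v \<Psi> \<xi> = \<psi> \<xi> * dir_deriv v A \<xi> +
      complex_of_real (real m * max 0 (\<theta> \<xi>) ^ (m - 1) * dir_deriv v \<theta> \<xi>) * A \<xi>" if "\<xi> \<in> S" for \<xi> v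
    unfolding \<Psi>\<psi> dir_deriv_eqI[OF d\<psi>, symmetric] using \<psi>[of \<xi>] smooth_on_differentiable[OF assms(3) that]
    by (auto simp: dir_deriv_mult)
  have cover: "\<xi> \<in> S \<or> \<xi> \<in> - ?K" for \<xi> using K(2) by auto
  have diff: "\<Psi> differentiable at \<xi>" for \<xi>
  proof (cases "\<xi> \<in> S")
    case False
    then have "\<xi> \<in> - ?K" using cover by blast
    then show ?thesis
      using differentiable_cong_open[OF Kc, of \<xi> \<Psi> "\<lambda>_. 0"] out by simp
  qed (rule inS)
  have cont: "continuous_on UNIV (dir_deriv v \<Psi>)" for v
  proof -
    have "continuous_on S (\<lambda>\<xi>. \<psi> \<xi> * dir_deriv v A \<xi> +
        complex_of_real (real m * max 0 (\<theta> \<xi>) ^ (m - 1) * dir_deriv v \<theta> \<xi>) * A \<xi>)"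
      unfolding \<psi>_def
      using smooth_on_continuous_on[OF smooth_on_subset[OF assms(2) subset_UNIV], of S]
        smooth_on_continuous_on[OF smooth_on_subset[OF smooth_on_dir_deriv[OF assms(2)] subset_UNIV], of S v]
        smooth_on_continuous_on[OF assms(3)] smooth_on_continuous_on[OF smooth_on_dir_deriv[OF assms(3)], of v]
      by (intro continuous_intros) auto
    then have "continuous_on S (dir_deriv v \<Psi>)"
      using inS(2) by (simp cong: continuous_on_cong)
    moreover have "continuous_on (- ?K) (dir_deriv v \<Psi>)"
    proof -
      have "dir_deriv v \<Psi> \<xi> = 0" if "\<xi> \<in> - ?K" for \<xi>
        using dir_deriv_zero_outside[OF compact_imp_closed[OF K(1)], of \<Psi> \<xi> v] out that by simp
      then show ?thesis by (subst continuous_on_cong[OF refl, of _ _ "\<lambda>_. 0"]) auto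
    qed
    ultimately have "continuous_on (S \<union> - ?K) (dir_deriv v \<Psi>)"
      by (intro continuous_on_open_Un assms(1) Kc)
    moreover have "S \<union> - ?K = UNIV" using cover by blast
    ultimately show ?thesis by simp
  qed
  show "integrable lborel (Zbar \<alpha> \<Psi>)" "(\<integral>\<xi>. Zbar \<alpha> \<Psi> \<xi> \<partial>lborel) = 0"
    using integral_Zbar_eq_0[OF diff cont K(1) out] by auto
  show "Zbar \<alpha> \<Psi> \<xi> = 0" if "\<theta> \<xi> < 0" for \<xi>
    using complex_field_cong[OF complex_field_Zbar Kc, of \<xi> \<Psi> "\<lambda>_. 0" \<alpha>] out that
    by (simp add: complex_field_const[OF complex_field_Zbar])
qed

lemma cutoff_div_integral:
  fixes \<theta> :: "'n::finite heis \<Rightarrow> real" and A :: "'n \<Rightarrow> 'n heis \<Rightarrow> complex"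
  assumes "open S" "smooth_on UNIV \<theta>" "\<And>\<alpha>. smooth_on S (A \<alpha>)" "2 \<le> m"
    "compact {\<xi>. 0 \<le> \<theta> \<xi>}" "{\<xi>. 0 \<le> \<theta> \<xi>} \<subseteq> S"
  shows "has_bochner_integral lborel
      (\<lambda>\<xi>. Re (div_bar (\<lambda>\<alpha> \<eta>. complex_of_real (max 0 (\<theta> \<eta>) ^ m) * A \<alpha> \<eta>) \<xi>)) 0"
    "\<And>\<xi>. \<theta> \<xi> < 0 \<Longrightarrow> div_bar (\<lambda>\<alpha> \<eta>. complex_of_real (max 0 (\<theta> \<eta>) ^ m) * A \<alpha> \<eta>) \<xi> = 0"
proof -
  note I = cutoff_integral[OF assms(1,2,3,4,5,6)]
  have "has_bochner_integral lborel
      (\<lambda>\<xi>. div_bar (\<lambda>\<alpha> \<eta>. complex_of_real (max 0 (\<theta> \<eta>) ^ m) * A \<alpha> \<eta>) \<xi>) (\<Sum>\<alpha>\<in>(UNIV :: 'n set). 0)"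
    unfolding div_bar_def using I(1,2) by (intro has_bochner_integral_sum) (simp add: has_bochner_integral_iff)
  from has_bochner_integral_bounded_linear[OF bounded_linear_Re this]
  show "has_bochner_integral lborel
      (\<lambda>\<xi>. Re (div_bar (\<lambda>\<alpha> \<eta>. complex_of_real (max 0 (\<theta> \<eta>) ^ m) * A \<alpha> \<eta>) \<xi>)) 0" by simp
  show "div_bar (\<lambda>\<alpha> \<eta>. complex_of_real (max 0 (\<theta> \<eta>) ^ m) * A \<alpha> \<eta>) \<xi> = 0" if "\<theta> \<xi> < 0" for \<xi>
    using I(3)[OF that] by (simp add: div_bar_def)
qed

text \<open>A polynomial in z, its conjugate and t, so that smoothness and \<open>Zbar\<close>
  follow from the rules on coordinates. The sum with factor \<i> is the group law term, since \<i>
  times (v minus its conjugate) is -2 Im v.\<close>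

lemma gauge4_complex:
  fixes \<xi>0 :: "'n::finite heis"
  shows "complex_of_real (gauge4 \<xi>0 \<xi>) =
    (\<Sum>\<beta>\<in>UNIV. (fst \<xi> $ \<beta> - fst \<xi>0 $ \<beta>) * (cnj (fst \<xi> $ \<beta>) - cnj (fst \<xi>0 $ \<beta>)))\<^sup>2
    + (complex_of_real (snd \<xi>) - complex_of_real (snd \<xi>0)
       + \<i> * (\<Sum>\<beta>\<in>UNIV. fst \<xi>0 $ \<beta> * cnj (fst \<xi> $ \<beta>) - cnj (fst \<xi>0 $ \<beta>) * fst \<xi> $ \<beta>))\<^sup>2"
proof -
  have "complex_of_real ((norm (fst \<xi> - fst \<xi>0))\<^sup>2)
      = (\<Sum>\<beta>\<in>UNIV. (fst \<xi> $ \<beta> - fst \<xi>0 $ \<beta>) * (cnj (fst \<xi> $ \<beta>) - cnj (fst \<xi>0 $ \<beta>)))"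
    by (simp add: norm_vec_def L2_set_def sum_nonneg complex_norm_square flip: of_real_power)
  then have 1: "complex_of_real (((norm (fst \<xi> - fst \<xi>0))\<^sup>2)\<^sup>2)
      = (\<Sum>\<beta>\<in>UNIV. (fst \<xi> $ \<beta> - fst \<xi>0 $ \<beta>) * (cnj (fst \<xi> $ \<beta>) - cnj (fst \<xi>0 $ \<beta>)))\<^sup>2"
    unfolding of_real_power by (simp only:)
  have 2: "complex_of_real (snd (heis_mult (heis_inv \<xi>0) \<xi>)) = complex_of_real (snd \<xi>) - complex_of_real (snd \<xi>0)
       + \<i> * (\<Sum>\<beta>\<in>UNIV. fst \<xi>0 $ \<beta> * cnj (fst \<xi> $ \<beta>) - cnj (fst \<xi>0 $ \<beta>) * fst \<xi> $ \<beta>)"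
    by (simp add: complex_eq_iff heis_mult_def heis_inv_def sum_distrib_left algebra_simps
        sum_subtractf sum.distrib sum_negf)
  have "norm (fst (heis_mult (heis_inv \<xi>0) \<xi>)) = norm (fst \<xi> - fst \<xi>0)"
    by (simp add: heis_mult_def heis_inv_def)
  then show ?thesis unfolding gauge4_def of_real_add of_real_power 2[symmetric]
    using 1 by (simp flip: power_mult)
qed

lemma smooth_gauge4_complex: "smooth_on UNIV (\<lambda>\<xi>. complex_of_real (gauge4 \<xi>0 \<xi>))"
  unfolding gauge4_complex
  by (intro smooth_on_add smooth_on_diff smooth_on_mult smooth_on_power smooth_on_sum smooth_on_const
      smooth_on_coords open_UNIV)

lemma smooth_gauge4: "smooth_on UNIV (gauge4 \<xi>0)"
  using smooth_on_bounded_linear[OF open_UNIV bounded_linear_Re smooth_gauge4_complex] by simp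

lemma Zbar_gauge4:
  fixes \<xi>0 :: "'n::finite heis"
  shows "Zbar \<alpha> (\<lambda>\<xi>. complex_of_real (gauge4 \<xi>0 \<xi>)) \<xi>
    = 2 * (fst \<xi> $ \<alpha> - fst \<xi>0 $ \<alpha>) * (of_real ((norm (fst \<xi> - fst \<xi>0))\<^sup>2)
       - \<i> * of_real (snd (heis_mult (heis_inv \<xi>0) \<xi>)))"
proof -
  let ?w = "\<lambda>\<beta> \<xi>::'n heis. fst \<xi> $ \<beta> - fst \<xi>0 $ \<beta>" and ?wb = "\<lambda>\<beta> \<xi>::'n heis. cnj (fst \<xi> $ \<beta>) - cnj (fst \<xi>0 $ \<beta>)"
  define A where "A = (\<lambda>\<xi>. \<Sum>\<beta>\<in>UNIV. ?w \<beta> \<xi> * ?wb \<beta> \<xi>)"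
  define s where "s = (\<lambda>\<xi>::'n heis. complex_of_real (snd \<xi>) - complex_of_real (snd \<xi>0)
       + \<i> * (\<Sum>\<beta>\<in>UNIV. fst \<xi>0 $ \<beta> * cnj (fst \<xi> $ \<beta>) - cnj (fst \<xi>0 $ \<beta>) * fst \<xi> $ \<beta>))"
  note B = complex_field_mult[OF complex_field_Zbar] complex_field_add[OF complex_field_Zbar]
    complex_field_diff[OF complex_field_Zbar] complex_field_const[OF complex_field_Zbar]
    complex_field_sum[OF complex_field_Zbar]
  have d: "(\<lambda>\<xi>::'n heis. fst \<xi> $ \<beta>) differentiable at \<xi>" "(\<lambda>\<xi>::'n heis. cnj (fst \<xi> $ \<beta>)) differentiable at \<xi>"
    "(\<lambda>\<xi>::'n heis. complex_of_real (snd \<xi>)) differentiable at \<xi>" for \<beta> \<xi>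
    by (rule smooth_on_coords[THEN smooth_on_differentiable, OF UNIV_I])+
  have dA: "A differentiable at \<xi>" and ds: "s differentiable at \<xi>" for \<xi>
    unfolding A_def s_def by (simp_all add: d differentiable_sum_fun)
  have zA: "Zbar \<alpha> A \<xi> = ?w \<alpha> \<xi>"
    unfolding A_def by (simp add: B d Zbar_coords sum_delta_mult)
  have zs: "Zbar \<alpha> s \<xi> = - \<i> * ?w \<alpha> \<xi>"
    unfolding s_def
    by (simp add: B d differentiable_sum_fun Zbar_coords sum_delta_mult algebra_simps)
  have "(\<lambda>\<xi>. complex_of_real (gauge4 \<xi>0 \<xi>)) = (\<lambda>\<xi>. A \<xi> * A \<xi> + s \<xi> * s \<xi>)"
    unfolding gauge4_complex A_def s_def power2_eq_square ..
  moreover have "A \<xi> = of_real ((norm (fst \<xi> - fst \<xi>0))\<^sup>2)"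
    unfolding A_def
    by (simp add: norm_vec_def L2_set_def sum_nonneg complex_norm_square flip: of_real_power)
  moreover have "s \<xi> = of_real (snd (heis_mult (heis_inv \<xi>0) \<xi>))"
    unfolding s_def
    by (simp add: complex_eq_iff heis_mult_def heis_inv_def sum_distrib_left algebra_simps
        sum_subtractf sum.distrib sum_negf)
  ultimately show ?thesis
    by (simp add: B dA ds zA zs algebra_simps)
qed

text \<open>In \<open>Zbar_gauge4\<close> the second factor has the squared horizontal norm as real
  part and minus the translated vertical coordinate as imaginary part. Its squared modulus is
  therefore the gauge polynomial itself.\<close>

lemma vnorm_Zbar_gauge4:
  "(vnorm (\<lambda>\<alpha>. Zbar \<alpha> (\<lambda>\<xi>. complex_of_real (gauge4 \<xi>0 \<xi>)) \<xi>))\<^sup>2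
    = 4 * (norm (fst \<xi> - fst \<xi>0))\<^sup>2 * gauge4 \<xi>0 \<xi>"
proof -
  define a where "a = of_real ((norm (fst \<xi> - fst \<xi>0))\<^sup>2) - \<i> * of_real (snd (heis_mult (heis_inv \<xi>0) \<xi>))"
  have f: "fst (heis_mult (heis_inv \<xi>0) \<xi>) = fst \<xi> - fst \<xi>0" by (simp add: heis_mult_def heis_inv_def)
  have a: "(cmod a)\<^sup>2 = gauge4 \<xi>0 \<xi>"
    unfolding a_def cmod_power2 gauge4_def f by (simp flip: power_mult)
  have "(\<Sum>\<alpha>\<in>UNIV. (cmod (fst \<xi> $ \<alpha> - fst \<xi>0 $ \<alpha>))\<^sup>2) = (norm (fst \<xi> - fst \<xi>0))\<^sup>2"
    by (simp add: norm_vec_def L2_set_def sum_nonneg)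
  then show ?thesis
    unfolding vnorm_sq Zbar_gauge4 a_def[symmetric] norm_mult power_mult_distrib a
    by (simp flip: sum_distrib_left sum_distrib_right)
qed

text \<open>A polynomial instead of a bump: it is positive exactly inside the gauge ball of radius
  2r and at least 15/16 on the one of radius r. Only powers of its positive part are used as
  multipliers.\<close>

definition cutoff :: "'n::finite heis \<Rightarrow> real \<Rightarrow> 'n heis \<Rightarrow> real" where
  "cutoff \<xi>0 r \<xi> = 1 - gauge4 \<xi>0 \<xi> / (2 * r) ^ 4"

lemma smooth_cutoff: "smooth_on UNIV (cutoff \<xi>0 r)"
proof -
  have eq: "cutoff \<xi>0 r = (\<lambda>\<xi>. 1 - gauge4 \<xi>0 \<xi> * inverse ((2 * r) ^ 4))"
    by (rule ext) (simp only: cutoff_def divide_inverse)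
  show ?thesis unfolding eq
    by (intro smooth_on_diff smooth_on_mult smooth_on_const smooth_gauge4 open_UNIV)
qed

lemma cutoff_nonneg_iff: "0 < r \<Longrightarrow> 0 \<le> cutoff \<xi>0 r \<xi> \<longleftrightarrow> gauge4 \<xi>0 \<xi> \<le> (2 * r) ^ 4"
  by (simp add: cutoff_def field_simps)

lemma cutoff_gradient:
  assumes "0 < r" "0 < cutoff \<xi>0 r \<xi>"
  shows "vnorm (\<lambda>\<alpha>. Zbar \<alpha> (\<lambda>\<xi>. complex_of_real (cutoff \<xi>0 r \<xi>)) \<xi>) \<le> 1 / r"
proof -
  define c where "c = (2 * r) ^ 4"
  have c: "0 < c" using assms by (simp add: c_def)
  have g: "gauge4 \<xi>0 \<xi> \<le> c" using cutoff_nonneg_iff[OF assms(1), of \<xi>0 \<xi>] assms(2) by (simp add: c_def)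
  have n: "norm (fst \<xi> - fst \<xi>0) \<le> 2 * r"
    using gauge4_le_imp(1)[of \<xi>0 \<xi> "2 * r"] g assms(1) by (simp add: c_def heis_mult_def heis_inv_def)
  have d: "(\<lambda>\<xi>. complex_of_real (gauge4 \<xi>0 \<xi>)) differentiable at \<xi>"
    using smooth_on_differentiable[OF smooth_gauge4_complex] by simp
  define k where "k = complex_of_real (- 1 / c)"
  have eq: "(\<lambda>\<xi>. complex_of_real (cutoff \<xi>0 r \<xi>)) = (\<lambda>\<xi>. 1 + k * complex_of_real (gauge4 \<xi>0 \<xi>))"
    by (rule ext) (simp add: cutoff_def c_def k_def)
  have z: "Zbar \<alpha> (\<lambda>\<xi>. complex_of_real (cutoff \<xi>0 r \<xi>)) \<xi>
      = of_real (- 1 / c) * Zbar \<alpha> (\<lambda>\<xi>. complex_of_real (gauge4 \<xi>0 \<xi>)) \<xi>" for \<alpha>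
    unfolding eq k_def[symmetric] using d
    by (simp add: complex_field_add[OF complex_field_Zbar] complex_field_cmult[OF complex_field_Zbar]
        complex_field_const[OF complex_field_Zbar])
  have "(vnorm (\<lambda>\<alpha>. Zbar \<alpha> (\<lambda>\<xi>. complex_of_real (cutoff \<xi>0 r \<xi>)) \<xi>))\<^sup>2
      = (1 / c)\<^sup>2 * (4 * (norm (fst \<xi> - fst \<xi>0))\<^sup>2 * gauge4 \<xi>0 \<xi>)"
    unfolding z vnorm_Zbar_gauge4[symmetric] unfolding vnorm_sq norm_mult power_mult_distrib norm_of_real
    using c by (simp flip: sum_distrib_left)
  \<comment> \<open>On the support the horizontal part is at most 2r and the gauge polynomial at
    most c = 16 r^4, so the bound is 16 r^2 / c, which is exactly 1 / r^2.\<close>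
  also have "\<dots> \<le> (1 / c)\<^sup>2 * (4 * (2 * r)\<^sup>2 * c)"
  proof (rule mult_left_mono[OF mult_mono[OF mult_left_mono g]])
    show "(norm (fst \<xi> - fst \<xi>0))\<^sup>2 \<le> (2 * r)\<^sup>2" by (rule power_mono[OF n]) simp
  qed (simp_all add: gauge4_nonneg)
  also have "\<dots> = (1 / r)\<^sup>2"
  proof -
    have "(1 / c)\<^sup>2 * (4 * (2 * r)\<^sup>2 * c) = 16 * r\<^sup>2 / c"
      using c by (simp add: power2_eq_square)
    also have "\<dots> = (1 / r)\<^sup>2"
    proof -
      define R where "R = r\<^sup>2"
      have "c = 16 * (R * R)" by (simp add: c_def R_def power_mult_distrib flip: power_add)
      moreover have "0 < R" using assms(1) by (simp add: R_def)
      ultimately show ?thesis by (simp add: power_divide flip: R_def)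
    qed
    finally show ?thesis .
  qed
  finally show ?thesis by (rule power2_le_imp_le) (use assms(1) in simp)
qed

text \<open>Either the error is already dominated, or \<open>exp (b * x)\<close> is at most \<open>k / (r * e)\<^sup>2\<close>, so that
  the weight itself is bounded, and s is large enough to absorb the negative powers of the cutoff value e.\<close>

lemma weight_absorption:
  fixes c l C r e x b k M :: real and s :: nat
  assumes "0 < l" "0 \<le> C" "0 < r" "0 \<le> e" "e \<le> 1" "0 < b" "0 \<le> c"
    and M: "M = c / b" "6 + 2 * M \<le> real s" "6 < s" and k: "k = (4 * C / l) powr (1 / 3)"
  shows "exp (c * x) * (C / r ^ 6 * e ^ (s - 6))
    \<le> exp (c * x) * (l / 4 * (e ^ s * exp (b * x) ^ 3)) + C * k powr M * r powr (- 6 - 2 * M)"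
proof (cases "e = 0")
  case True
  then show ?thesis using assms by (simp add: power_0_left)
next
  case False
  then have e: "0 < e" using assms(4) by simp
  define w where "w = exp (b * x)"
  have w: "0 < w" by (simp add: w_def)
  have M0: "0 \<le> M" using assms by simp
  have es: "e ^ s = e ^ (s - 6) * e ^ 6" using M(3) by (simp flip: power_add)
  have pos: "0 \<le> C * k powr M * r powr (- 6 - 2 * M)" using assms(2) by simp
  show ?thesis
  proof (cases "C / r ^ 6 \<le> l / 4 * (e ^ 6 * w ^ 3)")
    case True
    have "exp (c * x) * e ^ (s - 6) * (C / r ^ 6) \<le> exp (c * x) * e ^ (s - 6) * (l / 4 * (e ^ 6 * w ^ 3))"
      using e by (intro mult_left_mono[OF True]) simp
    moreover have "exp (c * x) * (C / r ^ 6 * e ^ (s - 6)) = exp (c * x) * e ^ (s - 6) * (C / r ^ 6)"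
      "exp (c * x) * (l / 4 * (e ^ (s - 6) * e ^ 6 * w ^ 3)) = exp (c * x) * e ^ (s - 6) * (l / 4 * (e ^ 6 * w ^ 3))"
      by simp_all
    ultimately show ?thesis using pos unfolding es w_def[symmetric] by linarith
  next
    case False
    have k3: "k ^ 3 = 4 * C / l"
      using assms(1,2) unfolding k by (cases "C = 0") (simp_all add: powr_powr flip: powr_numeral)
    have "w ^ 3 < (4 * C / l) / (r * e) ^ 6"
      using False e assms(1,3) by (simp add: field_simps)
    also have "\<dots> = (k / (r * e)\<^sup>2) ^ 3" by (simp add: power_divide k3 flip: power_mult)
    finally have "w ^ 3 < (k / (r * e)\<^sup>2) ^ 3" .
    moreover have k0: "0 \<le> k" unfolding k by simp
    ultimately have "w < k / (r * e)\<^sup>2" by (intro power_less_imp_less_base[of w 3]) auto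
    then have "w powr M \<le> (k / (r * e)\<^sup>2) powr M" using w M0 by (intro powr_mono2) auto
    also have "\<dots> = k powr M * ((r * e) powr (- 2 * M))"
    proof -
      have "(r * e)\<^sup>2 = (r * e) powr 2" using e assms(3) by simp
      then have "((r * e)\<^sup>2) powr M = (r * e) powr (2 * M)" by (simp only: powr_powr)
      moreover have "(k / (r * e)\<^sup>2) powr M = k powr M / ((r * e)\<^sup>2) powr M"
        by (simp add: powr_divide k0)
      ultimately show ?thesis by (simp add: powr_minus_divide)
    qed
    also have "\<dots> = k powr M * (r powr (- 2 * M) * e powr (- 2 * M))"
      using e assms(3) by (simp add: powr_mult)
    finally have wM: "w powr M \<le> k powr M * (r powr (- 2 * M) * e powr (- 2 * M))" .
    have "exp (c * x) = w powr M"
      using assms(6) M(1) by (simp add: w_def powr_def)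
    then have "exp (c * x) * (C / r ^ 6 * e ^ (s - 6))
        \<le> k powr M * (r powr (- 2 * M) * e powr (- 2 * M)) * (C / r ^ 6 * e ^ (s - 6))"
      using wM assms e by (simp only:) (intro mult_right_mono, auto)
    also have "\<dots> = C * k powr M * (r powr (- 2 * M) / r ^ 6) * (e powr (- 2 * M) * e ^ (s - 6))"
      by simp
    also have "e powr (- 2 * M) * e ^ (s - 6) = e powr (real s - 6 - 2 * M)"
    proof -
      have "e ^ (s - 6) = e powr (real s - 6)"
        using e M(3) by (simp add: powr_realpow[symmetric] of_nat_diff)
      then show ?thesis by (simp add: powr_add[symmetric])
    qed
    also have "r powr (- 2 * M) / r ^ 6 = r powr (- 6 - 2 * M)"
    proof -
      have "r powr (- 6 - 2 * M) = r powr (- 2 * M) * r powr (- 6)"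
        using powr_add[of r "- 2 * M" "- 6"] by (simp add: algebra_simps)
      moreover have "r powr (- 6) = 1 / r ^ 6"
        using assms(3) powr_minus_divide[of r 6] by simp
      ultimately show ?thesis by simp
    qed
    also have "C * k powr M * r powr (- 6 - 2 * M) * e powr (real s - 6 - 2 * M)
        \<le> C * k powr M * r powr (- 6 - 2 * M) * 1"
      using assms(2,4,5) M(2) by (intro mult_left_mono powr_le1) auto
    finally have "exp (c * x) * (C / r ^ 6 * e ^ (s - 6)) \<le> C * k powr M * r powr (- 6 - 2 * M)" by simp
    moreover have "0 \<le> exp (c * x) * (l / 4 * (e ^ s * exp (b * x) ^ 3))" using assms e by simp
    ultimately show ?thesis by linarith
  qed
qed

text \<open>Since 2 + p = n(q-1), the nonlinearity is u times e^((2+p)f). Writing u as an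
  exponential gives second derivatives of f plus products of first ones; exchanging \<open>Z\<close>
  and \<open>Zbar\<close> in one of the two traces produces the \<open>d_t\<close> term, and the
  nonzero factor 2nu is divided out.\<close>

lemma heis_solution_ln:
  fixes u :: "'n::finite heis \<Rightarrow> real" and q :: real
  assumes S: "open S" and u: "smooth_on S u" "\<And>\<xi>. \<xi> \<in> S \<Longrightarrow> u \<xi> > 0"
    and eq: "\<And>\<xi>. \<xi> \<in> S \<Longrightarrow> - heis_laplacian u \<xi> = complex_of_real (2 * (real CARD('n))\<^sup>2 * u \<xi> powr q)"
  shows "heis_solution S (\<lambda>\<xi>. ln (u \<xi>) / real CARD('n)) (real CARD('n) * (q - 1) - 2) (of_nat CARD('n))"
proof
  let ?c = "real CARD('n)"
  define f where "f = (\<lambda>\<xi>. ln (u \<xi>) / ?c)"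
  define F where "F = (\<lambda>\<xi>. complex_of_real (f \<xi>))"
  define U where "U = (\<lambda>\<xi>. complex_of_real (u \<xi>))"
  show "smooth_on S (\<lambda>\<xi>. ln (u \<xi>) / real CARD('n))"
    unfolding divide_inverse by (intro smooth_on_mult smooth_on_ln smooth_on_const S u)
  then have f: "smooth_on S f" by (simp add: f_def)
  have F: "smooth_on S F" unfolding F_def by (rule smooth_on_bounded_linear[OF S bounded_linear_of_real f])
  have U: "smooth_on S U" unfolding U_def by (rule smooth_on_bounded_linear[OF S bounded_linear_of_real u(1)])
  fix \<xi> assume \<xi>: "\<xi> \<in> S"
  have LU: "L U \<eta> = of_nat CARD('n) * (U \<eta> * L F \<eta>)" if L: "complex_field L" and \<eta>: "\<eta> \<in> S" for L \<eta>
  proof -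
    have "((\<lambda>x. exp (?c * x)) has_real_derivative ?c * exp (?c * f \<eta>)) (at (f \<eta>))"
      by (auto intro!: derivative_eq_intros)
    from complex_field_real_chain[OF L smooth_on_differentiable[OF f \<eta>] this]
    have "L (\<lambda>y. complex_of_real (exp (?c * f y))) \<eta> = ?c * exp (?c * f \<eta>) * L F \<eta>" by (simp add: F_def)
    moreover have "exp (?c * f y) = u y" if "y \<in> S" for y using u(2)[OF that] by (simp add: f_def)
    ultimately show ?thesis
      using complex_field_cong[OF L S \<eta>, of U "\<lambda>y. complex_of_real (exp (?c * f y))"] \<eta>
      by (simp add: U_def)
  qed
  have LLU: "L (L' U) \<xi> = of_nat CARD('n) * U \<xi> * (of_nat CARD('n) * (L F \<xi> * L' F \<xi>) + L (L' F) \<xi>)"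
    if L: "complex_field L" "complex_field L'" for L L'
  proof -
    have d: "U differentiable at \<xi>" "L' F differentiable at \<xi>"
      using smooth_on_differentiable[OF _ \<xi>] U complex_field_smooth[OF L(2) S F] by auto
    have "L (L' U) \<xi> = L (\<lambda>\<eta>. of_nat CARD('n) * (U \<eta> * L' F \<eta>)) \<xi>"
      using LU[OF L(2)] by (intro complex_field_cong[OF L(1) S \<xi>])
    also have "\<dots> = of_nat CARD('n) * (L U \<xi> * L' F \<xi> + U \<xi> * L (L' F) \<xi>)"
      using d by (simp add: complex_field_cmult[OF L(1)] complex_field_mult[OF L(1)])
    finally show ?thesis by (simp add: LU[OF L(1) \<xi>] algebra_simps)
  qed
  define X where "X = (\<Sum>\<alpha>\<in>UNIV. Z \<alpha> F \<xi> * Zbar \<alpha> F \<xi>)"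
  define A where "A = (\<Sum>\<alpha>\<in>UNIV. Zbar \<alpha> (Z \<alpha> F) \<xi>)"
  let ?n = "of_nat CARD('n) :: complex"
  have "heis_laplacian u \<xi> = (\<Sum>\<alpha>\<in>UNIV. ?n * U \<xi> * (2 * ?n * (Z \<alpha> F \<xi> * Zbar \<alpha> F \<xi>)
      + 2 * Zbar \<alpha> (Z \<alpha> F) \<xi> - 2 * \<i> * d_t F \<xi>))"
    unfolding heis_laplacian_def U_def[symmetric] LLU[OF complex_field_Zbar complex_field_Z]
      LLU[OF complex_field_Z complex_field_Zbar]
    using commutators(3)[OF S \<xi> F] by (intro sum.cong refl) (simp add: algebra_simps)
  also have "\<dots> = ?n * U \<xi> * (2 * ?n * X + 2 * A - ?n * (2 * \<i> * d_t F \<xi>))"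
    unfolding X_def A_def sum_distrib_left[symmetric] sum.distrib sum_subtractf by simp
  finally have "- (?n * U \<xi> * (2 * ?n * X + 2 * A - ?n * (2 * \<i> * d_t F \<xi>))) = 2 * ?n\<^sup>2 * of_real (u \<xi> powr q)"
    using eq[OF \<xi>] by simp
  moreover have "u \<xi> powr q = u \<xi> * exp ((2 + (?c * (q - 1) - 2)) * f \<xi>)"
  proof -
    have "u \<xi> powr q = u \<xi> * u \<xi> powr (q - 1)"
      using powr_add[of "u \<xi>" 1 "q - 1"] u(2)[OF \<xi>] by simp
    then show ?thesis using u(2)[OF \<xi>] by (simp add: powr_def f_def)
  qed
  ultimately have "(2 * ?n * U \<xi>) * A = (2 * ?n * U \<xi>) * (- ?n * (X + exp ((2 + (?c * (q - 1) - 2)) * f \<xi>) - \<i> * d_t F \<xi>))"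
    by (simp add: U_def power2_eq_square algebra_simps)
  moreover have "2 * ?n * U \<xi> \<noteq> 0" using u(2)[OF \<xi>] by (simp add: U_def)
  ultimately have "A = - ?n * (X + exp ((2 + (?c * (q - 1) - 2)) * f \<xi>) - \<i> * d_t F \<xi>)"
    using mult_left_cancel by blast
  then show "(\<Sum>\<alpha>\<in>UNIV. Zbar \<alpha> (Z \<alpha> (\<lambda>\<eta>. complex_of_real (ln (u \<eta>) / ?c))) \<xi>)
      = - ?n * ((\<Sum>\<alpha>\<in>UNIV. Z \<alpha> (\<lambda>\<eta>. complex_of_real (ln (u \<eta>) / ?c)) \<xi> * Zbar \<alpha> (\<lambda>\<eta>. complex_of_real (ln (u \<eta>) / ?c)) \<xi>)
         + exp ((2 + (?c * (q - 1) - 2)) * (ln (u \<xi>) / ?c)) - \<i> * d_t (\<lambda>\<eta>. complex_of_real (ln (u \<eta>) / ?c)) \<xi>)"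
    by (simp only: A_def X_def F_def f_def)
qed (use S in auto)

theorem theorem1p3:
  fixes Q qstar q :: real
  assumes "Q = 2 * real CARD('n::finite) + 2"
    and "qstar = (Q + 2) / (Q - 2)"
    and "1 < q" and "q < qstar"
  shows "\<exists>C>0. \<forall>(\<Omega> :: 'n heis set) \<xi>0 r (u :: 'n heis \<Rightarrow> real).
           open \<Omega> \<and> connected \<Omega> \<and> r > 0 \<and> heis_ball \<xi>0 (4 * r) \<subseteq> \<Omega>
           \<and> smooth_on \<Omega> u \<and> (\<forall>\<xi>\<in>\<Omega>. u \<xi> > 0)
           \<and> (\<forall>\<xi>\<in>\<Omega>. - heis_laplacian u \<xi> = complex_of_real (2 * (real CARD('n))\<^sup>2 * u \<xi> powr q))
           \<longrightarrow> (\<integral>\<^sup>+ \<xi>\<in>heis_ball \<xi>0 r. ennreal (u \<xi> powr (3 * q - qstar)) \<partial>lborel)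
                \<le> ennreal (C * r powr (Q - 2 * ((3 * q - qstar) / (q - 1))))"
proof -
  define c where "c = real CARD('n)"
  have c: "1 \<le> c"
  proof -
    have "0 < CARD('n)" by (simp add: zero_less_card_finite)
    then show ?thesis by (simp add: c_def)
  qed
  define p where "p = c * (q - 1) - 2"
  have qstar: "qstar = 1 + 2 / c" using assms(1,2) c by (simp add: c_def[symmetric] field_simps)
  have p: "- 2 < p" "p < 0"
    using assms(3,4) c by (auto simp: p_def qstar field_simps)
  \<comment> \<open>The weight is the M-th power of e^((2+p)f), so an upper bound for the latter
    bounds the weight.\<close>
  define M where "M = 2 * (c - 1) / (2 + p)"
  have M: "0 \<le> M" using c p by (simp add: M_def)
  \<comment> \<open>Absorbing the weight spends 2M powers of the cutoff beyond the six spent by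
    Young's inequality; the 7 also keeps s - 6 positive.\<close>
  define s where "s = nat \<lceil>2 * M\<rceil> + 7"
  have s: "7 \<le> s" "6 + 2 * M \<le> real s" using M by (auto simp: s_def) linarith
  have ps: "0 < - p" "- p < 2" "1 \<le> real s" using p s by auto
  obtain dl l \<kappa> C where K: "0 < dl" "0 < l" "0 < \<kappa>" "0 \<le> C" and young:
    "\<And>y w \<sigma> \<rho> \<gamma> h \<tau> :: real. 0 \<le> y \<Longrightarrow> 0 \<le> w \<Longrightarrow> 0 \<le> \<tau> \<Longrightarrow>
      l / 2 * w ^ 3 - C * \<tau> ^ 6 \<le>
        3 / 2 * \<sigma>\<^sup>2 + \<rho>\<^sup>2 / 2 + 3 * \<gamma>\<^sup>2 - 2 * (\<rho> * \<gamma>) - (- p) * w * (\<sigma> * y)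
        + (2 * c - 1) * (- p) * w * y\<^sup>2 * (y\<^sup>2 + w)
        + dl * (c * y ^ 6 - (c + 2) * y ^ 4 * w - 2 * y\<^sup>2 * (\<sigma> * y))
        + l * (c * w ^ 3 - (c + 2 - 2 * (- p)) * y\<^sup>2 * w\<^sup>2)
        - real s * \<tau> * ((y\<^sup>2 + w) * \<sigma> + \<bar>h\<bar> * (2 * \<rho> + 3 * \<gamma>) + dl * y ^ 5 + l * y * w\<^sup>2)
        + \<kappa> * \<tau>\<^sup>2 * (c * h\<^sup>2 - \<gamma> * y - (y\<^sup>2 + w) * y\<^sup>2)
        - real s * \<kappa> * \<tau> ^ 3 * (\<bar>h\<bar> * y)"
    using pointwise_young[OF c ps] by blast
  define k where "k = (4 * C / l) powr (1 / 3)"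
  define C1 where "C1 = C * k powr M"
  have C1: "0 \<le> C1" using K by (simp add: C1_def)
  define v where "v = 2 * unit_ball_vol (2 * c) * 2 ^ (2 * CARD('n) + 2)"
  have v: "0 \<le> v" by (simp add: v_def c_def)
  \<comment> \<open>The power of 16/15 compensates for the cutoff being only at least 15/16 on the
    inner ball, and 4/l removes the coefficient of the good term.\<close>
  define c2 where "c2 = (16 / 15) ^ s * (4 / l)"
  have c2: "0 < c2" using K by (simp add: c2_def)
  \<comment> \<open>The summand 1 makes the constant strictly positive even if \<open>C1\<close>
    vanishes.\<close>
  define Cf where "Cf = c2 * C1 * v + 1"
  have Cf: "0 < Cf" using c2 C1 v by (simp add: Cf_def add_nonneg_pos)
  \<comment> \<open>Hence the error r^(-6-2M), multiplied by the volume bound of order r^Q, has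
    exactly the power of r in the claim.\<close>
  have qe: "2 * ((3 * q - qstar) / (q - 1)) = 6 + 2 * M"
  proof -
    have "3 * q - qstar = (q - 1) * (3 + M)"
      using assms(3) c by (simp add: qstar M_def p_def field_simps)
    then show ?thesis using assms(3) by (simp add: field_simps)
  qed
  have main: "(\<integral>\<^sup>+ \<xi>\<in>heis_ball \<xi>0 r. ennreal (u \<xi> powr (3 * q - qstar)) \<partial>lborel)
      \<le> ennreal (Cf * r powr (Q - 2 * ((3 * q - qstar) / (q - 1))))"
    if S: "open \<Omega>" and r: "r > 0" and ball: "heis_ball \<xi>0 (4 * r) \<subseteq> \<Omega>" and u: "smooth_on \<Omega> u" "\<And>\<xi>. \<xi> \<in> \<Omega> \<Longrightarrow> u \<xi> > 0"
      and eq: "\<And>\<xi>. \<xi> \<in> \<Omega> \<Longrightarrow> - heis_laplacian u \<xi> = complex_of_real (2 * (real CARD('n))\<^sup>2 * u \<xi> powr q)"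
    for \<Omega> :: "'n heis set" and \<xi>0 r and u :: "'n heis \<Rightarrow> real"
  proof -
    define f where "f = (\<lambda>\<xi>. ln (u \<xi>) / c)"
    interpret heis_solution \<Omega> f p "of_nat CARD('n)"
      unfolding f_def p_def c_def by (rule heis_solution_ln[OF S u eq])
    define \<theta> where "\<theta> = cutoff \<xi>0 r"
    define T where "T = {\<xi>. 0 \<le> \<theta> \<xi>}"
    have T: "T = {\<xi>. gauge4 \<xi>0 \<xi> \<le> (2 * r) ^ 4}"
      unfolding T_def \<theta>_def cutoff_nonneg_iff[OF r] ..
    have Tc: "compact T" unfolding T using r by (intro compact_gauge4) simp
    have TS: "T \<subseteq> \<Omega>"
    proof -
      have "(2 * r) ^ 4 < (4 * r) ^ 4" using r by (intro power_strict_mono) auto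
      moreover have "heis_ball \<xi>0 (4 * r) = {\<xi>. gauge4 \<xi>0 \<xi> < (4 * r) ^ 4}"
        by (rule heis_ball_eq) (use r in simp)
      ultimately have "T \<subseteq> heis_ball \<xi>0 (4 * r)" unfolding T using le_less_trans by blast
      then show ?thesis using ball by blast
    qed
    have s\<theta>: "smooth_on UNIV \<theta>" unfolding \<theta>_def by (rule smooth_cutoff)
    define d1 where "d1 = (\<lambda>\<xi>. Re (div_bar (\<lambda>\<alpha> \<eta>. complex_of_real (max 0 (\<theta> \<eta>) ^ s) * (weight \<eta> * V dl l \<alpha> \<eta>)) \<xi>))"
    define d2 where "d2 = (\<lambda>\<xi>. Re (div_bar (\<lambda>\<alpha> \<eta>. complex_of_real (max 0 (\<theta> \<eta>) ^ (s - 2)) * (weight \<eta> * N \<alpha> \<eta>)) \<xi>))"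
    have s2: "2 \<le> s" "2 \<le> s - 2" using s by auto
    note I1 = cutoff_div_integral[OF S s\<theta> smooth_on_mult[OF S smooth_weight smooth_V[of dl l]] s2(1)
        Tc[unfolded T_def] TS[unfolded T_def]]
    note I2 = cutoff_div_integral[OF S s\<theta> smooth_on_mult[OF S smooth_weight smooth_N] s2(2)
        Tc[unfolded T_def] TS[unfolded T_def]]
    have h1: "has_bochner_integral lborel d1 0" unfolding d1_def by (rule I1(1))
    have h2: "has_bochner_integral lborel d2 0" unfolding d2_def by (rule I2(1))
    have z12: "d1 \<xi> = 0" "d2 \<xi> = 0" if "\<xi> \<notin> T" for \<xi>
      using I1(2)[of \<xi>] I2(2)[of \<xi>] that by (auto simp: d1_def d2_def T_def)
    define b where "b = C1 * r powr (- 6 - 2 * M)"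
    have b: "0 \<le> b" using C1 by (simp add: b_def)
    \<comment> \<open>The total divergence plus the constant error on the support. The divergence
      part integrates to 0 and vanishes off \<open>T\<close>, so H is nonnegative everywhere while
      its integral is only b times the measure of \<open>T\<close>.\<close>
    define H where "H = (\<lambda>\<xi>. d1 \<xi> + \<kappa> / r\<^sup>2 * d2 \<xi> + b * indicator T \<xi>)"
    have Tm: "emeasure lborel T \<le> ennreal (v * r ^ (2 * CARD('n) + 2))"
      using emeasure_gauge4_le[of "2 * r" \<xi>0] r
      by (simp add: T v_def c_def power_mult_distrib mult_ac)
    have Tb: "T \<in> sets lborel" using Tc by (simp add: borel_compact)
    have hT: "has_bochner_integral lborel (indicator T) (measure lborel T)"
      using Tm Tb by (intro has_bochner_integral_real_indicator) (auto simp: top_unique less_top[symmetric] neq_top_trans)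
    have mT: "measure lborel T \<le> v * r ^ (2 * CARD('n) + 2)"
      unfolding measure_def using Tm v r by (intro enn2real_leI) auto
    have hH: "has_bochner_integral lborel H (0 + \<kappa> / r\<^sup>2 * 0 + b * measure lborel T)"
      unfolding H_def by (intro has_bochner_integral_add has_bochner_integral_mult_right h1 h2 hT)
    \<comment> \<open>Half of the good coefficient l/2 is spent on absorbing the weighted error, up
      to the constant b.\<close>
    have lower: "l / 4 * (max 0 (\<theta> \<xi>) ^ s * (exp ((2 + p) * f \<xi>) ^ 3 * exp (2 * (c - 1) * f \<xi>))) \<le> H \<xi>" if \<xi>: "\<xi> \<in> T" for \<xi>
    proof -
      have in\<Omega>: "\<xi> \<in> \<Omega>" using \<xi> TS by blast
      have e: "0 \<le> max 0 (\<theta> \<xi>)" "max 0 (\<theta> \<xi>) \<le> 1"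
        using gauge4_nonneg[of \<xi>0 \<xi>] r by (auto simp: \<theta>_def cutoff_def)
      have "exp (2 * (c - 1) * f \<xi>)
          * (l / 2 * (max 0 (\<theta> \<xi>) ^ s * exp ((2 + p) * f \<xi>) ^ 3) - C / r ^ 6 * max 0 (\<theta> \<xi>) ^ (s - 6))
        \<le> d1 \<xi> + \<kappa> / r\<^sup>2 * d2 \<xi>"
        unfolding d1_def d2_def c_def
        using cutoff_div_lower_bound[OF in\<Omega> smooth_on_differentiable[OF s\<theta> UNIV_I] s(1) less_imp_le[OF p(2)] K(1-3) r
            cutoff_gradient[OF r, of \<xi>0 \<xi>, folded \<theta>_def] young[unfolded c_def]] .
      moreover have "exp (2 * (c - 1) * f \<xi>) * (C / r ^ 6 * max 0 (\<theta> \<xi>) ^ (s - 6))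
        \<le> exp (2 * (c - 1) * f \<xi>) * (l / 4 * (max 0 (\<theta> \<xi>) ^ s * exp ((2 + p) * f \<xi>) ^ 3)) + b"
        unfolding b_def C1_def
        using c p s by (intro weight_absorption K(2,4) r e k_def M_def) auto
      moreover have "l / 4 * (A * B) \<le> x + y" if "B * (l / 2 * A - D) \<le> x" "B * D \<le> B * (l / 4 * A) + y" for A B D x y :: real
      proof -
        have "B * (l / 2 * A - D) = l / 2 * (A * B) - B * D" "B * (l / 4 * A) = l / 4 * (A * B)"
          by (simp_all add: algebra_simps)
        with that show ?thesis by linarith
      qed
      ultimately have "l / 4 * (max 0 (\<theta> \<xi>) ^ s * exp ((2 + p) * f \<xi>) ^ 3 * exp (2 * (c - 1) * f \<xi>))
          \<le> d1 \<xi> + \<kappa> / r\<^sup>2 * d2 \<xi> + b" by blast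
      then show ?thesis using \<xi> by (simp only: H_def indicator_simps mult_1_right mult.assoc)
    qed
    have H0: "0 \<le> H \<xi>" for \<xi>
    proof (cases "\<xi> \<in> T")
      case True
      have "0 \<le> l / 4 * (max 0 (\<theta> \<xi>) ^ s * (exp ((2 + p) * f \<xi>) ^ 3 * exp (2 * (c - 1) * f \<xi>)))" using K by simp
      then show ?thesis using lower[OF True] by linarith
    qed (simp add: H_def z12)
    have pt: "ennreal (u \<xi> powr (3 * q - qstar)) * indicator (heis_ball \<xi>0 r) \<xi> \<le> ennreal (c2 * H \<xi>)" for \<xi>
    proof (cases "\<xi> \<in> heis_ball \<xi>0 r")
      case True
      then have g: "gauge4 \<xi>0 \<xi> < r ^ 4" unfolding heis_ball_eq[OF r] by simp
      have e: "15 / 16 \<le> max 0 (\<theta> \<xi>)"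
      proof -
        have "gauge4 \<xi>0 \<xi> / (2 * r) ^ 4 \<le> 1 / 16"
          using g r by (simp add: power_mult_distrib field_simps)
        then show ?thesis by (simp add: \<theta>_def cutoff_def)
      qed
      then have \<xi>T: "\<xi> \<in> T" by (simp add: T_def)
      then have u0: "0 < u \<xi>" using TS u(2) by blast
      have "u \<xi> powr (3 * q - qstar) = exp ((2 + p) * f \<xi>) ^ 3 * exp (2 * (c - 1) * f \<xi>)"
      proof -
        \<comment> \<open>Three factors u^(q-1) and the weight u^(2(n-1)/n) add up to the exponent
          3q - q*.\<close>
        have "(3 * q - qstar) * ln (u \<xi>) = (3 * (2 + p) + 2 * (c - 1)) * f \<xi>"
          using c by (simp add: f_def p_def qstar field_simps)
        then show ?thesis using u0 by (simp add: powr_def algebra_simps flip: exp_add exp_of_nat_mult)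
      qed
      also have "\<dots> \<le> (16 / 15 * max 0 (\<theta> \<xi>)) ^ s * (exp ((2 + p) * f \<xi>) ^ 3 * exp (2 * (c - 1) * f \<xi>))"
      proof -
        have "1 \<le> (16 / 15 * max 0 (\<theta> \<xi>)) ^ s" using e by (intro one_le_power) simp
        from mult_right_mono[OF this, of "exp ((2 + p) * f \<xi>) ^ 3 * exp (2 * (c - 1) * f \<xi>)"] show ?thesis by simp
      qed
      also have "\<dots> = c2 * (l / 4 * (max 0 (\<theta> \<xi>) ^ s * (exp ((2 + p) * f \<xi>) ^ 3 * exp (2 * (c - 1) * f \<xi>))))"
        unfolding c2_def power_mult_distrib using K by simp
      also have "\<dots> \<le> c2 * H \<xi>" using lower[OF \<xi>T] c2 by (intro mult_left_mono) auto
      finally show ?thesis using True by (simp add: ennreal_leI)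
    qed simp
    have "(\<integral>\<^sup>+ \<xi>\<in>heis_ball \<xi>0 r. ennreal (u \<xi> powr (3 * q - qstar)) \<partial>lborel) \<le> (\<integral>\<^sup>+ \<xi>. ennreal (c2 * H \<xi>) \<partial>lborel)"
      by (intro nn_integral_mono pt)
    also have "\<dots> = ennreal (c2 * (b * measure lborel T))"
    proof -
      have "has_bochner_integral lborel (\<lambda>\<xi>. c2 * H \<xi>) (c2 * (b * measure lborel T))"
        using has_bochner_integral_mult_right[OF hH, of c2] by simp
      then show ?thesis
        using nn_integral_eq_integral[of lborel "\<lambda>\<xi>. c2 * H \<xi>"] H0 c2
        by (simp add: has_bochner_integral_iff)
    qed
    also have "\<dots> \<le> ennreal (Cf * r powr (Q - 2 * ((3 * q - qstar) / (q - 1))))"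
    proof (rule ennreal_leI)
      have "c2 * (b * measure lborel T) \<le> c2 * (b * (v * r ^ (2 * CARD('n) + 2)))"
        using mT b c2 by (intro mult_left_mono) auto
      also have "\<dots> = c2 * C1 * v * (r powr (- 6 - 2 * M) * r powr Q)"
      proof -
        have "r ^ (2 * CARD('n) + 2) = r powr Q"
          using assms(1) powr_realpow[OF r, of "2 * CARD('n) + 2", symmetric] by (simp add: add.commute)
        then show ?thesis by (simp add: b_def)
      qed
      also have "\<dots> = c2 * C1 * v * r powr (Q - 2 * ((3 * q - qstar) / (q - 1)))"
        unfolding qe by (simp flip: powr_add add: algebra_simps)
      also have "\<dots> \<le> Cf * r powr (Q - 2 * ((3 * q - qstar) / (q - 1)))"
        by (intro mult_right_mono) (auto simp: Cf_def)
      finally show "c2 * (b * measure lborel T) \<le> Cf * r powr (Q - 2 * ((3 * q - qstar) / (q - 1)))" .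
    qed
    finally show ?thesis .
  qed
  show ?thesis
    by (rule exI[of _ Cf]) (use Cf main in blast)
qed

end
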